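(* Let $p_{Z|XY}$ be in normal form and let $p_X$, $p_Y$ be distributions with full support on $\mathcal X$, $\mathcal Y$. Any secure protocol $\Pi(p_Xp_Y,p_{Z|XY})$ (i.e. with independent inputs $X\sim p_X$, $Y\sim p_Y$) satisfies \begin{align*} H(M_{23})&\ge RI(X;Z)+H(Y,Z|X),\\ H(M_{31})&\ge RI(Y;Z)+H(X,Z|Y),\\ H(M_{12})&\ge RI(X;Z)+RI(Y;Z)+H(X,Y|Z). \end{align*}
   Context: Setting: $\mathcal X,\mathcal Y,\mathcal Z$ finite sets; Alice (party 1) holds $X\in\mathcal X$, Bob (party 2) holds $Y\in\mathcal Y$, $(X,Y)\sim p_{XY}$; Charlie (party 3) has no input and outputs $Z\in\mathcal Z$; a randomized function is a conditional distribution $p_{Z|XY}$. In a protocol the parties, each with private randomness (no shared randomness), exchange messages over multiple rounds on three pairwise private links, each message a codeword of a prefix-free code determined by previous messages on that link; the protocol terminates with probability 1 and may depend on $p_{XY}$. $M_{12},M_{23},M_{31}$ are the final transcripts on the Alice–Bob, Bob–Charlie, Charlie–Alice links. A secure protocol $\Pi(p_{XY},p_{Z|XY})$ satisfies correctness (on inputs $x,y$ Charlie's output has distribution $p_{Z|X=x,Y=y}$) and privacy (Markov chains $(M_{12},M_{31})-X-(Y,Z)$, $(M_{12},M_{23})-Y-(X,Z)$, $(M_{23},M_{31})-Z-(X,Y)$). Normal form: $p_{Z|XY}$ is in normal form if $p(z|x,y)=p(z|x',y)\ \forall y,z$ implies $x=x'$; $p(z|x,y)=p(z|x,y')\ \forall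 x,z$ implies $y=y'$; and $p(z|x,y)=c\,p(z'|x,y)\ \forall x,y$ for a constant $c$ implies $z=z'$. $RI(U;V)=I(U;V)-H(U\sqcap V)$ where $U\sqcap V$ has maximum entropy among random variables of the form $f(U)=g(V)$. Logs base 2. *)

theory Defs
  imports "HOL-Probability.Probability"
begin

text \<open>Messages are bit strings. Each round, every party sends one (possibly empty)
message to each other party. A link transcript is the list, round by round, of the
pair of messages exchanged on that link.
Conventions:
  L12 entries: (Alice to Bob, Bob to Alice);
  L23 entries: (Bob to Charlie, Charlie to Bob);
  L31 entries: (Charlie to Alice, Alice to Charlie).
Private randomness is modelled by behavioural strategies: in each round each party
samples its outgoing messages from a distribution depending on its input and its whole
view (all messages it sent and received), independently of the other parties.\<close>

type_synonym msg = "bool list"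
type_synonym trans = "(msg \<times> msg) list"
type_synonym state = "trans \<times> trans \<times> trans"

record ('x, 'y, 'z) protocol =
  alice :: "'x \<Rightarrow> trans \<Rightarrow> trans \<Rightarrow> (msg \<times> msg) pmf"
    \<comment> \<open>input x, view (L12, L31); returns (message to Bob, message to Charlie)\<close>
  bob :: "'y \<Rightarrow> trans \<Rightarrow> trans \<Rightarrow> (msg \<times> msg) pmf"
    \<comment> \<open>input y, view (L12, L23); returns (message to Alice, message to Charlie)\<close>
  charlie :: "trans \<Rightarrow> trans \<Rightarrow> (msg \<times> msg) pmf"
    \<comment> \<open>view (L23, L31); returns (message to Bob, message to Alice)\<close>
  outp :: "trans \<Rightarrow> trans \<Rightarrow> 'z pmf"
    \<comment> \<open>Charlie's output from its final view (M23, M31)\<close>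

definition step :: "('x, 'y, 'z) protocol \<Rightarrow> 'x \<Rightarrow> 'y \<Rightarrow> state \<Rightarrow> state pmf" where
  "step P x y s = (case s of (l12, l23, l31) \<Rightarrow>
     bind_pmf (alice P x l12 l31) (\<lambda>(a2, a3).
     bind_pmf (bob P y l12 l23) (\<lambda>(b1, b3).
     bind_pmf (charlie P l23 l31) (\<lambda>(c2, c1).
     return_pmf (l12 @ [(a2, b1)], l23 @ [(b3, c2)], l31 @ [(c1, a3)])))))"

primrec exec :: "('x, 'y, 'z) protocol \<Rightarrow> 'x \<Rightarrow> 'y \<Rightarrow> nat \<Rightarrow> state pmf" where
  "exec P x y 0 = return_pmf ([], [], [])"
| "exec P x y (Suc n) = bind_pmf (exec P x y n) (step P x y)"

definition empties :: "nat \<Rightarrow> trans" where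
  "empties k = replicate k ([], [])"

definition quiescent :: "('x, 'y, 'z) protocol \<Rightarrow> 'x \<Rightarrow> 'y \<Rightarrow> state \<Rightarrow> bool" where
  "quiescent P x y s = (case s of (l12, l23, l31) \<Rightarrow>
     (\<forall>k. alice P x (l12 @ empties k) (l31 @ empties k) = return_pmf ([], [])
        \<and> bob P y (l12 @ empties k) (l23 @ empties k) = return_pmf ([], [])
        \<and> charlie P (l23 @ empties k) (l31 @ empties k) = return_pmf ([], [])))"

text \<open>Final transcript of a link: the round-by-round transcript with the trailing
(empty) rounds after termination removed.\<close>
definition strip :: "trans \<Rightarrow> trans" where
  "strip l = rev (dropWhile (\<lambda>m. m = ([], [])) (rev l))"

type_synonym ('x, 'y, 'z) outcome = "'x \<times> 'y \<times> 'z \<times> trans \<times> trans \<times> trans"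

definition oX :: "('x, 'y, 'z) outcome \<Rightarrow> 'x" where "oX w = fst w"
definition oY :: "('x, 'y, 'z) outcome \<Rightarrow> 'y" where "oY w = fst (snd w)"
definition oZ :: "('x, 'y, 'z) outcome \<Rightarrow> 'z" where "oZ w = fst (snd (snd w))"
definition oM12 :: "('x, 'y, 'z) outcome \<Rightarrow> trans" where "oM12 w = fst (snd (snd (snd w)))"
definition oM23 :: "('x, 'y, 'z) outcome \<Rightarrow> trans" where "oM23 w = fst (snd (snd (snd (snd w))))"
definition oM31 :: "('x, 'y, 'z) outcome \<Rightarrow> trans" where "oM31 w = snd (snd (snd (snd (snd w))))"

definition run :: "('x, 'y, 'z) protocol \<Rightarrow> 'x pmf \<Rightarrow> 'y pmf \<Rightarrow> nat
                    \<Rightarrow> (bool \<times> ('x, 'y, 'z) outcome) pmf" where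
  "run P pX pY n =
     bind_pmf pX (\<lambda>x. bind_pmf pY (\<lambda>y. bind_pmf (exec P x y n) (\<lambda>(l12, l23, l31).
       map_pmf (\<lambda>z. (quiescent P x y (l12, l23, l31), (x, y, z, strip l12, strip l23, strip l31)))
         (outp P (strip l23) (strip l31)))))"

definition terminates :: "('x, 'y, 'z) protocol \<Rightarrow> 'x pmf \<Rightarrow> 'y pmf \<Rightarrow> bool" where
  "terminates P pX pY \<longleftrightarrow>
     (\<lambda>n. measure_pmf.prob (run P pX pY n) {r. fst r}) \<longlonglongrightarrow> 1"

definition protocol_outcome ::
  "('x, 'y, 'z) protocol \<Rightarrow> 'x pmf \<Rightarrow> 'y pmf \<Rightarrow> ('x, 'y, 'z) outcome pmf \<Rightarrow> bool" where
  "protocol_outcome P pX pY D \<longleftrightarrow> terminates P pX pY \<and>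
     (\<forall>w. (\<lambda>n. measure_pmf.prob (run P pX pY n) {(True, w)}) \<longlonglongrightarrow> pmf D w)"

definition markov :: "'w pmf \<Rightarrow> ('w \<Rightarrow> 'a) \<Rightarrow> ('w \<Rightarrow> 'b) \<Rightarrow> ('w \<Rightarrow> 'c) \<Rightarrow> bool" where
  "markov D f g h \<longleftrightarrow> (\<forall>a b c.
     measure_pmf.prob D {w. f w = a \<and> g w = b \<and> h w = c} * measure_pmf.prob D {w. g w = b}
     = measure_pmf.prob D {w. f w = a \<and> g w = b} * measure_pmf.prob D {w. g w = b \<and> h w = c})"

definition ent :: "'a pmf \<Rightarrow> real" where
  "ent p = (\<Sum>a\<in>set_pmf p. - pmf p a * log 2 (pmf p a))"

definition ent_inf :: "'a pmf \<Rightarrow> ennreal" where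
  "ent_inf p = (\<integral>\<^sup>+ a. ennreal (- pmf p a * log 2 (pmf p a)) \<partial>count_space UNIV)"

definition H :: "'w pmf \<Rightarrow> ('w \<Rightarrow> 'a) \<Rightarrow> real" where
  "H D f = ent (map_pmf f D)"

definition cond_H :: "'w pmf \<Rightarrow> ('w \<Rightarrow> 'a) \<Rightarrow> ('w \<Rightarrow> 'b) \<Rightarrow> real" where
  "cond_H D f g = H D (\<lambda>w. (f w, g w)) - H D g"

definition MI :: "'w pmf \<Rightarrow> ('w \<Rightarrow> 'a) \<Rightarrow> ('w \<Rightarrow> 'b) \<Rightarrow> real" where
  "MI D f g = H D f + H D g - H D (\<lambda>w. (f w, g w))"

text \<open>Entropy of the Gacs-Koerner common part U \<sqinter> V: maximal entropy of a random variable
of the form phi(U) = psi(V) (almost surely).\<close>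
definition GK :: "'w pmf \<Rightarrow> ('w \<Rightarrow> 'a) \<Rightarrow> ('w \<Rightarrow> 'b) \<Rightarrow> real" where
  "GK D f g = Sup {H D (\<phi> \<circ> f) | (\<phi> :: 'a \<Rightarrow> nat) (\<psi> :: 'b \<Rightarrow> nat).
                      \<forall>w\<in>set_pmf D. \<phi> (f w) = \<psi> (g w)}"

definition RI :: "'w pmf \<Rightarrow> ('w \<Rightarrow> 'a) \<Rightarrow> ('w \<Rightarrow> 'b) \<Rightarrow> real" where
  "RI D f g = MI D f g - GK D f g"

definition normal_form :: "('x \<Rightarrow> 'y \<Rightarrow> 'z pmf) \<Rightarrow> bool" where
  "normal_form W \<longleftrightarrow>
     (\<forall>x x'. (\<forall>y z. pmf (W x y) z = pmf (W x' y) z) \<longrightarrow> x = x') \<and>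
     (\<forall>y y'. (\<forall>x z. pmf (W x y) z = pmf (W x y') z) \<longrightarrow> y = y') \<and>
     (\<forall>z z'. (\<exists>c::real. \<forall>x y. pmf (W x y) z = c * pmf (W x y) z') \<longrightarrow> z = z')"

definition correct :: "('x \<Rightarrow> 'y \<Rightarrow> 'z pmf) \<Rightarrow> ('x, 'y, 'z) outcome pmf \<Rightarrow> bool" where
  "correct W D \<longleftrightarrow> (\<forall>x y z.
     measure_pmf.prob D {w. oX w = x \<and> oY w = y \<and> oZ w = z}
     = measure_pmf.prob D {w. oX w = x \<and> oY w = y} * pmf (W x y) z)"

definition is_private :: "('x, 'y, 'z) outcome pmf \<Rightarrow> bool" where
  "is_private D \<longleftrightarrow>
     markov D (\<lambda>w. (oM12 w, oM31 w)) oX (\<lambda>w. (oY w, oZ w)) \<and>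
     markov D (\<lambda>w. (oM12 w, oM23 w)) oY (\<lambda>w. (oX w, oZ w)) \<and>
     markov D (\<lambda>w. (oM23 w, oM31 w)) oZ (\<lambda>w. (oX w, oY w))"

definition secure_protocol ::
  "'x pmf \<Rightarrow> 'y pmf \<Rightarrow> ('x \<Rightarrow> 'y \<Rightarrow> 'z pmf) \<Rightarrow> ('x, 'y, 'z) protocol
     \<Rightarrow> ('x, 'y, 'z) outcome pmf \<Rightarrow> bool" where
  "secure_protocol pX pY W P D \<longleftrightarrow>
     protocol_outcome P pX pY D \<and> correct W D \<and> is_private D"

end

theory Submission
  imports Defs
begin

text \<open>Write \<open>A, B, C\<close> for the transcripts of the links 12, 23, 31. By privacy, normal form and the
product form of the law of the transcripts, the two links of a party determine its input (for
Charlie, its output). Hence \<open>H(B|A,C) \<ge> H(Y,Z|X)\<close>, and cyclically.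
Given the Gacs-Koerner common part \<open>Q\<close> of \<open>X\<close> and \<open>Z\<close>, the transcript \<open>C\<close> is independent of
\<open>(X,Z)\<close>, so \<open>I(A;B|C) \<ge> I(X;Z|Q) = RI(X;Z)\<close>; this gives the bounds for \<open>B\<close> and \<open>C\<close>.
For \<open>A\<close> one also needs \<open>I(A;B) \<ge> I(A;B|C)\<close>. For independent inputs no message sent during the
protocol decreases \<open>I(A;B) - I(A;B|C)\<close>, which is \<open>0\<close> at the start; the inequality is
transferred to the final transcripts by letting the number of rounds tend to infinity.
Transcripts may have infinite entropy, so inequalities are stated additively between
conditional entropies in \<open>[0, \<infinity>]\<close>.\<close>

section \<open>Extended conditional entropy\<close>

text \<open>The link 12 is harder because two residual terms are charged to it. For link 23, H(B) >=
  H(B|C) = H(B|A,C) + I(A;B|C), and the gap I(A;B|C) absorbs the only residual term; link 31 is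
  alike. For A the gaps I(A;B|C) and I(A;C|B) are both needed, and they add up only if H(A|B) +
  H(A|C) <= H(A) + H(A|B,C). General triples violate this: take independent fair bits A, B and let C
  be their sum mod 2. For protocols it holds because the messages that a party sends are, given the
  two links it sees, independent of the third link. That in turn needs the likelihood of a
  transcript, averaged over the inputs, to be a product with one factor per party, which is where
  independence of the inputs enters. The number of rounds is unbounded, so the induction concerns
  the first n rounds, read as functions of the final outcome; all rounds then live on the one space
  \<open>D\<close>. In the limit the left side is handled by Fatou's lemma, but H(A|B,C) must be
  bounded from below by its truncated versions, against the direction of Fatou; this is possible
  when H(A) is finite, and for infinite H(A) the inequality is trivial.\<close>

definition cell :: "'w pmf \<Rightarrow> ('w \<Rightarrow> 'a) \<Rightarrow> 'w \<Rightarrow> real" where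
  "cell D f w = measure_pmf.prob D {v. f v = f w}"

text \<open>The mean of the conditional information density. It has a value even when H(f,g) and
  H(g) are both infinite and their difference is meaningless. On the support the integrand is
  nonnegative, so \<open>ennreal\<close> cuts nothing off.\<close>

definition cond_ent :: "'w pmf \<Rightarrow> ('w \<Rightarrow> 'a) \<Rightarrow> ('w \<Rightarrow> 'b) \<Rightarrow> ennreal" where
  "cond_ent D f g = (\<integral>\<^sup>+ w. ennreal (log 2 (cell D g w) - log 2 (cell D (\<lambda>v. (f v, g v)) w)) \<partial>measure_pmf D)"

definition determines :: "'w pmf \<Rightarrow> ('w \<Rightarrow> 'b) \<Rightarrow> ('w \<Rightarrow> 'a) \<Rightarrow> bool" where
  "determines D g f \<longleftrightarrow> (\<forall>v\<in>set_pmf D. \<forall>w\<in>set_pmf D. g v = g w \<longrightarrow> f v = f w)"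

lemma determinesD:
  "determines D g f \<Longrightarrow> v \<in> set_pmf D \<Longrightarrow> w \<in> set_pmf D \<Longrightarrow> g v = g w \<Longrightarrow> f v = f w"
  unfolding determines_def by blast

lemma prob_mono_set_pmf:
  assumes "\<And>v. v \<in> set_pmf D \<Longrightarrow> v \<in> S \<Longrightarrow> v \<in> T"
  shows "measure_pmf.prob D S \<le> measure_pmf.prob D T"
proof -
  have "measure_pmf.prob D (S \<inter> set_pmf D) \<le> measure_pmf.prob D (T \<inter> set_pmf D)"
    using assms by (intro measure_pmf.finite_measure_mono) auto
  then show ?thesis by (simp add: measure_Int_set_pmf)
qed

lemma prob_cong_set_pmf:
  assumes "\<And>v. v \<in> set_pmf D \<Longrightarrow> v \<in> S \<longleftrightarrow> v \<in> T"
  shows "measure_pmf.prob D S = measure_pmf.prob D T"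
  using assms by (meson antisym prob_mono_set_pmf)

lemma cell_pos: "w \<in> set_pmf D \<Longrightarrow> cell D f w > 0"
  unfolding cell_def by (rule measure_pmf_posI[of w]) simp_all

lemma cell_le_1: "cell D f w \<le> 1"
  by (simp add: cell_def)

lemma cell_mono:
  assumes "\<And>v. v \<in> set_pmf D \<Longrightarrow> f v = f w \<Longrightarrow> g v = g w"
  shows "cell D f w \<le> cell D g w"
  unfolding cell_def by (rule prob_mono_set_pmf) (simp, rule assms)

lemma cell_cong:
  assumes "\<And>v. v \<in> set_pmf D \<Longrightarrow> f v = f w \<longleftrightarrow> g v = g w"
  shows "cell D f w = cell D g w"
  unfolding cell_def by (rule prob_cong_set_pmf) (unfold mem_Collect_eq, rule assms)

lemma log_cell_mono:
  assumes "w \<in> set_pmf D" "\<And>v. v \<in> set_pmf D \<Longrightarrow> f v = f w \<Longrightarrow> g v = g w"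
  shows "log 2 (cell D f w) \<le> log 2 (cell D g w)"
proof -
  have "cell D f w \<le> cell D g w" by (rule cell_mono) (rule assms(2))
  then show ?thesis by (simp add: cell_pos assms(1))
qed

lemma cond_ent_mono_AE:
  assumes "\<And>w. w \<in> set_pmf D \<Longrightarrow>
     log 2 (cell D g w) - log 2 (cell D (\<lambda>v. (f v, g v)) w)
     \<le> log 2 (cell D g' w) - log 2 (cell D (\<lambda>v. (f' v, g' v)) w)"
  shows "cond_ent D f g \<le> cond_ent D f' g'"
  unfolding cond_ent_def
  by (intro nn_integral_mono_AE AE_pmfI ennreal_leI assms)

text \<open>Conditional entropy sees only partitions of the support, so this rule performs all
  reordering and rebracketing of tuples.\<close>

lemma cond_ent_cong:
  assumes "\<And>v w. v \<in> set_pmf D \<Longrightarrow> w \<in> set_pmf D \<Longrightarrow> g v = g w \<longleftrightarrow> g' v = g' w"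
    and "\<And>v w. v \<in> set_pmf D \<Longrightarrow> w \<in> set_pmf D \<Longrightarrow> g v = g w \<Longrightarrow> f v = f w \<longleftrightarrow> f' v = f' w"
  shows "cond_ent D f g = cond_ent D f' g'"
proof -
  have "cell D g w = cell D g' w" if "w \<in> set_pmf D" for w
    using assms(1)[OF _ that] by (rule cell_cong)
  moreover have "cell D (\<lambda>v. (f v, g v)) w = cell D (\<lambda>v. (f' v, g' v)) w" if "w \<in> set_pmf D" for w
    by (rule cell_cong) (use assms[OF _ that] in blast)
  ultimately show ?thesis by (intro antisym cond_ent_mono_AE) auto
qed

lemma cond_ent_chain: "cond_ent D (\<lambda>w. (f w, g w)) k = cond_ent D g k + cond_ent D f (\<lambda>w. (g w, k w))"
proof -
  have "cond_ent D g k + cond_ent D f (\<lambda>w. (g w, k w)) =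
    (\<integral>\<^sup>+ w. ennreal (log 2 (cell D k w) - log 2 (cell D (\<lambda>v. (g v, k v)) w))
      + ennreal (log 2 (cell D (\<lambda>v. (g v, k v)) w) - log 2 (cell D (\<lambda>v. (f v, g v, k v)) w)) \<partial>measure_pmf D)"
    unfolding cond_ent_def by (subst nn_integral_add) auto
  also have "\<dots> = cond_ent D (\<lambda>w. (f w, g w)) k"
    unfolding cond_ent_def
  proof (intro nn_integral_cong_AE AE_pmfI)
    fix w assume w: "w \<in> set_pmf D"
    have "cell D (\<lambda>v. ((f v, g v), k v)) w = cell D (\<lambda>v. (f v, g v, k v)) w"
      by (rule cell_cong) auto
    moreover have "log 2 (cell D (\<lambda>v. (g v, k v)) w) \<le> log 2 (cell D k w)"
      "log 2 (cell D (\<lambda>v. (f v, g v, k v)) w) \<le> log 2 (cell D (\<lambda>v. (g v, k v)) w)"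
      by (rule log_cell_mono[OF w]; auto)+
    ultimately show "ennreal (log 2 (cell D k w) - log 2 (cell D (\<lambda>v. (g v, k v)) w))
      + ennreal (log 2 (cell D (\<lambda>v. (g v, k v)) w) - log 2 (cell D (\<lambda>v. (f v, g v, k v)) w))
      = ennreal (log 2 (cell D k w) - log 2 (cell D (\<lambda>v. ((f v, g v), k v)) w))"
      by (simp flip: ennreal_plus)
  qed
  finally show ?thesis by simp
qed

lemma cond_ent_eq_0:
  assumes "determines D g f" shows "cond_ent D f g = 0"
proof -
  have "cond_ent D f g = (\<integral>\<^sup>+ w. 0 \<partial>measure_pmf D)"
    unfolding cond_ent_def
  proof (intro nn_integral_cong_AE AE_pmfI)
    fix w assume w: "w \<in> set_pmf D"
    have "cell D (\<lambda>v. (f v, g v)) w = cell D g w"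
      using w by (intro cell_cong) (auto intro: determinesD[OF assms])
    then show "ennreal (log 2 (cell D g w) - log 2 (cell D (\<lambda>v. (f v, g v)) w)) = 0" by simp
  qed
  then show ?thesis by simp
qed

lemma cond_ent_mono_determines:
  assumes "determines D (\<lambda>w. (f' w, g w)) f" shows "cond_ent D f g \<le> cond_ent D f' g"
proof (rule cond_ent_mono_AE)
  fix w assume w: "w \<in> set_pmf D"
  have "log 2 (cell D (\<lambda>v. (f' v, g v)) w) \<le> log 2 (cell D (\<lambda>v. (f v, g v)) w)"
    using w by (intro log_cell_mono) (auto intro: determinesD[OF assms])
  then show "log 2 (cell D g w) - log 2 (cell D (\<lambda>v. (f v, g v)) w)
      \<le> log 2 (cell D g w) - log 2 (cell D (\<lambda>v. (f' v, g v)) w)" by simp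
qed

lemma markov_cell:
  assumes "markov D f g h"
  shows "cell D (\<lambda>v. (f v, g v, h v)) w * cell D g w
     = cell D (\<lambda>v. (f v, g v)) w * cell D (\<lambda>v. (g v, h v)) w"
  using assms unfolding markov_def cell_def by simp

lemma markov_log_cell:
  assumes "markov D f g h" "w \<in> set_pmf D"
  shows "log 2 (cell D (\<lambda>v. (f v, g v, h v)) w) + log 2 (cell D g w)
     = log 2 (cell D (\<lambda>v. (f v, g v)) w) + log 2 (cell D (\<lambda>v. (g v, h v)) w)"
proof -
  note pos = cell_pos[OF assms(2)]
  have "log 2 (cell D (\<lambda>v. (f v, g v, h v)) w * cell D g w)
     = log 2 (cell D (\<lambda>v. (f v, g v)) w * cell D (\<lambda>v. (g v, h v)) w)"
    by (simp only: markov_cell[OF assms(1)])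
  then show ?thesis by (simp add: log_mult_pos pos)
qed

lemma cond_ent_markov:
  assumes "markov D f g h"
  shows "cond_ent D f (\<lambda>w. (g w, h w)) = cond_ent D f g"
  unfolding cond_ent_def
proof (intro nn_integral_cong_AE AE_pmfI)
  fix w assume w: "w \<in> set_pmf D"
  show "ennreal (log 2 (cell D (\<lambda>w. (g w, h w)) w) - log 2 (cell D (\<lambda>v. (f v, g v, h v)) w))
     = ennreal (log 2 (cell D g w) - log 2 (cell D (\<lambda>v. (f v, g v)) w))"
    using markov_log_cell[OF assms w] by (intro arg_cong[where f = ennreal]) linarith
qed

text \<open>Adding \<open>(r - 1) / ln 2\<close> before integrating keeps every integrand nonnegative, so the
inequality also holds when both integrals are infinite.\<close>

lemma gibbs:
  fixes F G r :: "'w \<Rightarrow> real"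
  assumes FG: "\<And>w. w \<in> set_pmf D \<Longrightarrow> 0 \<le> F w \<and> 0 \<le> G w \<and> 0 < r w \<and> F w \<le> G w + log 2 (r w)"
    and r: "(\<integral>\<^sup>+ w. ennreal (r w) \<partial>measure_pmf D) \<le> 1"
  shows "(\<integral>\<^sup>+ w. ennreal (F w) \<partial>measure_pmf D) \<le> (\<integral>\<^sup>+ w. ennreal (G w) \<partial>measure_pmf D)"
proof -
  let ?c = "1 / ln (2::real)"
  have c: "?c > 0" by simp
  have "(\<integral>\<^sup>+ w. ennreal (F w) \<partial>measure_pmf D) + ennreal ?c = (\<integral>\<^sup>+ w. ennreal (F w) + ennreal ?c \<partial>measure_pmf D)"
    by (subst nn_integral_add) (auto simp: measure_pmf.emeasure_space_1)
  also have "\<dots> \<le> (\<integral>\<^sup>+ w. ennreal (G w) + ennreal ?c * ennreal (r w) \<partial>measure_pmf D)"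
  proof (intro nn_integral_mono_AE AE_pmfI)
    fix w assume "w \<in> set_pmf D"
    note w = FG[OF this]
    have "log 2 (r w) \<le> (r w - 1) / ln 2"
      using ln_le_minus_one[of "r w"] w by (simp add: log_def divide_right_mono)
    also have "\<dots> = ?c * r w - ?c" by (simp add: diff_divide_distrib)
    finally have "F w + ?c \<le> G w + ?c * r w" using w by linarith
    then have "ennreal (F w + ?c) \<le> ennreal (G w + ?c * r w)" by (rule ennreal_leI)
    then show "ennreal (F w) + ennreal ?c \<le> ennreal (G w) + ennreal ?c * ennreal (r w)"
      using w c by (simp add: ennreal_plus flip: ennreal_mult)
  qed
  also have "\<dots> = (\<integral>\<^sup>+ w. ennreal (G w) \<partial>measure_pmf D) + ennreal ?c * (\<integral>\<^sup>+ w. ennreal (r w) \<partial>measure_pmf D)"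
    by (simp add: nn_integral_add nn_integral_cmult)
  also have "\<dots> \<le> (\<integral>\<^sup>+ w. ennreal (G w) \<partial>measure_pmf D) + ennreal ?c * 1"
    by (intro add_left_mono mult_left_mono r) auto
  finally show ?thesis by simp
qed

section \<open>Sub-probability kernels and cross entropy\<close>

lemma nn_integral_pmf_Pair:
  "(\<integral>\<^sup>+ a. ennreal (pmf p (a, b)) \<partial>count_space UNIV) = ennreal (pmf (map_pmf snd p) b)"
proof -
  have "(\<integral>\<^sup>+ a. ennreal (pmf p (a, b)) \<partial>count_space UNIV)
      = (\<integral>\<^sup>+ x. ennreal (pmf p x) \<partial>count_space (range (\<lambda>a. (a, b))))"
    by (rule nn_integral_bij_count_space) (auto simp: bij_betw_def inj_on_def)
  also have "\<dots> = emeasure (measure_pmf p) (range (\<lambda>a. (a, b)))"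
    by (simp add: nn_integral_pmf)
  also have "range (\<lambda>a. (a, b)) = snd -` {b}" by force
  finally show ?thesis by (simp add: ennreal_pmf_map)
qed

lemma nn_integral_prob_conj:
  "(\<integral>\<^sup>+ a. ennreal (measure_pmf.prob D {v. f v = a \<and> P v}) \<partial>count_space UNIV) = ennreal (measure_pmf.prob D {v. P v})"
proof -
  have "measure_pmf.prob D {v. f v = a \<and> P v} = pmf (map_pmf (\<lambda>v. (f v, P v)) D) (a, True)" for a
    by (simp add: pmf_map vimage_def)
  then show ?thesis
    by (simp add: nn_integral_pmf_Pair pmf.map_comp o_def) (simp add: pmf_map vimage_def)
qed

text \<open>The integrand is the likelihood ratio of the law q(a|c) p(c) against the true law
  p(a,c). Its mean is the mass that the former puts on the support of the latter, hence at most 1.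
  This supplies the hypothesis on \<open>r\<close> in \<open>gibbs\<close>.\<close>

lemma nn_integral_kernel_ratio:
  fixes q :: "'a \<Rightarrow> 'b \<Rightarrow> real"
  assumes q0: "\<And>a c. 0 \<le> q a c"
    and q1: "\<And>c. (\<integral>\<^sup>+ a. ennreal (q a c) \<partial>count_space UNIV) \<le> 1"
  shows "(\<integral>\<^sup>+ w. ennreal (q (f w) (g w) * cell D g w / cell D (\<lambda>v. (f v, g v)) w) \<partial>measure_pmf D) \<le> 1"
proof -
  define p where "p = map_pmf (\<lambda>v. (f v, g v)) D"
  define pg where "pg = map_pmf g D"
  have cell: "cell D (\<lambda>v. (f v, g v)) w = pmf p (f w, g w)" "cell D g w = pmf pg (g w)" for w
    by (simp_all add: cell_def p_def pg_def pmf_map vimage_def)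
  have "(\<integral>\<^sup>+ w. ennreal (q (f w) (g w) * cell D g w / cell D (\<lambda>v. (f v, g v)) w) \<partial>measure_pmf D)
     = (\<integral>\<^sup>+ (a, c). ennreal (q a c * pmf pg c / pmf p (a, c)) \<partial>measure_pmf p)"
    by (simp add: p_def[symmetric] cell) (simp add: p_def)
  also have "\<dots> = (\<integral>\<^sup>+ (a, c). ennreal (pmf p (a, c)) * ennreal (q a c * pmf pg c / pmf p (a, c)) \<partial>count_space UNIV)"
    by (subst nn_integral_measure_pmf) (simp add: case_prod_unfold)
  also have "\<dots> \<le> (\<integral>\<^sup>+ (a, c). ennreal (q a c) * ennreal (pmf pg c) \<partial>count_space UNIV)"
  proof (intro nn_integral_mono, clarify)
    fix a c
    have "ennreal (pmf p (a, c)) * ennreal (q a c * pmf pg c / pmf p (a, c))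
      = ennreal (pmf p (a, c) * (q a c * pmf pg c / pmf p (a, c)))"
      using q0 by (intro ennreal_mult[symmetric]) auto
    also have "\<dots> \<le> ennreal (q a c * pmf pg c)" using q0 by (intro ennreal_leI) auto
    finally show "ennreal (pmf p (a, c)) * ennreal (q a c * pmf pg c / pmf p (a, c))
      \<le> ennreal (q a c) * ennreal (pmf pg c)" using q0 by (simp add: ennreal_mult)
  qed
  also have "\<dots> = (\<integral>\<^sup>+ c. \<integral>\<^sup>+ a. ennreal (q a c) * ennreal (pmf pg c) \<partial>count_space UNIV \<partial>count_space UNIV)"
    by (subst nn_integral_snd_count_space[symmetric]) simp
  also have "\<dots> \<le> (\<integral>\<^sup>+ c. ennreal (pmf pg c) \<partial>count_space UNIV)"
  proof (intro nn_integral_mono)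
    fix c
    have "(\<integral>\<^sup>+ a. ennreal (q a c) * ennreal (pmf pg c) \<partial>count_space UNIV)
      = (\<integral>\<^sup>+ a. ennreal (q a c) \<partial>count_space UNIV) * ennreal (pmf pg c)"
      by (simp add: nn_integral_multc)
    also have "\<dots> \<le> 1 * ennreal (pmf pg c)" by (intro mult_right_mono q1) auto
    finally show "(\<integral>\<^sup>+ a. ennreal (q a c) * ennreal (pmf pg c) \<partial>count_space UNIV) \<le> ennreal (pmf pg c)" by simp
  qed
  also have "\<dots> = 1" by (simp add: nn_integral_pmf measure_pmf.emeasure_space_1[simplified])
  finally show ?thesis .
qed

lemma kernel_le_1:
  fixes q :: "'a \<Rightarrow> real"
  assumes "(\<integral>\<^sup>+ a. ennreal (q a) \<partial>count_space UNIV) \<le> 1"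
  shows "q a \<le> 1"
proof -
  have "ennreal (q a) \<le> (\<integral>\<^sup>+ a. ennreal (q a) \<partial>count_space UNIV)"
    by (rule nn_integral_ge_point) simp
  then have "ennreal (q a) \<le> 1" using assms by (rule order_trans)
  then show ?thesis by simp
qed

text \<open>Nonnegativity of relative entropy: an upper bound on a conditional entropy follows from
  any kernel guessed for the conditional law, even if its total mass is below 1.\<close>

lemma cond_ent_le_cross_entropy:
  fixes q :: "'a \<Rightarrow> 'b \<Rightarrow> real"
  assumes q0: "\<And>a c. 0 \<le> q a c"
    and q1: "\<And>c. (\<integral>\<^sup>+ a. ennreal (q a c) \<partial>count_space UNIV) \<le> 1"
    and pos: "\<And>w. w \<in> set_pmf D \<Longrightarrow> q (f w) (g w) > 0"
  shows "cond_ent D f g \<le> (\<integral>\<^sup>+ w. ennreal (- log 2 (q (f w) (g w))) \<partial>measure_pmf D)"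
proof -
  let ?r = "\<lambda>w. q (f w) (g w) * cell D g w / cell D (\<lambda>v. (f v, g v)) w"
  have "0 \<le> log 2 (cell D g w) - log 2 (cell D (\<lambda>v. (f v, g v)) w) \<and>
         0 \<le> - log 2 (q (f w) (g w)) \<and> 0 < ?r w \<and>
         log 2 (cell D g w) - log 2 (cell D (\<lambda>v. (f v, g v)) w)
         \<le> - log 2 (q (f w) (g w)) + log 2 (?r w)" if w: "w \<in> set_pmf D" for w
  proof -
    have "log 2 (cell D (\<lambda>v. (f v, g v)) w) \<le> log 2 (cell D g w)"
      by (rule log_cell_mono[OF w]) auto
    moreover have "log 2 (q (f w) (g w)) \<le> 0"
      using kernel_le_1[OF q1, of "f w" "g w"] pos[OF w] by simp
    moreover have "log 2 (?r w) = log 2 (q (f w) (g w)) + log 2 (cell D g w)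
        - log 2 (cell D (\<lambda>v. (f v, g v)) w)"
      by (simp add: log_mult_pos log_divide_pos pos w cell_pos)
    moreover have "0 < ?r w" by (simp add: pos w cell_pos)
    ultimately show ?thesis by linarith
  qed
  then show ?thesis
    unfolding cond_ent_def by (rule gibbs[OF _ nn_integral_kernel_ratio[of q D f g, OF q0 q1]])
qed

text \<open>For \<open>b\<close> of probability 0 the quotient is 0, so the total mass is then 0
  instead of 1; this is why kernels are only asked to have mass at most 1.\<close>

definition cprob :: "'w pmf \<Rightarrow> ('w \<Rightarrow> 'a) \<Rightarrow> ('w \<Rightarrow> 'b) \<Rightarrow> 'a \<Rightarrow> 'b \<Rightarrow> real" where
  "cprob D f g a b = measure_pmf.prob D {v. f v = a \<and> g v = b} / measure_pmf.prob D {v. g v = b}"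

lemma cprob_nonneg: "0 \<le> cprob D f g a b"
  by (simp add: cprob_def)

lemma cprob_cell: "cprob D f g (f w) (g w) = cell D (\<lambda>v. (f v, g v)) w / cell D g w"
  by (simp add: cprob_def cell_def)

lemma cprob_sum: "(\<integral>\<^sup>+ a. ennreal (cprob D f g a b) \<partial>count_space UNIV) \<le> 1"
proof -
  let ?P = "measure_pmf.prob D {v. g v = b}"
  have "(\<integral>\<^sup>+ a. ennreal (cprob D f g a b) \<partial>count_space UNIV)
      = (\<integral>\<^sup>+ a. ennreal (measure_pmf.prob D {v. f v = a \<and> g v = b}) * ennreal (1 / ?P) \<partial>count_space UNIV)"
    unfolding cprob_def by (intro nn_integral_cong) (simp flip: ennreal_mult)
  also have "\<dots> = ennreal ?P * ennreal (1 / ?P)"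
    by (simp add: nn_integral_multc nn_integral_prob_conj)
  also have "\<dots> = ennreal (?P * (1 / ?P))" by (simp flip: ennreal_mult)
  also have "\<dots> \<le> 1" by simp
  finally show ?thesis .
qed

lemma cond_ent_eq_cross_entropy:
  "cond_ent D f g = (\<integral>\<^sup>+ w. ennreal (- log 2 (cprob D f g (f w) (g w))) \<partial>measure_pmf D)"
  unfolding cond_ent_def
proof (intro nn_integral_cong_AE AE_pmfI)
  fix w assume w: "w \<in> set_pmf D"
  show "ennreal (log 2 (cell D g w) - log 2 (cell D (\<lambda>v. (f v, g v)) w)) =
        ennreal (- log 2 (cprob D f g (f w) (g w)))"
    by (simp add: cprob_cell log_divide_pos cell_pos w)
qed

lemma cprob_pos: "w \<in> set_pmf D \<Longrightarrow> cprob D f g (f w) (g w) > 0"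
  by (simp add: cprob_cell cell_pos)

text \<open>The law of \<open>f\<close> given \<open>g\<close> serves as a guess for the law of
  \<open>f\<close> given \<open>(g, h)\<close>; its cross entropy is exactly H(f|g).\<close>

lemma cond_ent_condition: "cond_ent D f (\<lambda>w. (g w, h w)) \<le> cond_ent D f g"
proof -
  have "cond_ent D f (\<lambda>w. (g w, h w))
    \<le> (\<integral>\<^sup>+ w. ennreal (- log 2 ((\<lambda>a (b, c). cprob D f g a b) (f w) (g w, h w))) \<partial>measure_pmf D)"
    by (rule cond_ent_le_cross_entropy) (auto simp: cprob_nonneg cprob_sum cprob_pos)
  then show ?thesis by (simp add: cond_ent_eq_cross_entropy[of D f g])
qed

lemma cond_ent_condition_determines:
  assumes "determines D g' g" shows "cond_ent D f g' \<le> cond_ent D f g"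
proof -
  have "cond_ent D f g' = cond_ent D f (\<lambda>w. (g w, g' w))"
    by (rule cond_ent_cong) (simp, metis determinesD[OF assms], simp)
  then show ?thesis by (simp add: cond_ent_condition)
qed

text \<open>Brings a sum of two conditional entropies under one integral, the shape to which
  \<open>gibbs\<close> and Fatou's lemma apply.\<close>

lemma cond_ent_add:
  "cond_ent D f g + cond_ent D f' g' = (\<integral>\<^sup>+ w. ennreal
     ((log 2 (cell D g w) - log 2 (cell D (\<lambda>v. (f v, g v)) w))
     + (log 2 (cell D g' w) - log 2 (cell D (\<lambda>v. (f' v, g' v)) w))) \<partial>measure_pmf D)"
proof -
  have "cond_ent D f g + cond_ent D f' g' = (\<integral>\<^sup>+ w.
       ennreal (log 2 (cell D g w) - log 2 (cell D (\<lambda>v. (f v, g v)) w))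
     + ennreal (log 2 (cell D g' w) - log 2 (cell D (\<lambda>v. (f' v, g' v)) w)) \<partial>measure_pmf D)"
    unfolding cond_ent_def by (subst nn_integral_add) auto
  also have "\<dots> = (\<integral>\<^sup>+ w. ennreal
     ((log 2 (cell D g w) - log 2 (cell D (\<lambda>v. (f v, g v)) w))
     + (log 2 (cell D g' w) - log 2 (cell D (\<lambda>v. (f' v, g' v)) w))) \<partial>measure_pmf D)"
  proof (intro nn_integral_cong_AE AE_pmfI)
    fix w assume w: "w \<in> set_pmf D"
    have "log 2 (cell D (\<lambda>v. (f v, g v)) w) \<le> log 2 (cell D g w)"
      "log 2 (cell D (\<lambda>v. (f' v, g' v)) w) \<le> log 2 (cell D g' w)"
      by (rule log_cell_mono[OF w]; simp)+
    then show "ennreal (log 2 (cell D g w) - log 2 (cell D (\<lambda>v. (f v, g v)) w))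
     + ennreal (log 2 (cell D g' w) - log 2 (cell D (\<lambda>v. (f' v, g' v)) w))
     = ennreal ((log 2 (cell D g w) - log 2 (cell D (\<lambda>v. (f v, g v)) w))
     + (log 2 (cell D g' w) - log 2 (cell D (\<lambda>v. (f' v, g' v)) w)))"
      by (intro ennreal_plus[symmetric]) auto
  qed
  finally show ?thesis .
qed

text \<open>With \<open>d\<close> and \<open>c\<close> conditionally independent given \<open>(a, b)\<close> this reads
\<open>I(a;d|b) \<ge> I(a;d|b,c)\<close>; it is proved by Gibbs' inequality for the kernel of \<open>d\<close> given \<open>b\<close>,
since the entropy of \<open>d\<close> may be infinite.\<close>

lemma cond_ent_exchange:
  assumes "markov D d (\<lambda>w. (a w, b w)) c"
  shows "cond_ent D a (\<lambda>w. (b w, d w)) + cond_ent D a (\<lambda>w. (b w, c w))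
     \<le> cond_ent D a b + cond_ent D a (\<lambda>w. (b w, c w, d w))"
proof -
  let ?L = "\<lambda>f w. log 2 (cell D f w)"
  let ?F = "\<lambda>w. (?L (\<lambda>v. (b v, d v)) w - ?L (\<lambda>v. (a v, b v, d v)) w)
       + (?L (\<lambda>v. (b v, c v)) w - ?L (\<lambda>v. (a v, b v, c v)) w)"
  let ?G = "\<lambda>w. (?L b w - ?L (\<lambda>v. (a v, b v)) w)
       + (?L (\<lambda>v. (b v, c v, d v)) w - ?L (\<lambda>v. (a v, b v, c v, d v)) w)"
  let ?q = "\<lambda>x (y, z). cprob D d b x y"
  let ?r = "\<lambda>w. ?q (d w) (b w, c w) * cell D (\<lambda>w. (b w, c w)) w / cell D (\<lambda>v. (d v, b v, c v)) w"
  have "0 \<le> ?F w \<and> 0 \<le> ?G w \<and> 0 < ?r w \<and> ?F w \<le> ?G w + log 2 (?r w)"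
    if w: "w \<in> set_pmf D" for w
  proof -
    have "?L (\<lambda>v. (d v, (a v, b v), c v)) w + ?L (\<lambda>v. (a v, b v)) w
       = ?L (\<lambda>v. (d v, a v, b v)) w + ?L (\<lambda>v. ((a v, b v), c v)) w"
      using markov_log_cell[OF assms w] by simp
    moreover have "cell D (\<lambda>v. (d v, (a v, b v), c v)) w = cell D (\<lambda>v. (a v, b v, c v, d v)) w"
      "cell D (\<lambda>v. (d v, a v, b v)) w = cell D (\<lambda>v. (a v, b v, d v)) w"
      "cell D (\<lambda>v. ((a v, b v), c v)) w = cell D (\<lambda>v. (a v, b v, c v)) w"
      by (rule cell_cong; blast)+
    \<comment> \<open>By this identity all terms containing \<open>a\<close> cancel in
      \<open>?F w - ?G w\<close>, and what is left is exactly \<open>log 2 (?r w)\<close>.\<close>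
    ultimately have m: "?L (\<lambda>v. (a v, b v, c v, d v)) w + ?L (\<lambda>v. (a v, b v)) w
       = ?L (\<lambda>v. (a v, b v, d v)) w + ?L (\<lambda>v. (a v, b v, c v)) w" by simp
    have "cell D (\<lambda>v. (d v, b v)) w = cell D (\<lambda>v. (b v, d v)) w"
      "cell D (\<lambda>v. (d v, b v, c v)) w = cell D (\<lambda>v. (b v, c v, d v)) w"
      by (rule cell_cong; blast)+
    then have r: "log 2 (?r w) = ?L (\<lambda>v. (b v, d v)) w - ?L b w + ?L (\<lambda>v. (b v, c v)) w
        - ?L (\<lambda>v. (b v, c v, d v)) w"
      by (simp add: cprob_cell log_mult_pos log_divide_pos cell_pos w)
    have "0 < ?r w" by (simp add: cprob_pos w cell_pos)
    moreover have "?L (\<lambda>v. (a v, b v, d v)) w \<le> ?L (\<lambda>v. (b v, d v)) w"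
      "?L (\<lambda>v. (a v, b v, c v)) w \<le> ?L (\<lambda>v. (b v, c v)) w"
      "?L (\<lambda>v. (a v, b v)) w \<le> ?L b w"
      "?L (\<lambda>v. (a v, b v, c v, d v)) w \<le> ?L (\<lambda>v. (b v, c v, d v)) w"
      by (rule log_cell_mono[OF w]; simp)+
    ultimately show ?thesis using r m by linarith
  qed
  moreover have "(\<integral>\<^sup>+ w. ennreal (?r w) \<partial>measure_pmf D) \<le> 1"
    by (rule nn_integral_kernel_ratio) (auto simp: cprob_nonneg cprob_sum)
  ultimately show ?thesis
    unfolding cond_ent_add by (rule gibbs)
qed

section \<open>Conditional independence and interaction information\<close>

lemma markov_sym: "markov D f g h \<Longrightarrow> markov D h g f"
  unfolding markov_def by (simp add: conj_ac mult.commute)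

text \<open>The factors need not be normalised and their marginal sums \<open>?F\<close>,
  \<open>?G\<close> are not known to be finite. All four probabilities are therefore written as
  products in \<open>ennreal\<close>, where rearranging is unconditional.\<close>

lemma markovI_prod:
  assumes eq: "\<And>a b c. measure_pmf.prob D {w. f w = a \<and> g w = b \<and> h w = c} = F a b * G b c"
    and nonneg: "\<And>a b. 0 \<le> F a b" "\<And>b c. 0 \<le> G b c"
  shows "markov D f g h"
  unfolding markov_def
proof (intro allI)
  fix a b c
  let ?P = "\<lambda>Q. measure_pmf.prob D {w. Q w}"
  let ?F = "\<integral>\<^sup>+ a. ennreal (F a b) \<partial>count_space UNIV"
  let ?G = "\<integral>\<^sup>+ c. ennreal (G b c) \<partial>count_space UNIV"
  have 1: "ennreal (?P (\<lambda>w. f w = a \<and> g w = b)) = ennreal (F a b) * ?G" for a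
  proof -
    have "ennreal (?P (\<lambda>w. f w = a \<and> g w = b)) = (\<integral>\<^sup>+ c. ennreal (?P (\<lambda>w. h w = c \<and> f w = a \<and> g w = b)) \<partial>count_space UNIV)"
      by (rule nn_integral_prob_conj[symmetric])
    also have "\<dots> = (\<integral>\<^sup>+ c. ennreal (F a b) * ennreal (G b c) \<partial>count_space UNIV)"
      by (intro nn_integral_cong) (simp add: conj_ac eq[symmetric] nonneg flip: ennreal_mult)
    finally show ?thesis by (simp add: nn_integral_cmult)
  qed
  have 2: "ennreal (?P (\<lambda>w. g w = b \<and> h w = c)) = ?F * ennreal (G b c)"
  proof -
    have "ennreal (?P (\<lambda>w. g w = b \<and> h w = c)) = (\<integral>\<^sup>+ a. ennreal (?P (\<lambda>w. f w = a \<and> g w = b \<and> h w = c)) \<partial>count_space UNIV)"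
      by (rule nn_integral_prob_conj[symmetric])
    also have "\<dots> = (\<integral>\<^sup>+ a. ennreal (F a b) * ennreal (G b c) \<partial>count_space UNIV)"
      by (intro nn_integral_cong) (simp add: eq nonneg flip: ennreal_mult)
    finally show ?thesis by (simp add: nn_integral_multc)
  qed
  have 3: "ennreal (?P (\<lambda>w. g w = b)) = ?F * ?G"
  proof -
    have "ennreal (?P (\<lambda>w. g w = b)) = (\<integral>\<^sup>+ a. ennreal (?P (\<lambda>w. f w = a \<and> g w = b)) \<partial>count_space UNIV)"
      by (rule nn_integral_prob_conj[symmetric])
    then show ?thesis by (simp add: 1 nn_integral_multc)
  qed
  have "ennreal (?P (\<lambda>w. f w = a \<and> g w = b \<and> h w = c) * ?P (\<lambda>w. g w = b))
      = (ennreal (F a b) * ennreal (G b c)) * (?F * ?G)"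
    by (simp add: eq nonneg 3 ennreal_mult)
  also have "\<dots> = (ennreal (F a b) * ?G) * (?F * ennreal (G b c))" by (simp add: ac_simps)
  also have "\<dots> = ennreal (?P (\<lambda>w. f w = a \<and> g w = b) * ?P (\<lambda>w. g w = b \<and> h w = c))"
    by (simp add: 1 2 ennreal_mult)
  finally show "?P (\<lambda>w. f w = a \<and> g w = b \<and> h w = c) * ?P (\<lambda>w. g w = b)
      = ?P (\<lambda>w. f w = a \<and> g w = b) * ?P (\<lambda>w. g w = b \<and> h w = c)"
    by (subst (asm) ennreal_inj) auto
qed

lemma markov_decompose:
  assumes "markov D f g h" shows "markov D f g (\<lambda>w. \<phi> (h w))"
  unfolding markov_def
proof (intro allI)
  fix a b c
  let ?P = "\<lambda>Q. measure_pmf.prob D {w. Q w}"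
  have "ennreal (?P (\<lambda>w. f w = a \<and> g w = b \<and> \<phi> (h w) = c) * ?P (\<lambda>w. g w = b))
    = (\<integral>\<^sup>+ x. ennreal (?P (\<lambda>w. h w = x \<and> f w = a \<and> g w = b \<and> \<phi> (h w) = c)) \<partial>count_space UNIV) * ennreal (?P (\<lambda>w. g w = b))"
    by (subst nn_integral_prob_conj) (simp add: ennreal_mult)
  also have "\<dots> = (\<integral>\<^sup>+ x. ennreal (?P (\<lambda>w. h w = x \<and> f w = a \<and> g w = b \<and> \<phi> (h w) = c) * ?P (\<lambda>w. g w = b)) \<partial>count_space UNIV)"
    by (simp add: ennreal_mult nn_integral_multc)
  also have "\<dots> = (\<integral>\<^sup>+ x. ennreal (?P (\<lambda>w. f w = a \<and> g w = b) * ?P (\<lambda>w. h w = x \<and> g w = b \<and> \<phi> (h w) = c)) \<partial>count_space UNIV)"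
  proof (intro nn_integral_cong arg_cong[where f = ennreal])
    fix x
    show "?P (\<lambda>w. h w = x \<and> f w = a \<and> g w = b \<and> \<phi> (h w) = c) * ?P (\<lambda>w. g w = b)
      = ?P (\<lambda>w. f w = a \<and> g w = b) * ?P (\<lambda>w. h w = x \<and> g w = b \<and> \<phi> (h w) = c)"
    proof (cases "\<phi> x = c")
      case True
      then have "{w. h w = x \<and> f w = a \<and> g w = b \<and> \<phi> (h w) = c} = {w. f w = a \<and> g w = b \<and> h w = x}"
        "{w. h w = x \<and> g w = b \<and> \<phi> (h w) = c} = {w. g w = b \<and> h w = x}" by auto
      then show ?thesis using assms by (simp add: markov_def)
    next
      case False
      then have "{w. h w = x \<and> f w = a \<and> g w = b \<and> \<phi> (h w) = c} = {}"
        "{w. h w = x \<and> g w = b \<and> \<phi> (h w) = c} = {}" by auto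
      then show ?thesis by (simp only: measure_empty mult_zero_left mult_zero_right)
    qed
  qed
  also have "\<dots> = ennreal (?P (\<lambda>w. f w = a \<and> g w = b)) * (\<integral>\<^sup>+ x. ennreal (?P (\<lambda>w. h w = x \<and> g w = b \<and> \<phi> (h w) = c)) \<partial>count_space UNIV)"
    by (simp add: ennreal_mult nn_integral_cmult)
  also have "\<dots> = ennreal (?P (\<lambda>w. f w = a \<and> g w = b) * ?P (\<lambda>w. g w = b \<and> \<phi> (h w) = c))"
    by (subst nn_integral_prob_conj) (simp add: ennreal_mult)
  finally show "?P (\<lambda>w. f w = a \<and> g w = b \<and> \<phi> (h w) = c) * ?P (\<lambda>w. g w = b)
      = ?P (\<lambda>w. f w = a \<and> g w = b) * ?P (\<lambda>w. g w = b \<and> \<phi> (h w) = c)"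
    by (subst (asm) ennreal_inj) auto
qed

lemma markov_decompose_left:
  assumes "markov D f g h" shows "markov D (\<lambda>w. \<phi> (f w)) g h"
  by (rule markov_sym[OF markov_decompose[OF markov_sym[OF assms], of \<phi>]])

text \<open>The weak union rule of conditional independence. It allows the two messages of one
  sender to be added one after the other, the first becoming part of the condition for the
  second.\<close>

lemma markov_weak_union:
  fixes f :: "'w \<Rightarrow> 'a" and g :: "'w \<Rightarrow> 'b"
  assumes "markov D (\<lambda>w. (f w, f' w)) g h"
  shows "markov D f' (\<lambda>w. (g w, f w)) h"
  unfolding markov_def
proof (intro allI)
  fix a c and b :: "'b \<times> 'a"
  obtain y x where b: "b = (y, x)" by (cases b)
  let ?P = "\<lambda>Q. measure_pmf.prob D {w. Q w}"
  have m: "?P (\<lambda>w. f' w = a \<and> (g w, f w) = b \<and> h w = c) * ?P (\<lambda>w. g w = y)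
     = ?P (\<lambda>w. f' w = a \<and> (g w, f w) = b) * ?P (\<lambda>w. g w = y \<and> h w = c)"
    using assms[unfolded markov_def, rule_format, of "(x, a)" y c] by (simp add: b conj_ac)
  have n: "?P (\<lambda>w. (g w, f w) = b \<and> h w = c) * ?P (\<lambda>w. g w = y)
     = ?P (\<lambda>w. (g w, f w) = b) * ?P (\<lambda>w. g w = y \<and> h w = c)"
    using markov_decompose_left[OF assms, of fst, unfolded markov_def, rule_format, of x y c]
    by (simp add: b conj_ac)
  show "?P (\<lambda>w. f' w = a \<and> (g w, f w) = b \<and> h w = c) * ?P (\<lambda>w. (g w, f w) = b)
      = ?P (\<lambda>w. f' w = a \<and> (g w, f w) = b) * ?P (\<lambda>w. (g w, f w) = b \<and> h w = c)"
  proof (cases "?P (\<lambda>w. g w = y) = 0")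
    case True
    have "?P (\<lambda>w. (g w, f w) = b) \<le> ?P (\<lambda>w. g w = y)"
      "?P (\<lambda>w. (g w, f w) = b \<and> h w = c) \<le> ?P (\<lambda>w. g w = y)"
      by (rule measure_pmf.finite_measure_mono; auto simp: b)+
    then have "?P (\<lambda>w. (g w, f w) = b) = 0" "?P (\<lambda>w. (g w, f w) = b \<and> h w = c) = 0"
      using True by (auto simp: measure_le_0_iff)
    then show ?thesis by simp
  next
    case False
    then show ?thesis using m n
      by algebra
  qed
qed

lemma markov_cong:
  assumes "markov D f g h"
    and "\<And>v. f v = \<phi> (f' v)" "\<And>v. f' v = \<phi>' (f v)"
    and "\<And>v. g v = \<gamma> (g' v)" "\<And>v. g' v = \<gamma>' (g v)"
    and "\<And>v. h v = \<eta> (h' v)" "\<And>v. h' v = \<eta>' (h v)"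
  shows "markov D f' g' h'"
  unfolding markov_def
proof (intro allI)
  fix a b c
  have a: "f' v = a \<longleftrightarrow> f v = \<phi> a \<and> \<phi>' (\<phi> a) = a" for v using assms(2,3) by metis
  have b: "g' v = b \<longleftrightarrow> g v = \<gamma> b \<and> \<gamma>' (\<gamma> b) = b" for v using assms(4,5) by metis
  have c: "h' v = c \<longleftrightarrow> h v = \<eta> c \<and> \<eta>' (\<eta> c) = c" for v using assms(6,7) by metis
  show "measure_pmf.prob D {w. f' w = a \<and> g' w = b \<and> h' w = c} * measure_pmf.prob D {w. g' w = b}
     = measure_pmf.prob D {w. f' w = a \<and> g' w = b} * measure_pmf.prob D {w. g' w = b \<and> h' w = c}"
    using assms(1)[unfolded markov_def, rule_format, of "\<phi> a" "\<gamma> b" "\<eta> c"]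
    unfolding a b c
    by (cases "\<phi>' (\<phi> a) = a"; cases "\<gamma>' (\<gamma> b) = b"; cases "\<eta>' (\<eta> c) = c") simp_all
qed

text \<open>This is I(a;b) >= I(a;b|c) without subtraction. The form singles out \<open>a\<close>
  and is trivially true when H(a) is infinite; exchanging \<open>b\<close> and \<open>c\<close> is
  immediate, while growth of \<open>a\<close> and growth of \<open>b\<close> or \<open>c\<close> get
  separate lemmas.\<close>

definition nonneg_interaction :: "'w pmf \<Rightarrow> ('w \<Rightarrow> 'a) \<Rightarrow> ('w \<Rightarrow> 'b) \<Rightarrow> ('w \<Rightarrow> 'c) \<Rightarrow> bool" where
  "nonneg_interaction D a b c \<longleftrightarrow>
     cond_ent D a b + cond_ent D a c \<le> cond_ent D a (\<lambda>_. ()) + cond_ent D a (\<lambda>w. (b w, c w))"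

lemma nonneg_interaction_cong:
  assumes "nonneg_interaction D a b c"
    and "\<And>v w. v \<in> set_pmf D \<Longrightarrow> w \<in> set_pmf D \<Longrightarrow> a v = a w \<longleftrightarrow> a' v = a' w"
    and "\<And>v w. v \<in> set_pmf D \<Longrightarrow> w \<in> set_pmf D \<Longrightarrow> b v = b w \<longleftrightarrow> b' v = b' w"
    and "\<And>v w. v \<in> set_pmf D \<Longrightarrow> w \<in> set_pmf D \<Longrightarrow> c v = c w \<longleftrightarrow> c' v = c' w"
  shows "nonneg_interaction D a' b' c'"
proof -
  have "cond_ent D a b = cond_ent D a' b'" by (rule cond_ent_cong) (use assms(2,3) in blast)+
  moreover have "cond_ent D a c = cond_ent D a' c'" by (rule cond_ent_cong) (use assms(2,4) in blast)+
  moreover have "cond_ent D a (\<lambda>_. ()) = cond_ent D a' (\<lambda>_. ())" by (rule cond_ent_cong) (use assms(2) in blast)+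
  moreover have "cond_ent D a (\<lambda>w. (b w, c w)) = cond_ent D a' (\<lambda>w. (b' w, c' w))"
    by (rule cond_ent_cong) (use assms(2-4) in blast)+
  ultimately show ?thesis using assms(1) by (simp add: nonneg_interaction_def)
qed

lemma nonneg_interaction_sym:
  assumes "nonneg_interaction D a b c" shows "nonneg_interaction D a c b"
proof -
  have "cond_ent D a (\<lambda>w. (b w, c w)) = cond_ent D a (\<lambda>w. (c w, b w))" by (rule cond_ent_cong) blast+
  then show ?thesis using assms by (simp add: nonneg_interaction_def add.commute)
qed

text \<open>By the chain rule the left side gains H(d|a,b) + H(d|a,c) and the right side H(d|a) +
  H(d|a,b,c). The two terms with \<open>c\<close> agree by conditional independence, the others are
  ordered since conditioning reduces entropy.\<close>

lemma nonneg_interaction_extend1: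
  assumes "nonneg_interaction D a b c" and "markov D d (\<lambda>w. (a w, c w)) b"
  shows "nonneg_interaction D (\<lambda>w. (d w, a w)) b c"
proof -
  have "cond_ent D d (\<lambda>w. (a w, b w)) \<le> cond_ent D d (\<lambda>w. (a w, ()))"
    using cond_ent_condition[of D d a b] by (simp add: cond_ent_cong[of D "\<lambda>w. (a w, ())" a d d])
  moreover have "cond_ent D d (\<lambda>w. (a w, b w, c w)) = cond_ent D d (\<lambda>w. (a w, c w))"
  proof -
    have "cond_ent D d (\<lambda>w. (a w, b w, c w)) = cond_ent D d (\<lambda>w. ((a w, c w), b w))" by (rule cond_ent_cong) blast+
    then show ?thesis using cond_ent_markov[OF assms(2)] by simp
  qed
  moreover have "cond_ent D a b + cond_ent D a c \<le> cond_ent D a (\<lambda>_. ()) + cond_ent D a (\<lambda>w. (b w, c w))"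
    using assms(1) by (simp add: nonneg_interaction_def)
  ultimately have "(cond_ent D a b + cond_ent D a c) + (cond_ent D d (\<lambda>w. (a w, b w)) + cond_ent D d (\<lambda>w. (a w, c w)))
     \<le> (cond_ent D a (\<lambda>_. ()) + cond_ent D a (\<lambda>w. (b w, c w))) + (cond_ent D d (\<lambda>w. (a w, ())) + cond_ent D d (\<lambda>w. (a w, b w, c w)))"
    by (intro add_mono[OF _ add_mono]) (simp_all only: order_refl)
  then show ?thesis
    unfolding nonneg_interaction_def cond_ent_chain by (simp add: ac_simps)
qed

text \<open>Here the sender does not see \<open>a\<close>: the new message lowers H(a|b) on the left
  and leaves H(a|b,c) on the right unchanged.\<close>

lemma nonneg_interaction_extend2_remote:
  assumes "nonneg_interaction D a b c" and "markov D d (\<lambda>w. (b w, c w)) a"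
  shows "nonneg_interaction D a (\<lambda>w. (d w, b w)) c"
proof -
  have "cond_ent D a (\<lambda>w. (d w, b w)) \<le> cond_ent D a b"
    by (rule cond_ent_condition_determines) (simp add: determines_def)
  moreover have "cond_ent D a (\<lambda>w. ((d w, b w), c w)) = cond_ent D a (\<lambda>w. (b w, c w))"
  proof -
    have "cond_ent D a (\<lambda>w. ((d w, b w), c w)) = cond_ent D a (\<lambda>w. ((b w, c w), d w))" by (rule cond_ent_cong) blast+
    then show ?thesis using cond_ent_markov[OF markov_sym[OF assms(2)]] by simp
  qed
  ultimately show ?thesis using assms(1) unfolding nonneg_interaction_def
    by (auto intro: order_trans[OF add_right_mono])
qed

lemma cond_ent_le_uncond: "cond_ent D f g \<le> cond_ent D f (\<lambda>_. ())"
  by (rule cond_ent_condition_determines) (simp add: determines_def)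

text \<open>Here the sender sees \<open>a\<close> and \<open>b\<close>. The hypothesis and
  \<open>cond_ent_exchange\<close> are added and H(a|b) + H(a|b,c) is cancelled; that requires these
  terms to be finite, and they are unless H(a) is infinite.\<close>

lemma nonneg_interaction_extend2:
  assumes "nonneg_interaction D a b c" and "markov D d (\<lambda>w. (a w, b w)) c"
  shows "nonneg_interaction D a (\<lambda>w. (d w, b w)) c"
proof (cases "cond_ent D a (\<lambda>_. ()) = \<infinity>")
  case True
  then show ?thesis by (simp add: nonneg_interaction_def)
next
  case False
  have fin: "cond_ent D a b + cond_ent D a (\<lambda>w. (b w, c w)) \<noteq> \<infinity>"
    using False cond_ent_le_uncond[of D a b] cond_ent_le_uncond[of D a "\<lambda>w. (b w, c w)"]
    by (auto simp: top_unique)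
  have 1: "cond_ent D a (\<lambda>w. (d w, b w)) + cond_ent D a (\<lambda>w. (b w, c w))
     \<le> cond_ent D a b + cond_ent D a (\<lambda>w. ((d w, b w), c w))"
  proof -
    have "cond_ent D a (\<lambda>w. (d w, b w)) = cond_ent D a (\<lambda>w. (b w, d w))" by (rule cond_ent_cong) blast+
    moreover have "cond_ent D a (\<lambda>w. ((d w, b w), c w)) = cond_ent D a (\<lambda>w. (b w, c w, d w))" by (rule cond_ent_cong) blast+
    ultimately show ?thesis using cond_ent_exchange[OF assms(2)] by simp
  qed
  have 2: "cond_ent D a b + cond_ent D a c \<le> cond_ent D a (\<lambda>_. ()) + cond_ent D a (\<lambda>w. (b w, c w))"
    using assms(1) by (simp add: nonneg_interaction_def)
  have "(cond_ent D a b + cond_ent D a (\<lambda>w. (b w, c w))) + (cond_ent D a (\<lambda>w. (d w, b w)) + cond_ent D a c)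
    \<le> (cond_ent D a b + cond_ent D a (\<lambda>w. (b w, c w))) + (cond_ent D a (\<lambda>_. ()) + cond_ent D a (\<lambda>w. ((d w, b w), c w)))"
    using add_mono[OF 1 2] by (simp add: ac_simps)
  then show ?thesis
    using fin unfolding nonneg_interaction_def ennreal_add_left_cancel_le by blast
qed

section \<open>Limits of entropies under refinement\<close>

text \<open>The decoder \<open>R\<close> is the same for all \<open>n\<close>; only the index from
  which it succeeds may depend on the outcome. For transcripts \<open>fs n\<close> is padding to
  \<open>n\<close> rounds and \<open>R\<close> is \<open>strip\<close>.\<close>

definition approximates :: "'w pmf \<Rightarrow> (nat \<Rightarrow> 'w \<Rightarrow> 'b) \<Rightarrow> ('w \<Rightarrow> 'a) \<Rightarrow> bool" where
  "approximates D fs f \<longleftrightarrow> (\<forall>n. determines D f (fs n)) \<and>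
     (\<exists>R. \<forall>w\<in>set_pmf D. \<forall>\<^sub>F n in sequentially. R (fs n w) = f w)"

lemma approximates_Pair:
  assumes "approximates D fs f" "approximates D gs g"
  shows "approximates D (\<lambda>n w. (fs n w, gs n w)) (\<lambda>w. (f w, g w))"
proof -
  obtain R S where R: "\<forall>w\<in>set_pmf D. \<forall>\<^sub>F n in sequentially. R (fs n w) = f w"
    and S: "\<forall>w\<in>set_pmf D. \<forall>\<^sub>F n in sequentially. S (gs n w) = g w"
    using assms unfolding approximates_def by blast
  have "\<forall>w\<in>set_pmf D. \<forall>\<^sub>F n in sequentially. map_prod R S (fs n w, gs n w) = (f w, g w)"
  proof
    fix w assume w: "w \<in> set_pmf D"
    show "\<forall>\<^sub>F n in sequentially. map_prod R S (fs n w, gs n w) = (f w, g w)"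
      using bspec[OF R w] bspec[OF S w] by eventually_elim simp
  qed
  moreover have "determines D (\<lambda>w. (f w, g w)) (\<lambda>w. (fs n w, gs n w))" for n
    using assms unfolding approximates_def determines_def by blast
  ultimately show ?thesis unfolding approximates_def by blast
qed

lemma tendsto_cell:
  assumes "approximates D fs f" and w: "w \<in> set_pmf D"
  shows "(\<lambda>n. cell D (fs n) w) \<longlonglongrightarrow> cell D f w"
proof -
  obtain R where R: "\<And>w. w \<in> set_pmf D \<Longrightarrow> \<forall>\<^sub>F n in sequentially. R (fs n w) = f w"
    and d: "\<And>n. determines D f (fs n)"
    using assms(1) unfolding approximates_def by blast
  have cell: "cell D g w = measure_pmf.expectation D (\<lambda>v. indicator {v. g v = g w} v)" for g :: "_ \<Rightarrow> 'c"
    by (simp add: cell_def)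
  have "(\<lambda>n. measure_pmf.expectation D (\<lambda>v. indicator {v. fs n v = fs n w} v :: real))
     \<longlonglongrightarrow> measure_pmf.expectation D (\<lambda>v. indicator {v. f v = f w} v)"
  proof (rule integral_dominated_convergence[where w = "\<lambda>_. 1"])
    show "AE v in measure_pmf D. (\<lambda>n. indicator {v. fs n v = fs n w} v :: real)
        \<longlonglongrightarrow> indicator {v. f v = f w} v"
    proof (rule AE_pmfI)
      fix v assume v: "v \<in> set_pmf D"
      have "\<forall>\<^sub>F n in sequentially. indicator {v. fs n v = fs n w} v = (indicator {v. f v = f w} v :: real)"
        using R[OF v] R[OF w]
      proof eventually_elim
        case (elim n)
        have "fs n v = fs n w \<longleftrightarrow> f v = f w"
          using elim determinesD[OF d v w] by metis
        then show ?case by (simp add: indicator_def)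
      qed
      then show "(\<lambda>n. indicator {v. fs n v = fs n w} v :: real) \<longlonglongrightarrow> indicator {v. f v = f w} v"
        by (rule tendsto_eventually)
    qed
  qed (auto simp: indicator_def)
  then show ?thesis by (simp add: cell_def)
qed

lemma tendsto_log_cell:
  assumes "approximates D fs f" and w: "w \<in> set_pmf D"
  shows "(\<lambda>n. log 2 (cell D (fs n) w)) \<longlonglongrightarrow> log 2 (cell D f w)"
  using cell_pos[OF w, of f] by (intro tendsto_intros tendsto_cell assms) auto

text \<open>Fatou's lemma applied to the information densities, which converge pointwise on the
  support; no finiteness is involved.\<close>

lemma cond_ent_add_le_liminf:
  assumes a: "approximates D as a" and b: "approximates D bs b" and c: "approximates D cs c"
  shows "cond_ent D a b + cond_ent D a c \<le> liminf (\<lambda>n. cond_ent D (as n) (bs n) + cond_ent D (as n) (cs n))"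
proof -
  note lim = tendsto_log_cell[OF b] tendsto_log_cell[OF c]
    tendsto_log_cell[OF approximates_Pair[OF a b]] tendsto_log_cell[OF approximates_Pair[OF a c]]
  let ?F = "\<lambda>a b c w. (log 2 (cell D b w) - log 2 (cell D (\<lambda>v. (a v, b v)) w))
     + (log 2 (cell D c w) - log 2 (cell D (\<lambda>v. (a v, c v)) w))"
  have "cond_ent D a b + cond_ent D a c = (\<integral>\<^sup>+ w. liminf (\<lambda>n. ennreal
     ((log 2 (cell D (bs n) w) - log 2 (cell D (\<lambda>v. (as n v, bs n v)) w))
     + (log 2 (cell D (cs n) w) - log 2 (cell D (\<lambda>v. (as n v, cs n v)) w)))) \<partial>measure_pmf D)"
    unfolding cond_ent_add
  proof (intro nn_integral_cong_AE AE_pmfI)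
    fix w assume w: "w \<in> set_pmf D"
    show "ennreal ((log 2 (cell D b w) - log 2 (cell D (\<lambda>v. (a v, b v)) w))
     + (log 2 (cell D c w) - log 2 (cell D (\<lambda>v. (a v, c v)) w))) = liminf (\<lambda>n. ennreal
     ((log 2 (cell D (bs n) w) - log 2 (cell D (\<lambda>v. (as n v, bs n v)) w))
     + (log 2 (cell D (cs n) w) - log 2 (cell D (\<lambda>v. (as n v, cs n v)) w))))"
      by (intro lim_imp_Liminf[symmetric] trivial_limit_sequentially tendsto_ennrealI
          tendsto_add tendsto_diff lim[OF w])
  qed
  also have "\<dots> \<le> liminf (\<lambda>n. cond_ent D (as n) (bs n) + cond_ent D (as n) (cs n))"
    unfolding cond_ent_add by (rule nn_integral_liminf) simp
  finally show ?thesis .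
qed

text \<open>The cross entropy of \<open>a\<close> is taken with respect to the mixture
\<open>(1 - \<epsilon>) p(a | g = R (gs n)) + \<epsilon> p(a)\<close>: its first summand is the true conditional law once
\<open>gs n\<close> determines \<open>g\<close>, the second one makes the exceptional event integrable.\<close>

lemma eventually_cond_ent_condition_le:
  fixes a :: "'w \<Rightarrow> 'a"
  assumes "approximates D gs g" and fin: "cond_ent D a (\<lambda>_. ()) < \<infinity>" and \<delta>: "\<delta> > 0"
  shows "\<forall>\<^sub>F n in sequentially. cond_ent D a (gs n) \<le> cond_ent D a g + ennreal \<delta>"
proof -
  obtain R where R: "\<And>w. w \<in> set_pmf D \<Longrightarrow> \<forall>\<^sub>F n in sequentially. R (gs n w) = g w"
    using assms(1) unfolding approximates_def by blast
  \<comment> \<open>Chosen so that the weight \<open>1 - \<epsilon>\<close> of the true law costs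
    \<open>\<delta> / 2\<close> in the logarithm. The other \<open>\<delta> / 2\<close> pays for the
    exceptional event \<open>E n\<close>.\<close>
  define \<epsilon> where "\<epsilon> = 1 - 2 powr (- \<delta> / 2)"
  have \<epsilon>: "0 < \<epsilon>" "\<epsilon> < 1" using \<delta> powr_less_mono[of "- \<delta> / 2" 0 2] by (auto simp: \<epsilon>_def)
  have log\<epsilon>: "- log 2 (1 - \<epsilon>) = \<delta> / 2" by (simp add: \<epsilon>_def)
  let ?p = "\<lambda>w. cprob D a (\<lambda>_. ()) (a w) ()" and ?pg = "\<lambda>w. cprob D a g (a w) (g w)"
  define q where "q = (\<lambda>x c. (1 - \<epsilon>) * cprob D a g x (R c) + \<epsilon> * cprob D a (\<lambda>_. ()) x ())"
  define E where "E n = {w. R (gs n w) \<noteq> g w}" for n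
  define K where "K w = - log 2 \<epsilon> - log 2 (?p w)" for w
  define err where "err n = (\<integral>\<^sup>+ w. ennreal (indicator (E n) w * K w) \<partial>measure_pmf D)" for n
  have p: "0 < ?p w" "?p w \<le> 1" if "w \<in> set_pmf D" for w
    using cprob_pos[OF that, of a "\<lambda>_. ()"] kernel_le_1[OF cprob_sum] by auto
  have pg: "0 < ?pg w" "?pg w \<le> 1" if "w \<in> set_pmf D" for w
    using cprob_pos[OF that, of a g] kernel_le_1[OF cprob_sum] by auto
  have K: "0 \<le> K w" if w: "w \<in> set_pmf D" for w
  proof -
    have "log 2 \<epsilon> \<le> 0" "log 2 (?p w) \<le> 0" using \<epsilon> p[OF w] by simp_all
    then show ?thesis by (simp add: K_def)
  qed
  have cond_ent_le: "cond_ent D a (gs n) \<le> cond_ent D a g + (ennreal (\<delta> / 2) + err n)" for n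
  proof -
    have "cond_ent D a (gs n) \<le> (\<integral>\<^sup>+ w. ennreal (- log 2 (q (a w) (gs n w))) \<partial>measure_pmf D)"
    proof (rule cond_ent_le_cross_entropy)
      show "0 \<le> q x c" for x c using \<epsilon> by (simp add: q_def cprob_nonneg)
      show "0 < q (a w) (gs n w)" if "w \<in> set_pmf D" for w
        using \<epsilon> p[OF that] cprob_nonneg[of D a g] unfolding q_def
        by (intro add_nonneg_pos mult_pos_pos mult_nonneg_nonneg) auto
      show "(\<integral>\<^sup>+ x. ennreal (q x c) \<partial>count_space UNIV) \<le> 1" for c
      proof -
        have "(\<integral>\<^sup>+ x. ennreal (q x c) \<partial>count_space UNIV)
          = ennreal (1 - \<epsilon>) * (\<integral>\<^sup>+ x. ennreal (cprob D a g x (R c)) \<partial>count_space UNIV)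
          + ennreal \<epsilon> * (\<integral>\<^sup>+ x. ennreal (cprob D a (\<lambda>_. ()) x ()) \<partial>count_space UNIV)"
          using \<epsilon> by (simp add: q_def cprob_nonneg ennreal_plus ennreal_mult nn_integral_add nn_integral_cmult)
        also have "\<dots> \<le> ennreal (1 - \<epsilon>) * 1 + ennreal \<epsilon> * 1"
          by (intro add_mono mult_left_mono cprob_sum) auto
        also have "\<dots> = 1" using \<epsilon> by (simp flip: ennreal_plus)
        finally show ?thesis .
      qed
    qed
    also have "\<dots> \<le> (\<integral>\<^sup>+ w. ennreal (- log 2 (?pg w)) + (ennreal (\<delta> / 2) + ennreal (indicator (E n) w * K w)) \<partial>measure_pmf D)"
    proof (intro nn_integral_mono_AE AE_pmfI)
      fix w assume w: "w \<in> set_pmf D"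
      have lpg: "log 2 (?pg w) \<le> 0" using pg[OF w] by simp
      have "- log 2 (q (a w) (gs n w)) \<le> - log 2 (?pg w) + (\<delta> / 2 + indicator (E n) w * K w)"
      proof (cases "w \<in> E n")
        case True
        have "\<epsilon> * ?p w \<le> q (a w) (gs n w)" using \<epsilon> by (simp add: q_def cprob_nonneg)
        then have "log 2 (\<epsilon> * ?p w) \<le> log 2 (q (a w) (gs n w))"
          using \<epsilon> p[OF w] by (intro log_mono) auto
        then have "- log 2 (q (a w) (gs n w)) \<le> K w"
          using \<epsilon> p[OF w] by (simp add: K_def log_mult_pos)
        then show ?thesis using True lpg \<delta> by simp
      next
        case False
        then have "(1 - \<epsilon>) * ?pg w \<le> q (a w) (gs n w)"
          using \<epsilon> by (simp add: q_def E_def cprob_nonneg)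
        then have "log 2 ((1 - \<epsilon>) * ?pg w) \<le> log 2 (q (a w) (gs n w))"
          using \<epsilon> pg[OF w] by (intro log_mono) auto
        then have "- log 2 (q (a w) (gs n w)) \<le> \<delta> / 2 - log 2 (?pg w)"
          using \<epsilon> pg[OF w] log\<epsilon> by (simp add: log_mult_pos)
        then show ?thesis using False by simp
      qed
      moreover have "0 \<le> indicator (E n) w * K w" using K[OF w] by simp
      ultimately have "ennreal (- log 2 (q (a w) (gs n w))) \<le> ennreal (- log 2 (?pg w) + (\<delta> / 2 + indicator (E n) w * K w))"
        by (intro ennreal_leI)
      also have "\<dots> = ennreal (- log 2 (?pg w)) + (ennreal (\<delta> / 2) + ennreal (indicator (E n) w * K w))"
        using lpg \<delta> \<open>0 \<le> indicator (E n) w * K w\<close> by (subst ennreal_plus; simp add: ennreal_plus)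
      finally show "ennreal (- log 2 (q (a w) (gs n w)))
         \<le> ennreal (- log 2 (?pg w)) + (ennreal (\<delta> / 2) + ennreal (indicator (E n) w * K w))" .
    qed
    also have "\<dots> = cond_ent D a g + (ennreal (\<delta> / 2) + err n)"
      by (simp add: nn_integral_add cond_ent_eq_cross_entropy[of D a g] err_def measure_pmf.emeasure_space_1)
    finally show ?thesis .
  qed
  \<comment> \<open>Each outcome of the support leaves \<open>E n\<close> eventually, and
    \<open>K\<close> is an integrable bound because its mean is at most
    \<open>- log 2 \<epsilon>\<close> plus the finite H(a).\<close>
  have "err \<longlonglongrightarrow> (\<integral>\<^sup>+ w. 0 \<partial>measure_pmf D)"
    unfolding err_def
  proof (rule nn_integral_dominated_convergence[where w = "\<lambda>w. ennreal (K w)"])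
    have "(\<integral>\<^sup>+ w. ennreal (K w) \<partial>measure_pmf D)
      \<le> (\<integral>\<^sup>+ w. ennreal (- log 2 \<epsilon>) + ennreal (- log 2 (?p w)) \<partial>measure_pmf D)"
      using \<epsilon> p by (intro nn_integral_mono_AE AE_pmfI) (simp add: K_def flip: ennreal_plus)
    also have "\<dots> = ennreal (- log 2 \<epsilon>) + cond_ent D a (\<lambda>_. ())"
      by (simp add: nn_integral_add cond_ent_eq_cross_entropy[of D a "\<lambda>_. ()"] measure_pmf.emeasure_space_1)
    also have "\<dots> < \<infinity>" using fin by simp
    finally show "(\<integral>\<^sup>+ w. ennreal (K w) \<partial>measure_pmf D) < \<infinity>" .
    show "AE w in measure_pmf D. ennreal (indicator (E n) w * K w) \<le> ennreal (K w)" for n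
      using K by (intro AE_pmfI) (auto simp: indicator_def)
    show "AE w in measure_pmf D. (\<lambda>n. ennreal (indicator (E n) w * K w)) \<longlonglongrightarrow> 0"
    proof (rule AE_pmfI)
      fix w assume "w \<in> set_pmf D"
      from R[OF this] have "\<forall>\<^sub>F n in sequentially. ennreal (indicator (E n) w * K w) = 0"
        by eventually_elim (simp add: E_def)
      then show "(\<lambda>n. ennreal (indicator (E n) w * K w)) \<longlonglongrightarrow> 0" by (rule tendsto_eventually)
    qed
  qed auto
  then have "\<forall>\<^sub>F n in sequentially. err n < ennreal (\<delta> / 2)"
    using \<delta> by (intro order_tendstoD) auto
  then show ?thesis
  proof eventually_elim
    case (elim n)
    have "ennreal (\<delta> / 2) + err n \<le> ennreal (\<delta> / 2) + ennreal (\<delta> / 2)"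
      using elim by (intro add_left_mono) auto
    also have "\<dots> = ennreal \<delta>" using \<delta> by (simp flip: ennreal_plus)
    finally show ?case using cond_ent_le[of n] by (meson add_left_mono order_trans)
  qed
qed

text \<open>On the right, \<open>as n\<close> is first replaced by the finer \<open>a\<close>, which
  only increases entropy; then \<open>(bs n, cs n)\<close> is replaced by \<open>(b, c)\<close> at
  the cost of an arbitrary \<open>\<delta>\<close>. The second replacement needs finite
  H(a).\<close>

lemma nonneg_interaction_limit:
  assumes a: "approximates D as a" and b: "approximates D bs b" and c: "approximates D cs c"
    and J: "\<And>n. nonneg_interaction D (as n) (bs n) (cs n)"
  shows "nonneg_interaction D a b c"
proof (cases "cond_ent D a (\<lambda>_. ()) < \<infinity>")
  case False
  then show ?thesis by (simp add: nonneg_interaction_def not_less top_unique)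
next
  case True
  have det: "determines D a (as n)" for n using a by (simp add: approximates_def)
  have "cond_ent D a b + cond_ent D a c \<le> (cond_ent D a (\<lambda>_. ()) + cond_ent D a (\<lambda>w. (b w, c w))) + ennreal \<delta>" if "\<delta> > 0" for \<delta>
  proof -
    have "\<forall>\<^sub>F n in sequentially. cond_ent D (as n) (bs n) + cond_ent D (as n) (cs n)
      \<le> (cond_ent D a (\<lambda>_. ()) + cond_ent D a (\<lambda>w. (b w, c w))) + ennreal \<delta>"
      using eventually_cond_ent_condition_le[OF approximates_Pair[OF b c] True that]
    proof eventually_elim
      case (elim n)
      have d: "determines D (\<lambda>w. (a w, g w)) (as n)" for g :: "_ \<Rightarrow> 'g"
        using det[of n] unfolding determines_def by blast
      have "cond_ent D (as n) (bs n) + cond_ent D (as n) (cs n)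
         \<le> cond_ent D (as n) (\<lambda>_. ()) + cond_ent D (as n) (\<lambda>w. (bs n w, cs n w))"
        using J[of n] by (simp add: nonneg_interaction_def)
      also have "\<dots> \<le> cond_ent D a (\<lambda>_. ()) + cond_ent D a (\<lambda>w. (bs n w, cs n w))"
        by (intro add_mono cond_ent_mono_determines) (use det[of n] in \<open>unfold determines_def, blast\<close>)+
      also have "\<dots> \<le> cond_ent D a (\<lambda>_. ()) + (cond_ent D a (\<lambda>w. (b w, c w)) + ennreal \<delta>)"
        by (intro add_left_mono elim)
      finally show ?case by (simp add: add.assoc)
    qed
    then have "liminf (\<lambda>n. cond_ent D (as n) (bs n) + cond_ent D (as n) (cs n))
      \<le> liminf (\<lambda>n. (cond_ent D a (\<lambda>_. ()) + cond_ent D a (\<lambda>w. (b w, c w))) + ennreal \<delta>)"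
      by (rule Liminf_mono)
    then show ?thesis
      using cond_ent_add_le_liminf[OF a b c] by (simp add: Liminf_const)
  qed
  then show ?thesis
    unfolding nonneg_interaction_def by (rule ennreal_le_epsilon) blast
qed

section \<open>Probabilities of transcripts\<close>

lemma pmf_bind_Pair:
  "pmf (bind_pmf p (\<lambda>x. map_pmf (Pair x) (q x))) (x, y) = pmf p x * pmf (q x) y"
proof -
  have "pmf (map_pmf (Pair x') (q x')) (x, y) = indicator {x} x' * pmf (q x) y" for x'
  proof (cases "x' = x")
    case True
    have "inj (Pair x :: 'b \<Rightarrow> 'a \<times> 'b)" by (simp add: inj_on_def)
    from pmf_map_inj'[OF this] show ?thesis using True by simp
  next
    case False
    then have "(x, y) \<notin> set_pmf (map_pmf (Pair x') (q x'))" by auto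
    then show ?thesis using False by (simp add: pmf_eq_0_set_pmf)
  qed
  then show ?thesis by (simp add: pmf_bind measure_pmf_single)
qed

lemma pmf_bind_finite:
  fixes p :: "'a::finite pmf"
  shows "pmf (bind_pmf p q) y = (\<Sum>x\<in>UNIV. pmf p x * pmf (q x) y)"
  by (simp add: pmf_bind integral_measure_pmf[of UNIV])

text \<open>The likelihood of Alice's own messages along given links 12 and 31. By the orientation
  of the entries she sends the first component on 12 and the second on 31. The value 0 at wrong
  lengths makes \<open>pmf_exec\<close> valid for all arguments.\<close>

definition alice_weight :: "('x, 'y, 'z) protocol \<Rightarrow> nat \<Rightarrow> 'x \<Rightarrow> trans \<Rightarrow> trans \<Rightarrow> real" where
  "alice_weight P n x a c = (if length a = n \<and> length c = n
     then \<Prod>i<n. pmf (alice P x (take i a) (take i c)) (fst (a ! i), snd (c ! i)) else 0)"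

definition bob_weight :: "('x, 'y, 'z) protocol \<Rightarrow> nat \<Rightarrow> 'y \<Rightarrow> trans \<Rightarrow> trans \<Rightarrow> real" where
  "bob_weight P n y a b = (if length a = n \<and> length b = n
     then \<Prod>i<n. pmf (bob P y (take i a) (take i b)) (snd (a ! i), fst (b ! i)) else 0)"

definition charlie_weight :: "('x, 'y, 'z) protocol \<Rightarrow> nat \<Rightarrow> trans \<Rightarrow> trans \<Rightarrow> real" where
  "charlie_weight P n b c = (if length b = n \<and> length c = n
     then \<Prod>i<n. pmf (charlie P (take i b) (take i c)) (snd (b ! i), fst (c ! i)) else 0)"

lemma alice_weight_bounds: "0 \<le> alice_weight P n x a c" "alice_weight P n x a c \<le> 1"
  unfolding alice_weight_def by (auto intro: prod_nonneg prod_le_1 pmf_le_1)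

lemma bob_weight_bounds: "0 \<le> bob_weight P n y a b" "bob_weight P n y a b \<le> 1"
  unfolding bob_weight_def by (auto intro: prod_nonneg prod_le_1 pmf_le_1)

lemma charlie_weight_bounds: "0 \<le> charlie_weight P n b c" "charlie_weight P n b c \<le> 1"
  unfolding charlie_weight_def by (auto intro: prod_nonneg prod_le_1 pmf_le_1)

lemma alice_weight_snoc:
  "alice_weight P (Suc n) x (a @ [e]) (c @ [f]) = alice_weight P n x a c * pmf (alice P x a c) (fst e, snd f)"
  unfolding alice_weight_def by (auto simp: nth_append intro!: prod.cong)

lemma bob_weight_snoc:
  "bob_weight P (Suc n) y (a @ [e]) (b @ [f]) = bob_weight P n y a b * pmf (bob P y a b) (snd e, fst f)"
  unfolding bob_weight_def by (auto simp: nth_append intro!: prod.cong)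

lemma charlie_weight_snoc:
  "charlie_weight P (Suc n) (b @ [e]) (c @ [f]) = charlie_weight P n b c * pmf (charlie P b c) (snd e, fst f)"
  unfolding charlie_weight_def by (auto simp: nth_append intro!: prod.cong)

type_synonym round_msgs = "(msg \<times> msg) \<times> (msg \<times> msg) \<times> (msg \<times> msg)"

definition round_pmf :: "('x, 'y, 'z) protocol \<Rightarrow> 'x \<Rightarrow> 'y \<Rightarrow> state \<Rightarrow> round_msgs pmf" where
  "round_pmf P x y s = (case s of (a, b, c) \<Rightarrow>
     pair_pmf (alice P x a c) (pair_pmf (bob P y a b) (charlie P b c)))"

definition append_round :: "state \<Rightarrow> round_msgs \<Rightarrow> state" where
  "append_round s m = (case s of (a, b, c) \<Rightarrow> case m of (ma, mb, mc) \<Rightarrow>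
     (a @ [(fst ma, fst mb)], b @ [(snd mb, fst mc)], c @ [(snd mc, snd ma)]))"

definition last_round :: "state \<Rightarrow> state \<times> round_msgs" where
  "last_round s = (case s of (a, b, c) \<Rightarrow> ((butlast a, butlast b, butlast c),
     (fst (last a), snd (last c)), (snd (last a), fst (last b)), (snd (last b), fst (last c))))"

lemma last_round_append_round: "last_round (append_round s m) = (s, m)"
  by (auto simp: last_round_def append_round_def split: prod.splits)

definition rounds :: "('x, 'y, 'z) protocol \<Rightarrow> 'x \<Rightarrow> 'y \<Rightarrow> nat \<Rightarrow> (state \<times> round_msgs) pmf" where
  "rounds P x y n = bind_pmf (exec P x y n) (\<lambda>s. map_pmf (Pair s) (round_pmf P x y s))"

lemma step_eq: "step P x y s = map_pmf (append_round s) (round_pmf P x y s)"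
  by (auto simp: step_def round_pmf_def append_round_def pair_pmf_def map_bind_pmf bind_assoc_pmf
      bind_return_pmf case_prod_unfold split: prod.splits)

lemma exec_Suc_eq: "exec P x y (Suc n) = map_pmf (\<lambda>(s, m). append_round s m) (rounds P x y n)"
  by (simp add: rounds_def map_bind_pmf pmf.map_comp o_def step_eq[abs_def])

lemma rounds_eq: "rounds P x y n = map_pmf last_round (exec P x y (Suc n))"
  by (simp add: exec_Suc_eq pmf.map_comp o_def case_prod_unfold last_round_append_round del: exec.simps)

lemma exec_length:
  "(a, b, c) \<in> set_pmf (exec P x y n) \<Longrightarrow> length a = n \<and> length b = n \<and> length c = n"
proof (induction n arbitrary: a b c)
  case (Suc n)
  then show ?case by (fastforce simp: step_eq append_round_def split: prod.splits)
qed simp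

lemma pmf_round: "pmf (round_pmf P x y (a, b, c)) (ma, mb, mc)
   = pmf (alice P x a c) ma * pmf (bob P y a b) mb * pmf (charlie P b c) mc"
  by (simp add: round_pmf_def pmf_pair)

lemma pmf_rounds: "pmf (rounds P x y n) ((a, b, c), (ma, mb, mc)) = pmf (exec P x y n) (a, b, c)
   * (pmf (alice P x a c) ma * pmf (bob P y a b) mb * pmf (charlie P b c) mc)"
  by (simp add: rounds_def pmf_bind_Pair pmf_round)

text \<open>A message depends only on its sender's input and two links, so the likelihood has one
  factor per sender: \<open>x\<close> occurs only next to \<open>a, c\<close>, and \<open>y\<close>
  only next to \<open>a, b\<close>. All later factorisations come from here.\<close>

lemma pmf_exec:
  "pmf (exec P x y n) (a, b, c) = alice_weight P n x a c * bob_weight P n y a b * charlie_weight P n b c"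
proof (induction n arbitrary: a b c)
  case 0
  then show ?case by (auto simp: alice_weight_def bob_weight_def charlie_weight_def indicator_def)
next
  case (Suc n)
  show ?case
  proof (cases "length a = Suc n \<and> length b = Suc n \<and> length c = Suc n")
    case True
    then obtain a' e b' f c' g where abc: "a = a' @ [e]" "b = b' @ [f]" "c = c' @ [g]"
      by (metis length_Suc_conv_rev)
    define v where "v = ((a', b', c'), (fst e, snd g), (snd e, fst f), (snd f, fst g))"
    have "pmf (exec P x y (Suc n)) (a, b, c) = measure_pmf.prob (rounds P x y n) ((\<lambda>(s, m). append_round s m) -` {(a, b, c)})"
      by (simp only: exec_Suc_eq pmf_map)
    also have "(\<lambda>(s, m). append_round s m) -` {(a, b, c)} = {v}"
      by (auto simp: append_round_def abc v_def split: prod.splits)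
    finally show ?thesis
      by (simp add: abc v_def measure_pmf_single pmf_rounds Suc.IH alice_weight_snoc bob_weight_snoc charlie_weight_snoc mult_ac del: exec.simps)
  next
    case False
    then have "(a, b, c) \<notin> set_pmf (exec P x y (Suc n))" using exec_length[of a b c P x y "Suc n"] by fast
    then have "pmf (exec P x y (Suc n)) (a, b, c) = 0" by (simp only: pmf_eq_0_set_pmf not_False_eq_True)
    moreover have "alice_weight P (Suc n) x a c = 0 \<or> bob_weight P (Suc n) y a b = 0"
      using False by (metis alice_weight_def bob_weight_def)
    ultimately show ?thesis by (metis mult_zero_left mult_zero_right)
  qed
qed

section \<open>Recovering the first rounds from a stripped transcript\<close>

definition pad :: "nat \<Rightarrow> trans \<Rightarrow> trans" where
  "pad n l = take n (l @ empties n)"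

lemma length_pad [simp]: "length (pad n l) = n"
  by (simp add: pad_def empties_def)

lemma pad_eq: "length l \<le> n \<Longrightarrow> pad n l = l @ empties (n - length l)"
  by (simp add: pad_def empties_def)

lemma strip_append_empties: "strip (l @ empties k) = strip l"
  by (induction k) (simp_all add: strip_def empties_def dropWhile_append)

lemma strip_decompose: "\<exists>k. l = strip l @ empties k"
proof (induction l rule: rev_induct)
  case Nil
  show ?case by (simp add: strip_def empties_def)
next
  case (snoc e l)
  show ?case
  proof (cases "e = ([], [])")
    case True
    then have "strip (l @ [e]) = strip l" by (simp add: strip_def)
    moreover obtain k where "l = strip l @ empties k" using snoc by blast
    ultimately have "l @ [e] = strip (l @ [e]) @ empties (Suc k)"
      using True by (metis append.assoc empties_def replicate_append_same replicate_Suc)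
    then show ?thesis by blast
  next
    case False
    then have "strip (l @ [e]) = l @ [e]" by (simp add: strip_def)
    then show ?thesis by (metis append_Nil2 empties_def replicate_0)
  qed
qed

lemma strip_strip: "strip (strip l) = strip l"
  by (metis strip_append_empties strip_decompose)

lemma length_strip_le: "length (strip l) \<le> length l"
  by (metis le_add1 length_append strip_decompose)

lemma strip_pad: "length l \<le> n \<Longrightarrow> strip (pad n l) = strip l"
  by (simp add: pad_eq strip_append_empties)

text \<open>Stripping removes only trailing empty rounds, which padding restores; so the first
  \<open>n\<close> rounds are a function of the final transcript.\<close>

lemma pad_strip: "n \<le> length l \<Longrightarrow> pad n (strip l) = take n l"
proof -
  assume "n \<le> length l"
  moreover obtain k where k: "l = strip l @ empties k" using strip_decompose by blast
  ultimately have n: "n \<le> length (strip l) + k" by (metis empties_def length_append length_replicate)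
  have "take n l = take n (strip l) @ take (n - length (strip l)) (empties k)"
    by (subst k) simp
  also have "take (n - length (strip l)) (empties k) = take (n - length (strip l)) (empties n)"
    using n by (simp add: empties_def)
  finally show ?thesis by (simp add: pad_def)
qed

lemma pad_Suc_snoc: "pad (Suc n) l = pad n l @ [last (pad (Suc n) l)]"
proof -
  have "pad (Suc n) l = take n (l @ empties (Suc n)) @ [(l @ empties (Suc n)) ! n]"
    unfolding pad_def by (rule take_Suc_conv_app_nth) (simp add: empties_def)
  also have "l @ empties (Suc n) = (l @ empties n) @ [([], [])]"
    by (simp add: empties_def flip: replicate_append_same)
  also have "take n \<dots> = pad n l" unfolding pad_def by (subst take_append) (simp add: empties_def)
  finally show ?thesis by (metis last_snoc)
qed

section \<open>The law of the outcome\<close>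

definition alice_quiet :: "('x, 'y, 'z) protocol \<Rightarrow> 'x \<Rightarrow> trans \<Rightarrow> trans \<Rightarrow> bool" where
  "alice_quiet P x a c \<longleftrightarrow> (\<forall>k. alice P x (a @ empties k) (c @ empties k) = return_pmf ([], []))"

definition bob_quiet :: "('x, 'y, 'z) protocol \<Rightarrow> 'y \<Rightarrow> trans \<Rightarrow> trans \<Rightarrow> bool" where
  "bob_quiet P y a b \<longleftrightarrow> (\<forall>k. bob P y (a @ empties k) (b @ empties k) = return_pmf ([], []))"

definition charlie_quiet :: "('x, 'y, 'z) protocol \<Rightarrow> trans \<Rightarrow> trans \<Rightarrow> bool" where
  "charlie_quiet P b c \<longleftrightarrow> (\<forall>k. charlie P (b @ empties k) (c @ empties k) = return_pmf ([], []))"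

lemma quiescent_eq: "quiescent P x y (a, b, c) \<longleftrightarrow> alice_quiet P x a c \<and> bob_quiet P y a b \<and> charlie_quiet P b c"
  by (auto simp: quiescent_def alice_quiet_def bob_quiet_def charlie_quiet_def)

definition fits :: "nat \<Rightarrow> trans \<Rightarrow> bool" where
  "fits n l \<longleftrightarrow> strip l = l \<and> length l \<le> n"

text \<open>Alice's factor in the probability that the run is quiescent after \<open>n\<close>
  rounds with stripped transcripts \<open>a\<close> and \<open>c\<close>. Quiescence is a
  conjunction of one condition per party, so the product form of the likelihood survives.\<close>

definition alice_final :: "('x, 'y, 'z) protocol \<Rightarrow> 'x \<Rightarrow> trans \<Rightarrow> trans \<Rightarrow> nat \<Rightarrow> real" where
  "alice_final P x a c n = (if fits n a \<and> fits n c \<and> alice_quiet P x (pad n a) (pad n c)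
     then alice_weight P n x (pad n a) (pad n c) else 0)"

definition bob_final :: "('x, 'y, 'z) protocol \<Rightarrow> 'y \<Rightarrow> trans \<Rightarrow> trans \<Rightarrow> nat \<Rightarrow> real" where
  "bob_final P y a b n = (if fits n a \<and> fits n b \<and> bob_quiet P y (pad n a) (pad n b)
     then bob_weight P n y (pad n a) (pad n b) else 0)"

definition charlie_final :: "('x, 'y, 'z) protocol \<Rightarrow> trans \<Rightarrow> trans \<Rightarrow> nat \<Rightarrow> real" where
  "charlie_final P b c n = (if fits n b \<and> fits n c \<and> charlie_quiet P (pad n b) (pad n c)
     then charlie_weight P n (pad n b) (pad n c) else 0)"

lemma pad_Suc_empty: "length l \<le> n \<Longrightarrow> pad (Suc n) l = pad n l @ [([], [])]"
  by (simp add: pad_eq empties_def Suc_diff_le flip: replicate_append_same)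

lemma empties_Cons: "[([], [])] @ empties k = empties (Suc k)"
  by (simp add: empties_def)

lemma empties_0: "l @ empties 0 = l"
  by (simp add: empties_def)

text \<open>The sequence is 0 until its condition is met; afterwards the next empty messages are
  sent with probability 1, and the value stays constant.\<close>

lemma incseq_alice_final: "incseq (alice_final P x a c)"
proof (rule incseq_SucI)
  fix n
  show "alice_final P x a c n \<le> alice_final P x a c (Suc n)"
  proof (cases "fits n a \<and> fits n c \<and> alice_quiet P x (pad n a) (pad n c)")
    case True
    then have p: "pad (Suc n) a = pad n a @ [([], [])]" "pad (Suc n) c = pad n c @ [([], [])]"
      by (simp_all add: fits_def pad_Suc_empty)
    have q: "alice P x (pad n a @ empties k) (pad n c @ empties k) = return_pmf ([], [])" for k
      using True by (simp add: alice_quiet_def)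
    have "alice_quiet P x (pad (Suc n) a) (pad (Suc n) c)"
      unfolding alice_quiet_def p append_assoc empties_Cons using q by blast
    moreover have "alice_weight P (Suc n) x (pad (Suc n) a) (pad (Suc n) c) = alice_weight P n x (pad n a) (pad n c)"
      using q[of 0] by (simp add: p alice_weight_snoc empties_0)
    moreover have "fits (Suc n) a" "fits (Suc n) c" using True by (auto simp: fits_def)
    ultimately show ?thesis using True by (simp add: alice_final_def)
  next
    case False
    then show ?thesis by (simp only: alice_final_def if_False) (simp add: alice_weight_bounds)
  qed
qed

lemma incseq_bob_final: "incseq (bob_final P y a b)"
proof (rule incseq_SucI)
  fix n
  show "bob_final P y a b n \<le> bob_final P y a b (Suc n)"
  proof (cases "fits n a \<and> fits n b \<and> bob_quiet P y (pad n a) (pad n b)")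
    case True
    then have p: "pad (Suc n) a = pad n a @ [([], [])]" "pad (Suc n) b = pad n b @ [([], [])]"
      by (simp_all add: fits_def pad_Suc_empty)
    have q: "bob P y (pad n a @ empties k) (pad n b @ empties k) = return_pmf ([], [])" for k
      using True by (simp add: bob_quiet_def)
    have "bob_quiet P y (pad (Suc n) a) (pad (Suc n) b)"
      unfolding bob_quiet_def p append_assoc empties_Cons using q by blast
    moreover have "bob_weight P (Suc n) y (pad (Suc n) a) (pad (Suc n) b) = bob_weight P n y (pad n a) (pad n b)"
      using q[of 0] by (simp add: p bob_weight_snoc empties_0)
    moreover have "fits (Suc n) a" "fits (Suc n) b" using True by (auto simp: fits_def)
    ultimately show ?thesis using True by (simp add: bob_final_def)
  next
    case False
    then show ?thesis by (simp only: bob_final_def if_False) (simp add: bob_weight_bounds)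
  qed
qed

lemma incseq_charlie_final: "incseq (charlie_final P b c)"
proof (rule incseq_SucI)
  fix n
  show "charlie_final P b c n \<le> charlie_final P b c (Suc n)"
  proof (cases "fits n b \<and> fits n c \<and> charlie_quiet P (pad n b) (pad n c)")
    case True
    then have p: "pad (Suc n) b = pad n b @ [([], [])]" "pad (Suc n) c = pad n c @ [([], [])]"
      by (simp_all add: fits_def pad_Suc_empty)
    have q: "charlie P (pad n b @ empties k) (pad n c @ empties k) = return_pmf ([], [])" for k
      using True by (simp add: charlie_quiet_def)
    have "charlie_quiet P (pad (Suc n) b) (pad (Suc n) c)"
      unfolding charlie_quiet_def p append_assoc empties_Cons using q by blast
    moreover have "charlie_weight P (Suc n) (pad (Suc n) b) (pad (Suc n) c) = charlie_weight P n (pad n b) (pad n c)"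
      using q[of 0] by (simp add: p charlie_weight_snoc empties_0)
    moreover have "fits (Suc n) b" "fits (Suc n) c" using True by (auto simp: fits_def)
    ultimately show ?thesis using True by (simp add: charlie_final_def)
  next
    case False
    then show ?thesis by (simp only: charlie_final_def if_False) (simp add: charlie_weight_bounds)
  qed
qed

lemma alice_final_bounds: "0 \<le> alice_final P x a c n" "alice_final P x a c n \<le> 1"
  by (simp_all add: alice_final_def alice_weight_bounds)

lemma bob_final_bounds: "0 \<le> bob_final P y a b n" "bob_final P y a b n \<le> 1"
  by (simp_all add: bob_final_def bob_weight_bounds)

lemma charlie_final_bounds: "0 \<le> charlie_final P b c n" "charlie_final P b c n \<le> 1"
  by (simp_all add: charlie_final_def charlie_weight_bounds)

lemma incseq_tendsto_unit:
  fixes f :: "nat \<Rightarrow> real"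
  assumes "incseq f" "\<And>n. 0 \<le> f n" "\<And>n. f n \<le> 1"
  shows "\<exists>l. f \<longlonglongrightarrow> l \<and> 0 \<le> l"
proof -
  obtain l where l: "f \<longlonglongrightarrow> l"
    by (rule incseq_convergent[OF assms(1), of 1]) (use assms(3) in auto)
  moreover have "0 \<le> l" using l assms(2) by (simp add: LIMSEQ_le_const)
  ultimately show ?thesis by blast
qed

text \<open>\<open>run\<close> before stripping, with nothing forgotten. The nesting of
  \<open>Pair\<close> lets \<open>pmf_bind_Pair\<close> evaluate it as a plain product.\<close>

definition traces :: "('x, 'y, 'z) protocol \<Rightarrow> 'x pmf \<Rightarrow> 'y pmf \<Rightarrow> nat \<Rightarrow> ('x \<times> 'y \<times> state \<times> 'z) pmf" where
  "traces P pX pY n = bind_pmf pX (\<lambda>x. map_pmf (Pair x) (bind_pmf pY (\<lambda>y. map_pmf (Pair y)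
     (bind_pmf (exec P x y n) (\<lambda>s. map_pmf (Pair s)
       (outp P (strip (fst (snd s))) (strip (snd (snd s)))))))))"

lemma pmf_traces: "pmf (traces P pX pY n) (x, y, (a, b, c), z)
   = pmf pX x * (pmf pY y * (pmf (exec P x y n) (a, b, c) * pmf (outp P (strip b) (strip c)) z))"
  unfolding traces_def pmf_bind_Pair by simp

lemma run_eq: "run P pX pY n = map_pmf (\<lambda>(x, y, s, z).
     (quiescent P x y s, (x, y, z, strip (fst s), strip (fst (snd s)), strip (snd (snd s)))))
   (traces P pX pY n)"
  by (simp add: run_def traces_def map_bind_pmf pmf.map_comp o_def case_prod_unfold)

lemma set_traces_length:
  "(x, y, (a, b, c), z) \<in> set_pmf (traces P pX pY n) \<Longrightarrow> length a = n \<and> length b = n \<and> length c = n"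
  unfolding traces_def by (auto dest: exec_length)

lemma fits_strip: "fits (length l) (strip l)"
  by (simp add: fits_def strip_strip length_strip_le)

lemma strip_eq_iff:
  assumes "length l = n" "fits n a"
  shows "strip l = a \<longleftrightarrow> l = pad n a"
proof
  assume "strip l = a"
  moreover have "pad n (strip l) = l" using assms(1) by (simp add: pad_strip)
  ultimately show "l = pad n a" by simp
next
  assume "l = pad n a"
  then have "strip l = strip a" using assms(2) by (simp only: fits_def strip_pad)
  then show "strip l = a" using assms(2) by (simp only: fits_def)
qed

text \<open>Among transcripts of length \<open>n\<close> stripping is injective, so at most one
  trace of positive probability produces the given outcome, namely the one with padded
  transcripts.\<close>

lemma pmf_run: "pmf (run P pX pY n) (True, (x, y, z, a, b, c))
   = pmf pX x * pmf pY y * (alice_final P x a c n * bob_final P y a b n * charlie_final P b c n) * pmf (outp P b c) z"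
proof -
  let ?h = "\<lambda>(x, y, s, z). (quiescent P x y s, (x, y, z, strip (fst s), strip (fst (snd s)), strip (snd (snd s))))"
  let ?s = "(pad n a, pad n b, pad n c)"
  have run: "pmf (run P pX pY n) (True, (x, y, z, a, b, c))
    = measure_pmf.prob (traces P pX pY n) (?h -` {(True, (x, y, z, a, b, c))})"
    by (simp only: run_eq pmf_map)
  show ?thesis
  proof (cases "fits n a \<and> fits n b \<and> fits n c \<and> quiescent P x y ?s")
    case True
    have "measure_pmf.prob (traces P pX pY n) (?h -` {(True, (x, y, z, a, b, c))})
      = measure_pmf.prob (traces P pX pY n) {(x, y, ?s, z)}"
    proof (rule prob_cong_set_pmf)
      fix v assume v: "v \<in> set_pmf (traces P pX pY n)"
      obtain x' y' a' b' c' z' where v': "v = (x', y', (a', b', c'), z')" by (metis surj_pair)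
      have len: "length a' = n" "length b' = n" "length c' = n"
        using set_traces_length[OF v[unfolded v']] by simp_all
      have "strip a' = a \<longleftrightarrow> a' = pad n a" "strip b' = b \<longleftrightarrow> b' = pad n b" "strip c' = c \<longleftrightarrow> c' = pad n c"
        using True len by (simp_all add: strip_eq_iff)
      then show "v \<in> ?h -` {(True, (x, y, z, a, b, c))} \<longleftrightarrow> v \<in> {(x, y, ?s, z)}"
        using True unfolding v' by auto
    qed
    also have "\<dots> = pmf pX x * (pmf pY y * (pmf (exec P x y n) ?s * pmf (outp P b c) z))"
    proof -
      have "strip (pad n b) = b" "strip (pad n c) = c"
        using True strip_eq_iff[of "pad n b" n b] strip_eq_iff[of "pad n c" n c] by simp_all
      then show ?thesis by (simp only: measure_pmf_single pmf_traces)
    qed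
    finally show ?thesis
      using True unfolding run
      by (simp add: pmf_exec quiescent_eq alice_final_def bob_final_def charlie_final_def)
  next
    case False
    have "measure_pmf.prob (traces P pX pY n) (?h -` {(True, (x, y, z, a, b, c))})
      = measure_pmf.prob (traces P pX pY n) {}"
    proof (rule prob_cong_set_pmf)
      fix v assume v: "v \<in> set_pmf (traces P pX pY n)"
      obtain x' y' a' b' c' z' where v': "v = (x', y', (a', b', c'), z')" by (metis surj_pair)
      have len: "length a' = n" "length b' = n" "length c' = n"
        using set_traces_length[OF v[unfolded v']] by simp_all
      have "fits n (strip a')" "fits n (strip b')" "fits n (strip c')"
        using len by (metis fits_strip)+
      moreover have "pad n (strip a') = a'" "pad n (strip b') = b'" "pad n (strip c') = c'"
        using len by (simp_all add: pad_strip)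
      ultimately show "v \<in> ?h -` {(True, (x, y, z, a, b, c))} \<longleftrightarrow> v \<in> {}"
        using False unfolding v' by auto
    qed
    moreover have "alice_final P x a c n * bob_final P y a b n * charlie_final P b c n = 0"
      using False unfolding quiescent_eq alice_final_def bob_final_def charlie_final_def by auto
    ultimately show ?thesis unfolding run by simp
  qed
qed

lemma incseq_pmf_run: "incseq (\<lambda>n. pmf (run P pX pY n) (True, w))"
proof -
  obtain x y z a b c where w: "w = (x, y, z, a, b, c)" by (metis surj_pair)
  show ?thesis
    unfolding w pmf_run
    by (intro monoI mult_mono mult_left_mono mult_nonneg_nonneg order_refl)
       (auto simp: alice_final_bounds bob_final_bounds charlie_final_bounds incseq_alice_final[THEN incseqD] incseq_bob_final[THEN incseqD] incseq_charlie_final[THEN incseqD])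
qed

text \<open>Convergence of the product alone would not factorise its limit. Each party's factor is
  increasing and bounded by 1, hence converges by itself.\<close>

lemma pmf_outcome:
  assumes "protocol_outcome P pX pY D"
  shows "\<exists>\<alpha> \<beta> \<gamma>. (\<forall>x a c. 0 \<le> \<alpha> x a c) \<and> (\<forall>y a b. 0 \<le> \<beta> y a b) \<and> (\<forall>b c. (0::real) \<le> \<gamma> b c) \<and>
     (\<forall>x y z a b c. pmf D (x, y, z, a, b, c)
        = pmf pX x * pmf pY y * (\<alpha> x a c * \<beta> y a b * \<gamma> b c) * pmf (outp P b c) z)"
proof -
  have "\<forall>x a c. \<exists>l. alice_final P x a c \<longlonglongrightarrow> l \<and> 0 \<le> l"
    by (simp add: incseq_tendsto_unit incseq_alice_final alice_final_bounds)
  then obtain \<alpha> where \<alpha>: "\<And>x a c. alice_final P x a c \<longlonglongrightarrow> \<alpha> x a c" "\<And>x a c. 0 \<le> \<alpha> x a c" by metis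
  have "\<forall>y a b. \<exists>l. bob_final P y a b \<longlonglongrightarrow> l \<and> 0 \<le> l"
    by (simp add: incseq_tendsto_unit incseq_bob_final bob_final_bounds)
  then obtain \<beta> where \<beta>: "\<And>y a b. bob_final P y a b \<longlonglongrightarrow> \<beta> y a b" "\<And>y a b. 0 \<le> \<beta> y a b" by metis
  have "\<forall>b c. \<exists>l. charlie_final P b c \<longlonglongrightarrow> l \<and> 0 \<le> l"
    by (simp add: incseq_tendsto_unit incseq_charlie_final charlie_final_bounds)
  then obtain \<gamma> where \<gamma>: "\<And>b c. charlie_final P b c \<longlonglongrightarrow> \<gamma> b c" "\<And>b c. 0 \<le> \<gamma> b c" by metis
  have "pmf D (x, y, z, a, b, c)
     = pmf pX x * pmf pY y * (\<alpha> x a c * \<beta> y a b * \<gamma> b c) * pmf (outp P b c) z" for x y z a b c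
  proof (rule LIMSEQ_unique)
    show "(\<lambda>n. pmf (run P pX pY n) (True, (x, y, z, a, b, c))) \<longlonglongrightarrow> pmf D (x, y, z, a, b, c)"
      using assms unfolding protocol_outcome_def measure_pmf_single by blast
    show "(\<lambda>n. pmf (run P pX pY n) (True, (x, y, z, a, b, c)))
      \<longlonglongrightarrow> pmf pX x * pmf pY y * (\<alpha> x a c * \<beta> y a b * \<gamma> b c) * pmf (outp P b c) z"
      unfolding pmf_run by (intro tendsto_intros \<alpha> \<beta> \<gamma>)
  qed
  then show ?thesis using \<alpha>(2) \<beta>(2) \<gamma>(2) by blast
qed

lemma pmf_run_le:
  assumes "protocol_outcome P pX pY D"
  shows "pmf (run P pX pY n) (True, w) \<le> pmf D w"
proof (rule incseq_le[OF incseq_pmf_run])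
  show "(\<lambda>n. pmf (run P pX pY n) (True, w)) \<longlonglongrightarrow> pmf D w"
    using assms unfolding protocol_outcome_def measure_pmf_single by blast
qed

section \<open>The first \<open>n\<close> rounds as a function of the final outcome\<close>

definition joint :: "('x, 'y, 'z) protocol \<Rightarrow> 'x pmf \<Rightarrow> 'y pmf \<Rightarrow> nat \<Rightarrow> ('x \<times> 'y \<times> state) pmf" where
  "joint P pX pY n = bind_pmf pX (\<lambda>x. bind_pmf pY (\<lambda>y. map_pmf (\<lambda>s. (x, y, s)) (exec P x y n)))"

definition trunc :: "nat \<Rightarrow> ('x, 'y, 'z) outcome \<Rightarrow> 'x \<times> 'y \<times> state" where
  "trunc n w = (oX w, oY w, (pad n (oM12 w), pad n (oM23 w), pad n (oM31 w)))"

lemma take_exec: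
  "n \<le> N \<Longrightarrow> map_pmf (\<lambda>(a, b, c). (take n a, take n b, take n c)) (exec P x y N) = exec P x y n"
proof (induction N)
  case 0
  then show ?case by simp
next
  case (Suc N)
  show ?case
  proof (cases "n = Suc N")
    case True
    have "map_pmf (\<lambda>(a, b, c). (take n a, take n b, take n c)) (exec P x y (Suc N)) = map_pmf id (exec P x y (Suc N))"
      by (rule map_pmf_cong[OF refl]) (auto simp: True dest!: exec_length simp del: exec.simps)
    then show ?thesis using True by (simp only: pmf.map_id)
  next
    case False
    then have n: "n \<le> N" using Suc by simp
    have "map_pmf (\<lambda>(a, b, c). (take n a, take n b, take n c)) (exec P x y (Suc N))
      = map_pmf (\<lambda>((a, b, c), m). (take n a, take n b, take n c)) (rounds P x y N)"
      unfolding exec_Suc_eq pmf.map_comp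
    proof (rule map_pmf_cong[OF refl])
      fix v assume v: "v \<in> set_pmf (rounds P x y N)"
      obtain a b c ma mb mc where v': "v = ((a, b, c), (ma, mb, mc))" by (metis surj_pair)
      have "(a, b, c) \<in> set_pmf (exec P x y N)" using v by (auto simp: rounds_def v')
      then show "((\<lambda>(a, b, c). (take n a, take n b, take n c)) \<circ> (\<lambda>(s, m). append_round s m)) v
        = (case v of (x, xa) \<Rightarrow> (case x of (a, b, c) \<Rightarrow> \<lambda>m. (take n a, take n b, take n c)) xa)"
        using n by (auto simp: v' append_round_def dest: exec_length)
    qed
    also have "\<dots> = map_pmf (\<lambda>(a, b, c). (take n a, take n b, take n c)) (exec P x y N)"
      by (simp add: rounds_def map_bind_pmf pmf.map_comp o_def map_pmf_const)
         (simp add: map_pmf_def case_prod_unfold)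
    finally show ?thesis using Suc.IH n by simp
  qed
qed

lemma trunc_run:
  assumes "n \<le> N"
  shows "map_pmf (\<lambda>r. trunc n (snd r)) (run P pX pY N) = joint P pX pY n"
proof -
  have "map_pmf (\<lambda>s. (x, y, (pad n (strip (fst s)), pad n (strip (fst (snd s))), pad n (strip (snd (snd s))))))
      (exec P x y N) = map_pmf (\<lambda>s. (x, y, s)) (exec P x y n)" for x :: 'a and y :: 'b
  proof -
    have "map_pmf (\<lambda>s. (x, y, (pad n (strip (fst s)), pad n (strip (fst (snd s))), pad n (strip (snd (snd s))))))
      (exec P x y N) = map_pmf (\<lambda>s. (x, y, s)) (map_pmf (\<lambda>(a, b, c). (take n a, take n b, take n c)) (exec P x y N))"
      unfolding pmf.map_comp
      by (rule map_pmf_cong[OF refl]) (use assms in \<open>auto simp: pad_strip dest!: exec_length\<close>)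
    then show ?thesis by (simp only: take_exec[OF assms])
  qed
  then show ?thesis
    by (simp add: run_eq traces_def joint_def map_bind_pmf pmf.map_comp o_def case_prod_unfold trunc_def
        oX_def oY_def oM12_def oM23_def oM31_def map_pmf_const) (simp add: map_pmf_def)
qed

text \<open>Distinct probability mass functions differ strictly in either direction at some point,
  so a one-sided bound suffices. Up to the probability of not being quiescent after \<open>N\<close>
  rounds, the law of the first \<open>n\<close> rounds lies below the truncated outcome law, and
  that error tends to 0.\<close>

lemma law_trunc:
  assumes out: "protocol_outcome P pX pY D"
  shows "map_pmf (trunc n) D = joint P pX pY n"
proof (rule ccontr)
  assume "map_pmf (trunc n) D \<noteq> joint P pX pY n"
  then obtain v where v: "pmf (map_pmf (trunc n) D) v < pmf (joint P pX pY n) v"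
    using pmf_neq_exists_less by blast
  let ?R = "\<lambda>N. measure_pmf.prob (run P pX pY N)"
  have "pmf (joint P pX pY n) v \<le> pmf (map_pmf (trunc n) D) v + (1 - ?R N {r. fst r})" if "N \<ge> n" for N
  proof -
    have "pmf (joint P pX pY n) v = ?R N {r. trunc n (snd r) = v}"
      by (simp add: trunc_run[OF that, symmetric] pmf_map vimage_def)
    also have "\<dots> \<le> ?R N (Pair True ` {w. trunc n w = v} \<union> - {r. fst r})"
      by (rule measure_pmf.finite_measure_mono) force+
    also have "\<dots> \<le> ?R N (Pair True ` {w. trunc n w = v}) + ?R N (- {r. fst r})"
      by (rule measure_Un_le) auto
    also have "?R N (- {r. fst r}) = 1 - ?R N {r. fst r}"
      using measure_pmf.prob_compl[of "{r. fst r}" "run P pX pY N"] by (simp add: Compl_eq_Diff_UNIV)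
    also have "?R N (Pair True ` {w. trunc n w = v}) \<le> measure_pmf.prob D {w. trunc n w = v}"
    proof -
      have "ennreal (?R N (Pair True ` {w. trunc n w = v}))
        = (\<integral>\<^sup>+ r. ennreal (pmf (run P pX pY N) r) \<partial>count_space (Pair True ` {w. trunc n w = v}))"
        by (simp add: nn_integral_pmf measure_pmf.emeasure_eq_measure)
      also have "\<dots> = (\<integral>\<^sup>+ w. ennreal (pmf (run P pX pY N) (True, w)) \<partial>count_space {w. trunc n w = v})"
        by (rule nn_integral_bij_count_space[symmetric]) (auto simp: bij_betw_def inj_on_def)
      also have "\<dots> \<le> (\<integral>\<^sup>+ w. ennreal (pmf D w) \<partial>count_space {w. trunc n w = v})"
        by (intro nn_integral_mono ennreal_leI pmf_run_le[OF out])
      also have "\<dots> = ennreal (measure_pmf.prob D {w. trunc n w = v})"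
        by (simp add: nn_integral_pmf measure_pmf.emeasure_eq_measure)
      finally show ?thesis by simp
    qed
    finally show ?thesis by (simp add: pmf_map vimage_def)
  qed
  moreover have "(\<lambda>N. pmf (map_pmf (trunc n) D) v + (1 - ?R N {r. fst r})) \<longlonglongrightarrow> pmf (map_pmf (trunc n) D) v + (1 - 1)"
    using out by (intro tendsto_intros) (simp add: protocol_outcome_def terminates_def)
  ultimately have "pmf (joint P pX pY n) v \<le> pmf (map_pmf (trunc n) D) v + (1 - 1)"
    by (intro LIMSEQ_le_const) blast+
  then show False using v by simp
qed

section \<open>Interaction information along the protocol\<close>

text \<open>A party on the links \<open>a\<close> and \<open>c\<close> sends \<open>d\<close> on the
  first and \<open>e\<close> on the second. Weak union puts \<open>d\<close> into the condition
  before \<open>e\<close> is added.\<close>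

lemma nonneg_interaction_move1:
  assumes J: "nonneg_interaction D a b c" and m: "markov D (\<lambda>w. (d w, e w)) (\<lambda>w. (a w, c w)) b"
  shows "nonneg_interaction D (\<lambda>w. (d w, a w)) b (\<lambda>w. (e w, c w))"
proof -
  have "markov D d (\<lambda>w. (a w, c w)) b"
    using markov_decompose_left[OF m, of fst] by simp
  then have "nonneg_interaction D (\<lambda>w. (d w, a w)) b c"
    by (rule nonneg_interaction_extend1[OF J])
  moreover have "markov D e (\<lambda>w. ((d w, a w), c w)) b"
    by (rule markov_cong[OF markov_weak_union[OF m], where \<phi> = id and \<phi>' = id and \<eta> = id and \<eta>' = id
        and \<gamma> = "\<lambda>((d, a), c). ((a, c), d)" and \<gamma>' = "\<lambda>((a, c), d). ((d, a), c)"]) simp_all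
  ultimately have "nonneg_interaction D (\<lambda>w. (d w, a w)) (\<lambda>w. (e w, c w)) b"
    by (intro nonneg_interaction_extend2 nonneg_interaction_sym[of D "\<lambda>w. (d w, a w)" b c])
  then show ?thesis by (rule nonneg_interaction_sym)
qed

text \<open>The same for the party that does not see the distinguished link \<open>a\<close>; both
  messages are remote.\<close>

lemma nonneg_interaction_move2:
  assumes J: "nonneg_interaction D a b c" and m: "markov D (\<lambda>w. (d w, e w)) (\<lambda>w. (b w, c w)) a"
  shows "nonneg_interaction D a (\<lambda>w. (d w, b w)) (\<lambda>w. (e w, c w))"
proof -
  have "markov D d (\<lambda>w. (b w, c w)) a"
    using markov_decompose_left[OF m, of fst] by simp
  then have 1: "nonneg_interaction D a (\<lambda>w. (d w, b w)) c"
    by (rule nonneg_interaction_extend2_remote[OF J])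
  have 2: "markov D e (\<lambda>w. (c w, (d w, b w))) a"
    by (rule markov_cong[OF markov_weak_union[OF m], where \<phi> = id and \<phi>' = id and \<eta> = id and \<eta>' = id
        and \<gamma> = "\<lambda>(c, (d, b)). ((b, c), d)" and \<gamma>' = "\<lambda>((b, c), d). (c, (d, b))"]) simp_all
  show ?thesis
    by (rule nonneg_interaction_sym[OF nonneg_interaction_extend2_remote[OF nonneg_interaction_sym[OF 1] 2]])
qed

text \<open>Independence of the inputs at work: averaging over \<open>x\<close> and over
  \<open>y\<close> separately keeps the product form, so the inputs disappear and a factorisation of
  the law of the transcripts alone remains.\<close>

lemma pmf_bind_independent:
  fixes p :: "'a::finite pmf" and q :: "'b::finite pmf"
  assumes "\<And>x y. pmf (r x y) v = F x * G y * K"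
  shows "pmf (bind_pmf p (\<lambda>x. bind_pmf q (\<lambda>y. r x y))) v
    = (\<Sum>x\<in>UNIV. pmf p x * F x) * (\<Sum>y\<in>UNIV. pmf q y * G y) * K"
proof -
  have "pmf (bind_pmf p (\<lambda>x. bind_pmf q (\<lambda>y. r x y))) v
    = (\<Sum>x\<in>UNIV. \<Sum>y\<in>UNIV. pmf p x * (pmf q y * (F x * G y * K)))"
    by (simp add: pmf_bind_finite assms sum_distrib_left)
  also have "\<dots> = (\<Sum>x\<in>UNIV. pmf p x * F x) * (\<Sum>y\<in>UNIV. pmf q y * G y) * K"
    unfolding sum_product unfolding sum_distrib_right by (intro sum.cong refl) (simp add: mult_ac)
  finally show ?thesis .
qed

context
  fixes P :: "('x::finite, 'y::finite, 'z) protocol" and pX :: "'x pmf" and pY :: "'y pmf"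
    and n :: nat and D :: "'w pmf" and r :: "'w \<Rightarrow> state \<times> round_msgs"
  assumes law: "map_pmf r D = bind_pmf pX (\<lambda>x. bind_pmf pY (\<lambda>y. rounds P x y n))"
begin

text \<open>Likelihoods averaged over the private input, including the sender's next message.
  \<open>avgB0\<close> omits Bob's message, for the stage at which only Alice's has been
  added.\<close>

definition "avgA a c m = (\<Sum>x\<in>UNIV. pmf pX x * (alice_weight P n x a c * pmf (alice P x a c) m))"
definition "avgB a b m = (\<Sum>y\<in>UNIV. pmf pY y * (bob_weight P n y a b * pmf (bob P y a b) m))"
definition "avgB0 a b = (\<Sum>y\<in>UNIV. pmf pY y * bob_weight P n y a b)"

lemma avg_nonneg: "0 \<le> avgA a c m" "0 \<le> avgB a b m" "0 \<le> avgB0 a b"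
  by (auto simp: avgA_def avgB_def avgB0_def alice_weight_bounds bob_weight_bounds intro!: sum_nonneg)

lemma prob_round:
  "measure_pmf.prob D {w. \<phi> (r w) = v} = pmf (bind_pmf pX (\<lambda>x. bind_pmf pY (\<lambda>y. map_pmf \<phi> (rounds P x y n)))) v"
proof -
  have "measure_pmf.prob D {w. \<phi> (r w) = v} = pmf (map_pmf \<phi> (map_pmf r D)) v"
    by (simp add: pmf.map_comp pmf_map vimage_def)
  then show ?thesis by (simp add: law map_bind_pmf)
qed

lemma prob_round1:
  "measure_pmf.prob D {w. (fst (r w), fst (snd (r w))) = ((a, b, c), ma)}
   = avgA a c ma * avgB0 a b * charlie_weight P n b c"
proof -
  have "map_pmf (\<lambda>v. (fst v, fst (snd v))) (rounds P x y n)
    = bind_pmf (exec P x y n) (\<lambda>s. map_pmf (Pair s) (alice P x (fst s) (snd (snd s))))" for x y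
  proof -
    have "map_pmf (\<lambda>m. (s, fst m)) (round_pmf P x y s) = map_pmf (Pair s) (map_pmf fst (round_pmf P x y s))" for s
      by (simp add: pmf.map_comp o_def)
    then show ?thesis
      by (simp add: rounds_def map_bind_pmf pmf.map_comp o_def round_pmf_def map_fst_pair_pmf case_prod_unfold)
  qed
  then show ?thesis
    unfolding prob_round[of "\<lambda>v. (fst v, fst (snd v))"] avgA_def avgB0_def
    by (intro pmf_bind_independent) (simp add: pmf_bind_Pair pmf_exec mult_ac)
qed

lemma prob_round2:
  "measure_pmf.prob D {w. (fst (r w), fst (snd (r w)), fst (snd (snd (r w)))) = ((a, b, c), ma, mb)}
   = avgA a c ma * avgB a b mb * charlie_weight P n b c"
proof -
  have "map_pmf (\<lambda>v. (fst v, fst (snd v), fst (snd (snd v)))) (rounds P x y n)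
    = bind_pmf (exec P x y n) (\<lambda>s. map_pmf (Pair s)
       (pair_pmf (alice P x (fst s) (snd (snd s))) (bob P y (fst s) (fst (snd s)))))" for x y
  proof -
    have "map_pmf (\<lambda>m. (s, fst m, fst (snd m))) (round_pmf P x y s)
      = map_pmf (Pair s) (map_pmf (\<lambda>(u, v). (id u, fst v)) (round_pmf P x y s))" for s
      by (simp add: pmf.map_comp o_def case_prod_unfold)
    moreover have "map_pmf (\<lambda>(u, v). (id u, fst v)) (round_pmf P x y s)
      = pair_pmf (alice P x (fst s) (snd (snd s))) (bob P y (fst s) (fst (snd s)))" for s
      unfolding round_pmf_def
      using map_pair[where f = id and g = fst,
          of "alice P x (fst s) (snd (snd s))" "pair_pmf (bob P y (fst s) (fst (snd s))) (charlie P (fst (snd s)) (snd (snd s)))"]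
      by (simp add: case_prod_unfold map_fst_pair_pmf)
    ultimately have "map_pmf (\<lambda>m. (s, fst m, fst (snd m))) (round_pmf P x y s)
      = map_pmf (Pair s) (pair_pmf (alice P x (fst s) (snd (snd s))) (bob P y (fst s) (fst (snd s))))" for s
      by (simp only:)
    then show ?thesis
      by (simp add: rounds_def map_bind_pmf pmf.map_comp o_def)
  qed
  then show ?thesis
    unfolding prob_round[of "\<lambda>v. (fst v, fst (snd v), fst (snd (snd v)))"] avgA_def avgB_def
    by (intro pmf_bind_independent) (simp add: pmf_bind_Pair pmf_exec pmf_pair mult_ac)
qed

lemma prob_round3:
  "measure_pmf.prob D {w. r w = ((a, b, c), ma, mb, mc)}
   = avgA a c ma * avgB a b mb * (charlie_weight P n b c * pmf (charlie P b c) mc)"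
  using prob_round[of "\<lambda>v. v" "((a, b, c), ma, mb, mc)"]
  unfolding avgA_def avgB_def
  by (simp only: pmf.map_ident) (intro pmf_bind_independent, simp add: pmf_rounds pmf_exec mult_ac)

abbreviation (input) "rA w \<equiv> fst (fst (r w))"
abbreviation (input) "rB w \<equiv> fst (snd (fst (r w)))"
abbreviation (input) "rC w \<equiv> snd (snd (fst (r w)))"
abbreviation (input) "mA w \<equiv> fst (snd (r w))"
abbreviation (input) "mB w \<equiv> fst (snd (snd (r w)))"
abbreviation (input) "mC w \<equiv> snd (snd (snd (r w)))"

lemma markov_alice: "markov D mA (\<lambda>w. (rA w, rC w)) rB"
proof (rule markovI_prod[where F = "\<lambda>m (a, c). avgA a c m" and G = "\<lambda>(a, c) b. avgB0 a b * charlie_weight P n b c"])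
  fix m b and s :: "trans \<times> trans"
  have "{w. mA w = m \<and> (rA w, rC w) = s \<and> rB w = b} = {w. (fst (r w), fst (snd (r w))) = ((fst s, b, snd s), m)}"
    by (auto simp: prod_eq_iff)
  then show "measure_pmf.prob D {w. mA w = m \<and> (rA w, rC w) = s \<and> rB w = b}
    = (case s of (a, c) \<Rightarrow> avgA a c m) * (case s of (a, c) \<Rightarrow> \<lambda>b. avgB0 a b * charlie_weight P n b c) b"
    by (simp only: prob_round1) (simp add: case_prod_unfold)
qed (auto simp: avg_nonneg charlie_weight_bounds)

text \<open>The messages of a round are simultaneous but are added in the order Alice, Bob, Charlie.
  So Alice's new message to Bob already belongs to the condition, and her new message to Charlie to
  the remote link.\<close>

lemma markov_bob: "markov D mB (\<lambda>w. ((fst (mA w), rA w), rB w)) (\<lambda>w. (snd (mA w), rC w))"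
proof (rule markovI_prod[where F = "\<lambda>m s. avgB (snd (fst s)) (snd s) m"
    and G = "\<lambda>s t. avgA (snd (fst s)) (snd t) (fst (fst s), fst t) * charlie_weight P n (snd s) (snd t)"])
  fix m and s :: "(msg \<times> trans) \<times> trans" and t :: "msg \<times> trans"
  have "{w. mB w = m \<and> ((fst (mA w), rA w), rB w) = s \<and> (snd (mA w), rC w) = t}
     = {w. (fst (r w), fst (snd (r w)), fst (snd (snd (r w)))) = ((snd (fst s), snd s, snd t), (fst (fst s), fst t), m)}"
    by (auto simp: prod_eq_iff)
  then show "measure_pmf.prob D {w. mB w = m \<and> ((fst (mA w), rA w), rB w) = s \<and> (snd (mA w), rC w) = t}
    = avgB (snd (fst s)) (snd s) m * (avgA (snd (fst s)) (snd t) (fst (fst s), fst t) * charlie_weight P n (snd s) (snd t))"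
    by (simp only: prob_round2) simp
qed (auto simp: avg_nonneg charlie_weight_bounds)

lemma markov_charlie:
  "markov D mC (\<lambda>w. ((snd (mB w), rB w), (snd (mA w), rC w))) (\<lambda>w. (fst (mB w), (fst (mA w), rA w)))"
proof (rule markovI_prod[where
      F = "\<lambda>m s. charlie_weight P n (snd (fst s)) (snd (snd s)) * pmf (charlie P (snd (fst s)) (snd (snd s))) m"
    and G = "\<lambda>s t. avgA (snd (snd t)) (snd (snd s)) (fst (snd t), fst (snd s))
       * avgB (snd (snd t)) (snd (fst s)) (fst t, fst (fst s))"])
  fix m and s :: "(msg \<times> trans) \<times> (msg \<times> trans)" and t :: "msg \<times> msg \<times> trans"
  have "{w. mC w = m \<and> ((snd (mB w), rB w), (snd (mA w), rC w)) = s \<and> (fst (mB w), (fst (mA w), rA w)) = t}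
     = {w. r w = ((snd (snd t), snd (fst s), snd (snd s)), (fst (snd t), fst (snd s)), (fst t, fst (fst s)), m)}"
    by (auto simp: prod_eq_iff)
  then show "measure_pmf.prob D {w. mC w = m \<and> ((snd (mB w), rB w), (snd (mA w), rC w)) = s \<and> (fst (mB w), (fst (mA w), rA w)) = t}
    = charlie_weight P n (snd (fst s)) (snd (snd s)) * pmf (charlie P (snd (fst s)) (snd (snd s))) m
     * (avgA (snd (snd t)) (snd (snd s)) (fst (snd t), fst (snd s))
       * avgB (snd (snd t)) (snd (fst s)) (fst t, fst (fst s)))"
    by (simp only: prob_round3) simp
qed (auto simp: avg_nonneg charlie_weight_bounds)

text \<open>Alice and Bob both send on link 12, the distinguished argument, so
  \<open>nonneg_interaction_move1\<close> serves them, for Bob with the other two links exchanged.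
  Charlie sends on 23 and 31 only, which is the case of
  \<open>nonneg_interaction_move2\<close>.\<close>

lemma nonneg_interaction_round:
  assumes "nonneg_interaction D rA rB rC"
  shows "nonneg_interaction D (\<lambda>w. (fst (mB w), fst (mA w), rA w))
     (\<lambda>w. (fst (mC w), snd (mB w), rB w)) (\<lambda>w. (snd (mC w), snd (mA w), rC w))"
proof -
  have "nonneg_interaction D (\<lambda>w. (fst (mA w), rA w)) rB (\<lambda>w. (snd (mA w), rC w))"
    using assms markov_alice by (intro nonneg_interaction_move1) simp_all
  then have "nonneg_interaction D (\<lambda>w. (fst (mA w), rA w)) (\<lambda>w. (snd (mA w), rC w)) rB"
    by (rule nonneg_interaction_sym)
  then have "nonneg_interaction D (\<lambda>w. (fst (mB w), fst (mA w), rA w)) (\<lambda>w. (snd (mA w), rC w)) (\<lambda>w. (snd (mB w), rB w))"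
    using markov_bob by (intro nonneg_interaction_move1) simp_all
  then have "nonneg_interaction D (\<lambda>w. (fst (mB w), fst (mA w), rA w)) (\<lambda>w. (snd (mB w), rB w)) (\<lambda>w. (snd (mA w), rC w))"
    by (rule nonneg_interaction_sym)
  moreover have "markov D (\<lambda>w. (fst (mC w), snd (mC w)))
      (\<lambda>w. ((snd (mB w), rB w), (snd (mA w), rC w))) (\<lambda>w. (fst (mB w), (fst (mA w), rA w)))"
    using markov_charlie by simp
  ultimately show ?thesis by (rule nonneg_interaction_move2)
qed

end

lemma last_round_pad:
  "last_round (pad (Suc n) a, pad (Suc n) b, pad (Suc n) c) = ((pad n a, pad n b, pad n c),
     (fst (last (pad (Suc n) a)), snd (last (pad (Suc n) c))),
     (snd (last (pad (Suc n) a)), fst (last (pad (Suc n) b))),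
     (snd (last (pad (Suc n) b)), fst (last (pad (Suc n) c))))"
proof -
  have "butlast (pad (Suc n) l) = pad n l" for l
    using pad_Suc_snoc[of n l] by (metis butlast_snoc)
  then show ?thesis by (simp add: last_round_def)
qed

lemma pad_Suc_eq_iff:
  "pad (Suc n) l = pad (Suc n) l' \<longleftrightarrow> pad n l = pad n l' \<and> last (pad (Suc n) l) = last (pad (Suc n) l')"
  using pad_Suc_snoc[of n l] pad_Suc_snoc[of n l'] by (metis append1_eq_conv)

text \<open>The state after \<open>n\<close> rounds and the messages of the next one are both read
  off the outcome; \<open>law_trunc\<close> gives them the law required by the one-round lemma. With
  0 rounds all entropies vanish.\<close>

lemma nonneg_interaction_pad:
  fixes P :: "('x::finite, 'y::finite, 'z) protocol"
  assumes out: "protocol_outcome P pX pY D"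
  shows "nonneg_interaction D (\<lambda>w. pad n (oM12 w)) (\<lambda>w. pad n (oM23 w)) (\<lambda>w. pad n (oM31 w))"
proof (induction n)
  case 0
  show ?case by (simp add: nonneg_interaction_def cond_ent_eq_0 determines_def pad_def)
next
  case (Suc n)
  define r where "r w = last_round (snd (snd (trunc (Suc n) w)))" for w :: "('x, 'y, 'z) outcome"
  have r: "r w = ((pad n (oM12 w), pad n (oM23 w), pad n (oM31 w)),
     (fst (last (pad (Suc n) (oM12 w))), snd (last (pad (Suc n) (oM31 w)))),
     (snd (last (pad (Suc n) (oM12 w))), fst (last (pad (Suc n) (oM23 w)))),
     (snd (last (pad (Suc n) (oM23 w))), fst (last (pad (Suc n) (oM31 w)))))" for w
    by (simp add: r_def trunc_def last_round_pad)
  have "map_pmf r D = map_pmf (\<lambda>v. last_round (snd (snd v))) (map_pmf (trunc (Suc n)) D)"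
    by (simp add: pmf.map_comp o_def r_def[abs_def])
  also have "\<dots> = bind_pmf pX (\<lambda>x. bind_pmf pY (\<lambda>y. rounds P x y n))"
    unfolding law_trunc[OF out] joint_def rounds_eq by (simp add: map_bind_pmf pmf.map_comp o_def del: exec.simps)
  finally have law: "map_pmf r D = bind_pmf pX (\<lambda>x. bind_pmf pY (\<lambda>y. rounds P x y n))" .
  show ?case
  proof (rule nonneg_interaction_cong[OF nonneg_interaction_round[OF law]])
    show "nonneg_interaction D (\<lambda>w. fst (fst (r w))) (\<lambda>w. fst (snd (fst (r w)))) (\<lambda>w. snd (snd (fst (r w))))"
      using Suc by (simp add: r)
  qed (auto simp: r pad_Suc_eq_iff prod_eq_iff)
qed

lemma approximates_pad:
  assumes "\<And>w. w \<in> set_pmf D \<Longrightarrow> strip (f w) = f w"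
  shows "approximates D (\<lambda>n w. pad n (f w)) f"
proof -
  have "\<forall>\<^sub>F n in sequentially. strip (pad n (f w)) = f w" if "w \<in> set_pmf D" for w
    using eventually_ge_at_top[of "length (f w)"] by eventually_elim (simp add: strip_pad assms that)
  moreover have "determines D f (\<lambda>w. pad n (f w))" for n by (auto simp: determines_def)
  ultimately show ?thesis unfolding approximates_def by blast
qed

text \<open>A positive limit has a positive term, and the factors of that term vanish on transcripts
  that are not stripped.\<close>

lemma outcome_strip:
  assumes out: "protocol_outcome P pX pY D" and w: "w \<in> set_pmf D"
  shows "strip (oM12 w) = oM12 w" "strip (oM23 w) = oM23 w" "strip (oM31 w) = oM31 w"
proof -
  obtain x y z a b c where w': "w = (x, y, z, a, b, c)" by (metis surj_pair)
  have "(\<lambda>n. pmf (run P pX pY n) (True, w)) \<longlonglongrightarrow> pmf D w"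
    using out unfolding protocol_outcome_def measure_pmf_single by blast
  moreover have "pmf D w > 0" using w by (simp add: pmf_positive)
  ultimately have "\<forall>\<^sub>F n in sequentially. 0 < pmf (run P pX pY n) (True, w)" by (rule order_tendstoD)
  then obtain n where "0 < pmf (run P pX pY n) (True, w)" by (meson eventually_sequentially order_refl)
  then have "alice_final P x a c n \<noteq> 0" "bob_final P y a b n \<noteq> 0" unfolding w' pmf_run by auto
  then have "fits n a" "fits n b" "fits n c" by (auto simp: alice_final_def bob_final_def split: if_splits)
  then show "strip (oM12 w) = oM12 w" "strip (oM23 w) = oM23 w" "strip (oM31 w) = oM31 w"
    by (simp_all add: w' oM12_def oM23_def oM31_def fits_def)
qed

lemma nonneg_interaction_outcome:
  fixes P :: "('x::finite, 'y::finite, 'z) protocol"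
  assumes out: "protocol_outcome P pX pY D"
  shows "nonneg_interaction D oM12 oM23 oM31"
  by (rule nonneg_interaction_limit[OF approximates_pad approximates_pad approximates_pad
      nonneg_interaction_pad[OF out]]) (simp_all add: outcome_strip[OF out])

section \<open>Inputs and output are determined by the transcripts\<close>

lemma prob_pos_of_mem: "w \<in> set_pmf D \<Longrightarrow> Q w \<Longrightarrow> measure_pmf.prob D {v. Q v} > 0"
  by (rule measure_pmf_posI[of w]) simp_all

text \<open>The hypothesis \<open>scale\<close> says that the joint law factorises as \<open>k x m * \<rho> m y z\<close>;
privacy makes it proportional to \<open>W x y z\<close> as well, so two inputs compatible with the same
transcripts \<open>m\<close> have proportional, hence equal, rows of \<open>W\<close>.\<close>

lemma input_determined:
  fixes X :: "'w \<Rightarrow> 'x" and Y :: "'w \<Rightarrow> 'y" and Z :: "'w \<Rightarrow> 'z::finite" and M :: "'w \<Rightarrow> 'm"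
    and W :: "'x \<Rightarrow> 'y \<Rightarrow> 'z pmf"
  assumes indep: "\<And>x y. measure_pmf.prob D {w. X w = x \<and> Y w = y} = pX x * pY y"
    and pos: "\<And>x. 0 < pX x" "\<And>y. 0 < pY y"
    and marg: "\<And>x. measure_pmf.prob D {w. X w = x} = pX x"
    and correct: "\<And>x y z. measure_pmf.prob D {w. X w = x \<and> Y w = y \<and> Z w = z}
      = measure_pmf.prob D {w. X w = x \<and> Y w = y} * pmf (W x y) z"
    and privacy: "markov D M X (\<lambda>w. (Y w, Z w))"
    and scale: "\<And>m x x' y z. measure_pmf.prob D {w. M w = m \<and> X w = x \<and> Y w = y \<and> Z w = z} * k x' m
      = measure_pmf.prob D {w. M w = m \<and> X w = x' \<and> Y w = y \<and> Z w = z} * k x m"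
    and kpos: "\<And>w. w \<in> set_pmf D \<Longrightarrow> (0::real) < k (X w) (M w)"
    and nf: "\<And>x x'. (\<And>y z. pmf (W x y) z = pmf (W x' y) z) \<Longrightarrow> x = x'"
  shows "determines D M X"
  unfolding determines_def
proof (intro ballI impI)
  fix v w assume v: "v \<in> set_pmf D" and w: "w \<in> set_pmf D" and M: "M v = M w"
  define m where "m = M w"
  define \<mu> where "\<mu> x = measure_pmf.prob D {u. M u = m \<and> X u = x}" for x
  have joint: "measure_pmf.prob D {u. M u = m \<and> X u = x \<and> Y u = y \<and> Z u = z} = \<mu> x * pY y * pmf (W x y) z" for x y z
  proof -
    have "measure_pmf.prob D {u. M u = m \<and> X u = x \<and> Y u = y \<and> Z u = z} * pX x = \<mu> x * (pX x * pY y * pmf (W x y) z)"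
      using privacy[unfolded markov_def, rule_format, of m x "(y, z)"] correct[of x y z]
      by (simp add: \<mu>_def marg indep)
    then show ?thesis using pos(1)[of x] by (simp add: mult_ac)
  qed
  have \<mu>pos: "\<mu> (X v) > 0" "\<mu> (X w) > 0"
    unfolding \<mu>_def by (rule prob_pos_of_mem[OF v] prob_pos_of_mem[OF w]; simp add: m_def M)+
  have kp: "k (X v) m > 0" "k (X w) m > 0" using kpos[OF v] kpos[OF w] by (simp_all add: m_def M)
  have ratio: "\<mu> (X v) * k (X w) m * pmf (W (X v) y) z = \<mu> (X w) * k (X v) m * pmf (W (X w) y) z" for y z
    using scale[of m "X v" y z "X w"] pos(2)[of y] unfolding joint by (simp add: mult_ac)
  \<comment> \<open>Both rows of \<open>W\<close> have total mass 1, so summing \<open>ratio\<close>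
    over \<open>z\<close> at one arbitrary second input, here \<open>undefined\<close>, forces the
    proportionality factor to be 1.\<close>
  have "\<mu> (X v) * k (X w) m = \<mu> (X w) * k (X v) m"
  proof -
    have "(\<Sum>z\<in>UNIV. pmf (W x y) z) = 1" for x y by (rule sum_pmf_eq_1) auto
    moreover have "(\<Sum>z\<in>UNIV. \<mu> (X v) * k (X w) m * pmf (W (X v) undefined) z)
      = (\<Sum>z\<in>UNIV. \<mu> (X w) * k (X v) m * pmf (W (X w) undefined) z)"
      by (rule sum.cong[OF refl ratio])
    ultimately show ?thesis by (simp add: sum_distrib_left[symmetric])
  qed
  with ratio have "pmf (W (X v) y) z = pmf (W (X w) y) z" for y z
    using \<mu>pos kp by (metis less_irrefl mult_cancel_left mult_pos_pos)
  then show "X v = X w" by (rule nf)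
qed

text \<open>Summation over the link that a party does not see. In Bob's case \<open>oY\<close>
  precedes \<open>oX\<close>, since \<open>input_determined\<close> is applied to him with the
  inputs exchanged.\<close>

lemma prob_outcome_conj:
  fixes D :: "('x, 'y, 'z) outcome pmf"
  shows "(\<integral>\<^sup>+ b. ennreal (pmf D (x, y, z, a, b, c)) \<partial>count_space UNIV)
    = ennreal (measure_pmf.prob D {w. (oM12 w, oM31 w) = (a, c) \<and> oX w = x \<and> oY w = y \<and> oZ w = z})"
    "(\<integral>\<^sup>+ c. ennreal (pmf D (x, y, z, a, b, c)) \<partial>count_space UNIV)
    = ennreal (measure_pmf.prob D {w. (oM12 w, oM23 w) = (a, b) \<and> oY w = y \<and> oX w = x \<and> oZ w = z})"
    "(\<integral>\<^sup>+ a. ennreal (pmf D (x, y, z, a, b, c)) \<partial>count_space UNIV)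
    = ennreal (measure_pmf.prob D {w. (oM23 w, oM31 w) = (b, c) \<and> oX w = x \<and> oY w = y \<and> oZ w = z})"
proof -
  note defs = oX_def oY_def oZ_def oM12_def oM23_def oM31_def
  have "{w. oM23 w = b \<and> (oM12 w, oM31 w) = (a, c) \<and> oX w = x \<and> oY w = y \<and> oZ w = z} = {(x, y, z, a, b, c)}" for b
    by (auto simp: defs prod_eq_iff)
  then show "(\<integral>\<^sup>+ b. ennreal (pmf D (x, y, z, a, b, c)) \<partial>count_space UNIV)
    = ennreal (measure_pmf.prob D {w. (oM12 w, oM31 w) = (a, c) \<and> oX w = x \<and> oY w = y \<and> oZ w = z})"
    by (subst nn_integral_prob_conj[of D oM23, symmetric]) (simp add: measure_pmf_single)
  have "{w. oM31 w = c \<and> (oM12 w, oM23 w) = (a, b) \<and> oY w = y \<and> oX w = x \<and> oZ w = z} = {(x, y, z, a, b, c)}" for c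
    by (auto simp: defs prod_eq_iff)
  then show "(\<integral>\<^sup>+ c. ennreal (pmf D (x, y, z, a, b, c)) \<partial>count_space UNIV)
    = ennreal (measure_pmf.prob D {w. (oM12 w, oM23 w) = (a, b) \<and> oY w = y \<and> oX w = x \<and> oZ w = z})"
    by (subst nn_integral_prob_conj[of D oM31, symmetric]) (simp add: measure_pmf_single)
  have "{w. oM12 w = a \<and> (oM23 w, oM31 w) = (b, c) \<and> oX w = x \<and> oY w = y \<and> oZ w = z} = {(x, y, z, a, b, c)}" for a
    by (auto simp: defs prod_eq_iff)
  then show "(\<integral>\<^sup>+ a. ennreal (pmf D (x, y, z, a, b, c)) \<partial>count_space UNIV)
    = ennreal (measure_pmf.prob D {w. (oM23 w, oM31 w) = (b, c) \<and> oX w = x \<and> oY w = y \<and> oZ w = z})"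
    by (subst nn_integral_prob_conj[of D oM12, symmetric]) (simp add: measure_pmf_single)
qed

text \<open>Carries a proportionality of single outcomes over to their sums over the unseen
  link.\<close>

lemma prob_scale:
  fixes p q :: "'a \<Rightarrow> real"
  assumes "\<And>b. p b * k = q b * l" "0 \<le> k" "0 \<le> l" "\<And>b. 0 \<le> p b" "\<And>b. 0 \<le> q b"
    and "(\<integral>\<^sup>+ b. ennreal (p b) \<partial>count_space UNIV) = ennreal P" "(\<integral>\<^sup>+ b. ennreal (q b) \<partial>count_space UNIV) = ennreal Q"
    and "0 \<le> P" "0 \<le> Q"
  shows "P * k = Q * l"
proof -
  have "ennreal (P * k) = (\<integral>\<^sup>+ b. ennreal (p b) * ennreal k \<partial>count_space UNIV)"
    using assms by (simp add: nn_integral_multc ennreal_mult)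
  also have "\<dots> = (\<integral>\<^sup>+ b. ennreal (q b) * ennreal l \<partial>count_space UNIV)"
    using assms by (intro nn_integral_cong) (simp flip: ennreal_mult)
  also have "\<dots> = ennreal (Q * l)"
    using assms by (simp add: nn_integral_multc ennreal_mult)
  finally show ?thesis using assms by simp
qed

text \<open>For a fixed view of Alice, \<open>pmf pX x\<close> and \<open>\<alpha>\<close> hold all
  dependence of the outcome law on \<open>x\<close>, apart from the choice of output and the other
  parties' factors, which do not mention it; this is \<open>k\<close>. Bob is symmetric. For Charlie
  the output kernel \<open>outp\<close> takes the place of \<open>k\<close>.\<close>

lemma outcome_determines:
  fixes W :: "'x::finite \<Rightarrow> 'y::finite \<Rightarrow> 'z::finite pmf"
    and P :: "('x, 'y, 'z) protocol"
  assumes nf: "normal_form W"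
    and full: "set_pmf pX = UNIV" "set_pmf pY = UNIV"
    and sec: "secure_protocol pX pY W P D"
  shows "determines D (\<lambda>w. (oM12 w, oM31 w)) oX"
    and "determines D (\<lambda>w. (oM12 w, oM23 w)) oY"
    and "determines D (\<lambda>w. (oM23 w, oM31 w)) oZ"
proof -
  have out: "protocol_outcome P pX pY D" and cor: "correct W D" and priv: "is_private D"
    using sec by (simp_all add: secure_protocol_def)
  obtain \<alpha> \<beta> \<gamma> where nonneg: "\<And>x a c. 0 \<le> \<alpha> x a c" "\<And>y a b. 0 \<le> \<beta> y a b" "\<And>b c. (0::real) \<le> \<gamma> b c"
    and pD: "\<And>x y z a b c. pmf D (x, y, z, a, b, c)
        = pmf pX x * pmf pY y * (\<alpha> x a c * \<beta> y a b * \<gamma> b c) * pmf (outp P b c) z"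
    using pmf_outcome[OF out] by blast
  have pos: "0 < pmf pX x" "0 < pmf pY y" for x y
    using full by (auto simp: pmf_positive)
  have law: "map_pmf (\<lambda>w. (oX w, oY w)) D = pair_pmf pX pY"
  proof -
    \<comment> \<open>Truncation to 0 rounds erases the transcripts, so \<open>law_trunc\<close>
      reduces to the law of the inputs.\<close>
    have "map_pmf (\<lambda>w. (oX w, oY w)) D = map_pmf (\<lambda>(x, y, s). (x, y)) (map_pmf (trunc 0) D)"
      by (simp add: pmf.map_comp o_def trunc_def)
    also have "\<dots> = pair_pmf pX pY"
      unfolding law_trunc[OF out] joint_def pair_pmf_def
      by (simp add: map_bind_pmf pmf.map_comp o_def map_pmf_const)
    finally show ?thesis .
  qed
  have indep: "measure_pmf.prob D {w. oX w = x \<and> oY w = y} = pmf pX x * pmf pY y" for x y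
  proof -
    have "measure_pmf.prob D {w. oX w = x \<and> oY w = y} = pmf (map_pmf (\<lambda>w. (oX w, oY w)) D) (x, y)"
      by (simp add: pmf_map vimage_def)
    then show ?thesis by (simp add: law pmf_pair)
  qed
  have margX: "measure_pmf.prob D {w. oX w = x} = pmf pX x" for x
  proof -
    have "measure_pmf.prob D {w. oX w = x} = pmf (map_pmf fst (map_pmf (\<lambda>w. (oX w, oY w)) D)) x"
      by (simp add: pmf.map_comp o_def pmf_map vimage_def)
    then show ?thesis by (simp add: law map_fst_pair_pmf)
  qed
  have margY: "measure_pmf.prob D {w. oY w = y} = pmf pY y" for y
  proof -
    have "measure_pmf.prob D {w. oY w = y} = pmf (map_pmf snd (map_pmf (\<lambda>w. (oX w, oY w)) D)) y"
      by (simp add: pmf.map_comp o_def pmf_map vimage_def)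
    then show ?thesis by (simp add: law map_snd_pair_pmf)
  qed
  have cor': "measure_pmf.prob D {w. oX w = x \<and> oY w = y \<and> oZ w = z} = pmf pX x * pmf pY y * pmf (W x y) z" for x y z
    using cor by (simp add: correct_def indep)
  have supp: "0 < \<alpha> (oX w) (oM12 w) (oM31 w)" "0 < \<beta> (oY w) (oM12 w) (oM23 w)"
      "0 < pmf (outp P (oM23 w) (oM31 w)) (oZ w)" if "w \<in> set_pmf D" for w
  proof -
    obtain x y z a b c where w': "w = (x, y, z, a, b, c)" by (metis surj_pair)
    have "pmf D (x, y, z, a, b, c) \<noteq> 0" using that w' by (simp add: set_pmf_iff)
    then have "\<alpha> x a c \<noteq> 0" "\<beta> y a b \<noteq> 0" "pmf (outp P b c) z \<noteq> 0" unfolding pD by auto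
    then show "0 < \<alpha> (oX w) (oM12 w) (oM31 w)" "0 < \<beta> (oY w) (oM12 w) (oM23 w)"
      "0 < pmf (outp P (oM23 w) (oM31 w)) (oZ w)"
      using nonneg(1)[of x a c] nonneg(2)[of y a b]
      by (simp_all add: w' oX_def oY_def oZ_def oM12_def oM23_def oM31_def order_less_le)
  qed
  show "determines D (\<lambda>w. (oM12 w, oM31 w)) oX"
  proof (rule input_determined[where Y = oY and Z = oZ and pX = "pmf pX" and pY = "pmf pY" and W = W
        and k = "\<lambda>x m. pmf pX x * \<alpha> x (fst m) (snd m)"])
    show "measure_pmf.prob D {w. (oM12 w, oM31 w) = m \<and> oX w = x \<and> oY w = y \<and> oZ w = z}
       * (pmf pX x' * \<alpha> x' (fst m) (snd m))
      = measure_pmf.prob D {w. (oM12 w, oM31 w) = m \<and> oX w = x' \<and> oY w = y \<and> oZ w = z}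
       * (pmf pX x * \<alpha> x (fst m) (snd m))" for m x x' y z
    proof (cases m)
      case (Pair a c)
      show ?thesis
        unfolding Pair by (rule prob_scale[OF _ _ _ _ _ prob_outcome_conj(1) prob_outcome_conj(1)])
          (simp_all add: pD nonneg mult_ac)
    qed
    show "(\<And>y z. pmf (W x y) z = pmf (W x' y) z) \<Longrightarrow> x = x'" for x x'
      using nf unfolding normal_form_def by blast
    show "markov D (\<lambda>w. (oM12 w, oM31 w)) oX (\<lambda>w. (oY w, oZ w))"
      using priv by (simp add: is_private_def)
  qed (simp_all add: indep pos margX cor' supp)
  show "determines D (\<lambda>w. (oM12 w, oM23 w)) oY"
  proof (rule input_determined[where Y = oX and Z = oZ and pX = "pmf pY" and pY = "pmf pX" and W = "\<lambda>y x. W x y"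
        and k = "\<lambda>y m. pmf pY y * \<beta> y (fst m) (snd m)"])
    show "measure_pmf.prob D {w. (oM12 w, oM23 w) = m \<and> oY w = y \<and> oX w = x \<and> oZ w = z}
       * (pmf pY y' * \<beta> y' (fst m) (snd m))
      = measure_pmf.prob D {w. (oM12 w, oM23 w) = m \<and> oY w = y' \<and> oX w = x \<and> oZ w = z}
       * (pmf pY y * \<beta> y (fst m) (snd m))" for m x y y' z
    proof (cases m)
      case (Pair a b)
      show ?thesis
        unfolding Pair by (rule prob_scale[OF _ _ _ _ _ prob_outcome_conj(2) prob_outcome_conj(2)])
          (simp_all add: pD nonneg mult_ac)
    qed
    show "(\<And>x z. pmf (W x y) z = pmf (W x y') z) \<Longrightarrow> y = y'" for y y'
      using nf unfolding normal_form_def by blast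
    show "markov D (\<lambda>w. (oM12 w, oM23 w)) oY (\<lambda>w. (oX w, oZ w))"
      using priv by (simp add: is_private_def)
    have swap: "{w. oY w = y \<and> oX w = x} = {w. oX w = x \<and> oY w = y}"
      "{w. oY w = y \<and> oX w = x \<and> oZ w = z} = {w. oX w = x \<and> oY w = y \<and> oZ w = z}" for x y z
      by auto
    show "measure_pmf.prob D {w. oY w = y \<and> oX w = x} = pmf pY y * pmf pX x"
      and "measure_pmf.prob D {w. oY w = y \<and> oX w = x \<and> oZ w = z}
        = measure_pmf.prob D {w. oY w = y \<and> oX w = x} * pmf (W x y) z" for x y z
      unfolding swap by (simp_all add: indep cor')
  qed (simp_all add: pos margY supp)
  show "determines D (\<lambda>w. (oM23 w, oM31 w)) oZ"
    unfolding determines_def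
  proof (intro ballI impI)
    fix v w assume v: "v \<in> set_pmf D" and w: "w \<in> set_pmf D" and M: "(oM23 v, oM31 v) = (oM23 w, oM31 w)"
    define b c where "b = oM23 w" and "c = oM31 w"
    let ?k = "\<lambda>z. pmf (outp P b c) z"
    let ?pz = "\<lambda>z. measure_pmf.prob D {u. oZ u = z}"
    define \<nu> where "\<nu> z = measure_pmf.prob D {u. (oM23 u, oM31 u) = (b, c) \<and> oZ u = z}" for z
    define J where "J x y z = measure_pmf.prob D {w. (oM23 w, oM31 w) = (b, c) \<and> oX w = x \<and> oY w = y \<and> oZ w = z}" for x y z
    have J: "J x y z * ?pz z = \<nu> z * (pmf pX x * pmf pY y * pmf (W x y) z)" for x y z
    proof -
      have "measure_pmf.prob D {w. (oM23 w, oM31 w) = (b, c) \<and> oZ w = z \<and> (oX w, oY w) = (x, y)} * ?pz z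
        = \<nu> z * measure_pmf.prob D {w. oZ w = z \<and> (oX w, oY w) = (x, y)}"
        using priv unfolding is_private_def markov_def \<nu>_def by blast
      moreover have "{w. (oM23 w, oM31 w) = (b, c) \<and> oZ w = z \<and> (oX w, oY w) = (x, y)}
         = {w. (oM23 w, oM31 w) = (b, c) \<and> oX w = x \<and> oY w = y \<and> oZ w = z}"
        "{w. oZ w = z \<and> (oX w, oY w) = (x, y)} = {w. oX w = x \<and> oY w = y \<and> oZ w = z}" by blast+
      ultimately show ?thesis by (simp only: J_def cor')
    qed
    have scale: "J x y z * ?k z' = J x y z' * ?k z" for x y z z'
      unfolding J_def
      by (rule prob_scale[OF _ _ _ _ _ prob_outcome_conj(3) prob_outcome_conj(3)])
         (simp_all add: pD nonneg mult_ac)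
    have \<nu>pos: "\<nu> (oZ v) > 0" "\<nu> (oZ w) > 0"
      unfolding \<nu>_def by (rule prob_pos_of_mem[OF v] prob_pos_of_mem[OF w]; use M in \<open>simp add: b_def c_def\<close>)+
    have zpos: "?pz (oZ v) > 0" "?pz (oZ w) > 0"
      by (rule prob_pos_of_mem[OF v] prob_pos_of_mem[OF w]; simp)+
    have kpos: "?k (oZ v) > 0" "?k (oZ w) > 0"
      using supp(3)[OF v] supp(3)[OF w] M by (simp_all add: b_def c_def)
    \<comment> \<open>Outputs index columns of \<open>W\<close>, which carry no normalisation, so
      the factor need not be 1. It depends on neither \<open>x\<close> nor \<open>y\<close>, which
      is what the third clause of \<open>normal_form\<close> asks for.\<close>
    have "pmf (W x y) (oZ v) = (\<nu> (oZ w) * ?k (oZ v) * ?pz (oZ v)) / (\<nu> (oZ v) * ?k (oZ w) * ?pz (oZ w))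
        * pmf (W x y) (oZ w)" for x y
    proof -
      let ?q = "pmf pX x * pmf pY y"
      have "?q * (\<nu> (oZ v) * ?k (oZ w) * ?pz (oZ w) * pmf (W x y) (oZ v))
        = (J x y (oZ v) * ?pz (oZ v)) * ?k (oZ w) * ?pz (oZ w)" by (simp add: J mult_ac)
      also have "\<dots> = (J x y (oZ w) * ?pz (oZ w)) * ?k (oZ v) * ?pz (oZ v)"
        using scale[of x y "oZ v" "oZ w"] by (simp add: mult_ac)
      also have "\<dots> = ?q * (\<nu> (oZ w) * ?k (oZ v) * ?pz (oZ v) * pmf (W x y) (oZ w))" by (simp add: J mult_ac)
      finally have "\<nu> (oZ v) * ?k (oZ w) * ?pz (oZ w) * pmf (W x y) (oZ v)
        = \<nu> (oZ w) * ?k (oZ v) * ?pz (oZ v) * pmf (W x y) (oZ w)"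
        using pos(1)[of x] pos(2)[of y] by simp
      then show ?thesis using \<nu>pos zpos kpos by (simp add: field_simps)
    qed
    then show "oZ v = oZ w"
      using nf unfolding normal_form_def by blast
  qed
qed

section \<open>Residual information\<close>

lemma ent_inf_eq_cond_ent: "ent_inf (map_pmf f D) = cond_ent D f (\<lambda>_. ())"
proof -
  let ?p = "map_pmf f D"
  have cell: "cell D (\<lambda>v. (f v, ())) w = pmf ?p (f w)" "cell D (\<lambda>_. ()) w = 1" for w
    by (simp_all add: cell_def pmf_map vimage_def)
  have "cond_ent D f (\<lambda>_. ()) = (\<integral>\<^sup>+ a. ennreal (- log 2 (pmf ?p a)) \<partial>measure_pmf ?p)"
    by (simp add: cond_ent_def cell)
  also have "\<dots> = (\<integral>\<^sup>+ a. ennreal (pmf ?p a) * ennreal (- log 2 (pmf ?p a)) \<partial>count_space UNIV)"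
    by (rule nn_integral_measure_pmf)
  also have "\<dots> = ent_inf ?p"
    unfolding ent_inf_def by (intro nn_integral_cong) (simp flip: ennreal_mult')
  finally show ?thesis by simp
qed

lemma ent_nonneg: "0 \<le> ent p"
  unfolding ent_def
proof (rule sum_nonneg)
  fix a assume "a \<in> set_pmf p"
  then have "log 2 (pmf p a) \<le> 0" by (simp add: pmf_positive pmf_le_1)
  then show "0 \<le> - pmf p a * log 2 (pmf p a)" by (simp add: mult_nonneg_nonpos)
qed

lemma H_nonneg: "0 \<le> H D f"
  by (simp add: H_def ent_nonneg)

lemma ennreal_H:
  assumes "finite (f ` set_pmf D)"
  shows "ennreal (H D f) = cond_ent D f (\<lambda>_. ())"
proof -
  let ?p = "map_pmf f D"
  have nonneg: "0 \<le> - pmf ?p a * log 2 (pmf ?p a)" for a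
  proof (cases "pmf ?p a = 0")
    case False
    then have "log 2 (pmf ?p a) \<le> 0" by (simp add: pmf_le_1 order_less_le)
    then show ?thesis by (simp add: mult_nonneg_nonpos)
  qed simp
  have "ent_inf ?p = (\<Sum>a\<in>set_pmf ?p. ennreal (- pmf ?p a * log 2 (pmf ?p a)))"
    unfolding ent_inf_def using assms
    by (intro nn_integral_count_space') (simp_all add: pmf_eq_0_set_pmf[THEN iffD2] del: set_map_pmf, simp)
  also have "\<dots> = ennreal (ent ?p)"
    unfolding ent_def by (rule sum_ennreal) (rule nonneg)
  finally show ?thesis by (simp add: H_def ent_inf_eq_cond_ent)
qed

lemma finite_image_set_pmf: "finite (f ` set_pmf D)" for f :: "'w \<Rightarrow> 'c::finite"
  by simp

lemma H_cong:
  assumes "finite (f ` set_pmf D)" "finite (f' ` set_pmf D)"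
    and "\<And>v w. v \<in> set_pmf D \<Longrightarrow> w \<in> set_pmf D \<Longrightarrow> f v = f w \<longleftrightarrow> f' v = f' w"
  shows "H D f = H D f'"
proof -
  have "cond_ent D f (\<lambda>_. ()) = cond_ent D f' (\<lambda>_. ())" by (rule cond_ent_cong) (use assms(3) in blast)+
  then have "ennreal (H D f) = ennreal (H D f')" by (simp only: ennreal_H assms)
  then show ?thesis by (simp add: H_nonneg)
qed

lemma cond_ent_eq_cond_H:
  assumes "finite (f ` set_pmf D)" "finite (g ` set_pmf D)"
  shows "cond_ent D f g = ennreal (cond_H D f g)" and "0 \<le> cond_H D f g"
proof -
  have "(\<lambda>w. (f w, g w)) ` set_pmf D \<subseteq> f ` set_pmf D \<times> g ` set_pmf D" by auto
  then have fin: "finite ((\<lambda>w. (f w, g w)) ` set_pmf D)"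
    using assms finite_subset by blast
  have "ennreal (H D (\<lambda>w. (f w, g w))) = cond_ent D g (\<lambda>_. ()) + cond_ent D f (\<lambda>w. (g w, ()))"
    unfolding ennreal_H[OF fin] by (rule cond_ent_chain)
  also have "cond_ent D f (\<lambda>w. (g w, ())) = cond_ent D f g" by (rule cond_ent_cong) blast+
  finally have eq: "ennreal (H D (\<lambda>w. (f w, g w))) = ennreal (H D g) + cond_ent D f g"
    by (simp add: ennreal_H assms)
  then have "cond_ent D f g \<le> ennreal (H D (\<lambda>w. (f w, g w)))" by simp
  then obtain t where t: "cond_ent D f g = ennreal t" "0 \<le> t"
    by (cases "cond_ent D f g") (auto simp: top_unique)
  then have "H D (\<lambda>w. (f w, g w)) = H D g + t"
    using eq by (simp add: H_nonneg flip: ennreal_plus)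
  then show "cond_ent D f g = ennreal (cond_H D f g)" "0 \<le> cond_H D f g"
    using t by (simp_all add: cond_H_def)
qed

text \<open>Two values of \<open>X\<close> are linked if some value of \<open>Z\<close> is compatible with both; the classes
of the generated equivalence are the Gacs-Koerner common part of \<open>X\<close> and \<open>Z\<close>.\<close>

definition linked :: "'w pmf \<Rightarrow> ('w \<Rightarrow> 'x) \<Rightarrow> ('w \<Rightarrow> 'z) \<Rightarrow> ('x \<times> 'x) set" where
  "linked D X Z = {(X v, X w) | v w. v \<in> set_pmf D \<and> w \<in> set_pmf D \<and> Z v = Z w}"

text \<open>Classes are encoded as natural numbers because \<open>GK\<close> ranges over
  \<open>nat\<close>-valued functions; sets over a finite type are countable, so
  \<open>to_nat\<close> is injective on them.\<close>

definition common :: "'w pmf \<Rightarrow> ('w \<Rightarrow> 'x::finite) \<Rightarrow> ('w \<Rightarrow> 'z) \<Rightarrow> 'x \<Rightarrow> nat" where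
  "common D X Z x = to_nat {x'. (x, x') \<in> (linked D X Z)\<^sup>*}"

lemma sym_linked: "sym (linked D X Z)"
  unfolding sym_def linked_def by (clarsimp, metis)

lemma common_eqD: "common D X Z x = common D X Z x' \<Longrightarrow> (x, x') \<in> (linked D X Z)\<^sup>*"
proof -
  assume "common D X Z x = common D X Z x'"
  then have "{y. (x, y) \<in> (linked D X Z)\<^sup>*} = {y. (x', y) \<in> (linked D X Z)\<^sup>*}"
    by (simp only: common_def inj_eq[OF inj_to_nat])
  moreover have "(x', x') \<in> (linked D X Z)\<^sup>*" by simp
  ultimately show ?thesis by blast
qed

lemma common_linked:
  assumes "(x, x') \<in> linked D X Z" shows "common D X Z x = common D X Z x'"
proof -
  have "(x', x) \<in> linked D X Z" using sym_linked assms by (meson symD)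
  then have "{y. (x, y) \<in> (linked D X Z)\<^sup>*} = {y. (x', y) \<in> (linked D X Z)\<^sup>*}"
    using assms by (auto intro: converse_rtrancl_into_rtrancl)
  then show ?thesis by (simp only: common_def)
qed

text \<open>\<open>GK\<close> enters \<open>RI\<close> with a minus sign, so this yields RI(X;Z) <=
  I(X;Z) - H(Q) for the common part Q. The function \<open>\<psi>\<close> may choose any outcome
  with the given \<open>Z\<close>, as such outcomes are linked.\<close>

lemma H_common_le_GK:
  fixes X :: "'w \<Rightarrow> 'x::finite" and Z :: "'w \<Rightarrow> 'z"
  shows "H D (common D X Z \<circ> X) \<le> GK D X Z"
  unfolding GK_def
proof (rule cSup_upper)
  define \<psi> where "\<psi> z = common D X Z (X (SOME w. w \<in> set_pmf D \<and> Z w = z))" for z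
  have "common D X Z (X w) = \<psi> (Z w)" if w: "w \<in> set_pmf D" for w
  proof -
    have "(SOME v. v \<in> set_pmf D \<and> Z v = Z w) \<in> set_pmf D \<and> Z (SOME v. v \<in> set_pmf D \<and> Z v = Z w) = Z w"
      by (rule someI[of _ w]) (simp add: w)
    then have "(X w, X (SOME v. v \<in> set_pmf D \<and> Z v = Z w)) \<in> linked D X Z"
      using w unfolding linked_def by force
    then show ?thesis unfolding \<psi>_def by (rule common_linked)
  qed
  then show "H D (common D X Z \<circ> X) \<in> {H D (\<phi> \<circ> X) |(\<phi> :: 'x \<Rightarrow> nat) \<psi>. \<forall>w\<in>set_pmf D. \<phi> (X w) = \<psi> (Z w)}"
    by blast
  have "H D (\<phi> \<circ> X) \<le> H D X" for \<phi> :: "'x \<Rightarrow> nat"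
  proof -
    have fin: "finite (X ` set_pmf D)" by simp
    then have fin': "finite ((\<phi> \<circ> X) ` set_pmf D)" by (metis finite_imageI image_comp)
    have "cond_ent D (\<phi> \<circ> X) (\<lambda>_. ()) \<le> cond_ent D X (\<lambda>_. ())"
      by (rule cond_ent_mono_determines) (auto simp: determines_def)
    then show ?thesis by (simp add: ennreal_H[OF fin, symmetric] ennreal_H[OF fin', symmetric] H_nonneg)
  qed
  then show "bdd_above {H D (\<phi> \<circ> X) |(\<phi> :: 'x \<Rightarrow> nat) \<psi>. \<forall>w\<in>set_pmf D. \<phi> (X w) = \<psi> (Z w)}"
    by (intro bdd_aboveI[of _ "H D X"]) blast
qed

text \<open>For a possible pair \<open>(X w, Z w)\<close> the two Markov chains equate the law of
  \<open>C\<close> given \<open>X w\<close> and the law given \<open>Z w\<close> with the law given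
  both. Linked inputs share a value of \<open>Z\<close>.\<close>

lemma cprob_linked:
  assumes m: "markov D C X Z" "markov D C Z X" and l: "(x, x') \<in> linked D X Z"
  shows "cprob D C X c x = cprob D C X c x'"
proof -
  have eq: "cprob D C X c (X w) = cprob D C Z c (Z w)" if w: "w \<in> set_pmf D" for w
  proof -
    let ?P = "\<lambda>Q. measure_pmf.prob D {w. Q w}"
    have pos: "?P (\<lambda>v. X v = X w) > 0" "?P (\<lambda>v. Z v = Z w) > 0" "?P (\<lambda>v. X v = X w \<and> Z v = Z w) > 0"
      by (rule prob_pos_of_mem[OF w]; simp)+
    have "?P (\<lambda>v. C v = c \<and> X v = X w \<and> Z v = Z w) * ?P (\<lambda>v. X v = X w)
        = ?P (\<lambda>v. C v = c \<and> X v = X w) * ?P (\<lambda>v. X v = X w \<and> Z v = Z w)"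
      using m(1) unfolding markov_def by blast
    moreover have "?P (\<lambda>v. C v = c \<and> X v = X w \<and> Z v = Z w) * ?P (\<lambda>v. Z v = Z w)
        = ?P (\<lambda>v. C v = c \<and> Z v = Z w) * ?P (\<lambda>v. X v = X w \<and> Z v = Z w)"
    proof -
      have "{v. C v = c \<and> Z v = Z w \<and> X v = X w} = {v. C v = c \<and> X v = X w \<and> Z v = Z w}"
        "{v. Z v = Z w \<and> X v = X w} = {v. X v = X w \<and> Z v = Z w}" by blast+
      then show ?thesis
        using m(2)[unfolded markov_def, rule_format, of c "Z w" "X w"] by (simp only:)
    qed
    ultimately have "cprob D C X c (X w) = ?P (\<lambda>v. C v = c \<and> X v = X w \<and> Z v = Z w) / ?P (\<lambda>v. X v = X w \<and> Z v = Z w)"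
      "cprob D C Z c (Z w) = ?P (\<lambda>v. C v = c \<and> X v = X w \<and> Z v = Z w) / ?P (\<lambda>v. X v = X w \<and> Z v = Z w)"
      using pos unfolding cprob_def by (simp_all add: frac_eq_eq)
    then show ?thesis by simp
  qed
  obtain v w where "v \<in> set_pmf D" "w \<in> set_pmf D" "x = X v" "x' = X w" "Z v = Z w"
    using l unfolding linked_def by blast
  then show ?thesis using eq by metis
qed

lemma cprob_linked_rtrancl:
  assumes m: "markov D C X Z" "markov D C Z X" and "(x, x') \<in> (linked D X Z)\<^sup>*"
  shows "cprob D C X c x = cprob D C X c x'"
  using assms(3) by (induction rule: rtrancl_induct) (simp_all add: cprob_linked[OF m])

text \<open>The law of \<open>C\<close> given \<open>X\<close> is constant on each class, so it is a
  kernel \<open>\<kappa>\<close> of the class, and the joint law factorises through the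
  class.\<close>

lemma markov_common:
  fixes X :: "'w \<Rightarrow> 'x::finite"
  assumes m: "markov D C X Z" "markov D C Z X"
  shows "markov D C (common D X Z \<circ> X) X"
proof -
  define \<kappa> where "\<kappa> c q = cprob D C X c (X (SOME w. w \<in> set_pmf D \<and> common D X Z (X w) = q))" for c q
  have \<kappa>: "cprob D C X c (X w) = \<kappa> c (common D X Z (X w))" if w: "w \<in> set_pmf D" for c w
  proof -
    let ?v = "SOME v. v \<in> set_pmf D \<and> common D X Z (X v) = common D X Z (X w)"
    have "?v \<in> set_pmf D \<and> common D X Z (X ?v) = common D X Z (X w)"
      by (rule someI[of _ w]) (simp add: w)
    then have "(X ?v, X w) \<in> (linked D X Z)\<^sup>*" by (intro common_eqD) blast
    then have "cprob D C X c (X ?v) = cprob D C X c (X w)"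
      by (rule cprob_linked_rtrancl[OF m])
    then show ?thesis by (simp add: \<kappa>_def)
  qed
  show ?thesis
  proof (rule markovI_prod[where F = \<kappa> and G = "\<lambda>q x. measure_pmf.prob D {w. (common D X Z \<circ> X) w = q \<and> X w = x}"])
    fix c q x
    show "measure_pmf.prob D {w. C w = c \<and> (common D X Z \<circ> X) w = q \<and> X w = x}
      = \<kappa> c q * measure_pmf.prob D {w. (common D X Z \<circ> X) w = q \<and> X w = x}"
    proof (cases "common D X Z x = q \<and> (\<exists>w\<in>set_pmf D. X w = x)")
      case True
      then obtain w where w: "w \<in> set_pmf D" "X w = x" by blast
      have sets: "{w. C w = c \<and> (common D X Z \<circ> X) w = q \<and> X w = x} = {w. C w = c \<and> X w = x}"
        "{w. (common D X Z \<circ> X) w = q \<and> X w = x} = {w. X w = x}" using True by auto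
      have "measure_pmf.prob D {w. X w = x} > 0" using w by (intro prob_pos_of_mem[of w])
      then show ?thesis
        using \<kappa>[OF w(1), of c] True w(2) unfolding sets cprob_def by (simp add: field_simps)
    next
      case False
      have "measure_pmf.prob D {w. C w = c \<and> (common D X Z \<circ> X) w = q \<and> X w = x} = measure_pmf.prob D {}"
        "measure_pmf.prob D {w. (common D X Z \<circ> X) w = q \<and> X w = x} = measure_pmf.prob D {}"
        by (rule prob_cong_set_pmf; use False in auto)+
      then show ?thesis by simp
    qed
  qed (simp_all add: \<kappa>_def cprob_nonneg)
qed

text \<open>Secure data processing: \<open>RI(X;Z) \<le> I(A;B|C)\<close>.\<close>

lemma RI_le:
  fixes X :: "'w \<Rightarrow> 'x::finite" and Z :: "'w \<Rightarrow> 'z::finite"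
  assumes X: "determines D (\<lambda>w. (A w, C w)) X" and Z: "determines D (\<lambda>w. (B w, C w)) Z"
    and m: "markov D C X Z" "markov D C Z X"
  shows "cond_ent D A (\<lambda>w. (B w, C w)) + ennreal (RI D X Z) \<le> cond_ent D A C"
proof (cases "RI D X Z \<le> 0")
  \<comment> \<open>\<open>ennreal\<close> sends a nonpositive \<open>RI\<close> to 0, and the claim
    becomes that conditioning reduces entropy.\<close>
  case True
  have "cond_ent D A (\<lambda>w. (B w, C w)) \<le> cond_ent D A C"
    by (rule cond_ent_condition_determines) (auto simp: determines_def)
  then show ?thesis using True by (simp add: ennreal_neg)
next
  case False
  define Q where "Q = common D X Z \<circ> X"
  have finQ: "finite (Q ` set_pmf D)"
    unfolding Q_def image_comp[symmetric] by simp
  have Q: "cond_ent D X Q \<le> cond_ent D X C"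
  proof -
    have "cond_ent D X Q = cond_ent D X (\<lambda>w. (Q w, C w))"
      using cond_ent_markov[OF markov_sym[OF markov_common[OF m]]] by (simp add: Q_def)
    also have "\<dots> \<le> cond_ent D X C"
      by (rule order_trans[OF eq_refl cond_ent_condition[of D X C Q]]) (rule cond_ent_cong; blast)
    finally show ?thesis .
  qed
  have BC: "cond_ent D X (\<lambda>w. (B w, C w)) \<le> cond_ent D X Z"
  proof -
    have "cond_ent D X (\<lambda>w. (B w, C w)) \<le> cond_ent D X (\<lambda>w. (Z w, C w))"
      by (rule cond_ent_condition_determines) (use Z in \<open>unfold determines_def, blast\<close>)
    also have "\<dots> = cond_ent D X Z" by (rule cond_ent_markov[OF markov_sym[OF m(2)]])
    finally show ?thesis .
  qed
  \<comment> \<open>Since \<open>X\<close> is a function of \<open>(A, C)\<close>, joining it to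
    \<open>A\<close> changes neither entropy; the chain rule then splits off H(X|C) and H(X|B,C),
    which are compared with H(X|Q) and H(X|Z).\<close>
  have eq1: "cond_ent D A C = cond_ent D (\<lambda>w. (A w, X w)) C"
    by (rule cond_ent_cong) (use determinesD[OF X] in blast)+
  have eq2: "cond_ent D A (\<lambda>w. (B w, C w)) = cond_ent D (\<lambda>w. (A w, X w)) (\<lambda>w. (B w, C w))"
    by (rule cond_ent_cong) (use determinesD[OF X] in blast)+
  have "cond_ent D A (\<lambda>w. (X w, B w, C w)) \<le> cond_ent D A (\<lambda>w. (X w, C w))"
    by (rule cond_ent_condition_determines) (auto simp: determines_def)
  from add_mono[OF add_mono[OF BC this] Q] have main: "cond_ent D A (\<lambda>w. (B w, C w)) + cond_ent D X Q \<le> cond_ent D X Z + cond_ent D A C"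
    unfolding eq1 eq2 cond_ent_chain by (simp add: ac_simps)
  \<comment> \<open>I(X;Z) + H(X|Z) = H(X), while H(X|Q) = H(X) - H(Q) because \<open>Q\<close> is a
    function of \<open>X\<close>.\<close>
  have "RI D X Z + cond_H D X Z \<le> cond_H D X Q"
  proof -
    have "H D (\<lambda>w. (X w, Q w)) = H D X"
    proof (rule H_cong)
      have "(\<lambda>w. (X w, Q w)) ` set_pmf D \<subseteq> X ` set_pmf D \<times> Q ` set_pmf D" by auto
      then show "finite ((\<lambda>w. (X w, Q w)) ` set_pmf D)" using finQ finite_image_set_pmf[of X] by (meson finite_SigmaI finite_subset)
    qed (auto simp: Q_def)
    moreover have "H D Q \<le> GK D X Z" unfolding Q_def by (rule H_common_le_GK)
    ultimately show ?thesis by (simp add: RI_def MI_def cond_H_def)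
  qed
  then have "ennreal (RI D X Z) + cond_ent D X Z \<le> cond_ent D X Q"
    using False cond_ent_eq_cond_H[OF finite_image_set_pmf[of X] finite_image_set_pmf[of Z]] cond_ent_eq_cond_H[OF finite_image_set_pmf[of X] finQ]
    by (simp flip: ennreal_plus)
  from order_trans[OF add_left_mono[OF this] main]
  have "cond_ent D X Z + (cond_ent D A (\<lambda>w. (B w, C w)) + ennreal (RI D X Z)) \<le> cond_ent D X Z + cond_ent D A C"
    by (simp only: ac_simps)
  then show ?thesis
    using cond_ent_eq_cond_H(1)[OF finite_image_set_pmf[of X] finite_image_set_pmf[of Z]] by (simp add: ennreal_add_left_cancel_le)
qed

text \<open>\<open>RI_le\<close> wants its first variable determined by \<open>(A, C)\<close>. When
  the bounded link is one of Charlie's, that variable is \<open>oZ\<close>, so the roles must be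
  exchanged. Both suprema range over the same set, as the two functions agree on the
  support.\<close>

lemma RI_commute:
  fixes X :: "'w \<Rightarrow> 'x::finite" and Z :: "'w \<Rightarrow> 'z::finite"
  shows "RI D X Z = RI D Z X"
proof -
  have "H D (\<lambda>w. (X w, Z w)) = H D (\<lambda>w. (Z w, X w))" by (rule H_cong) auto
  moreover have "GK D X Z = GK D Z X"
  proof -
    have "{H D (\<phi> \<circ> X) |(\<phi> :: 'x \<Rightarrow> nat) \<psi>. \<forall>w\<in>set_pmf D. \<phi> (X w) = \<psi> (Z w)}
      = {H D (\<phi> \<circ> Z) |(\<phi> :: 'z \<Rightarrow> nat) \<psi>. \<forall>w\<in>set_pmf D. \<phi> (Z w) = \<psi> (X w)}"
    proof -
      have "H D (\<phi> \<circ> X) = H D (\<psi> \<circ> Z)" if "\<forall>w\<in>set_pmf D. \<phi> (X w) = \<psi> (Z w)" for \<phi> :: "'x \<Rightarrow> nat" and \<psi> :: "'z \<Rightarrow> nat"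
      proof -
        have "map_pmf (\<phi> \<circ> X) D = map_pmf (\<psi> \<circ> Z) D" using that by (intro map_pmf_cong) auto
        then show ?thesis by (simp only: H_def)
      qed
      then show ?thesis by (intro set_eqI iffI; clarsimp) metis+
    qed
    then show ?thesis by (simp only: GK_def)
  qed
  ultimately show ?thesis by (simp add: RI_def MI_def)
qed

text \<open>\<open>V\<close> is the pair of links at one party with data \<open>X\<close>, and
  \<open>U\<close> is the data of the other two. Privacy and determination give H(U|X) = H(U|V);
  given \<open>V\<close>, the remaining link \<open>B\<close> must carry all of
  \<open>U\<close>.\<close>

lemma cut_entropy:
  assumes m: "markov D V X U" and X: "determines D V X" and U: "determines D (\<lambda>w. (B w, V w)) U"
  shows "cond_ent D U X \<le> cond_ent D B V"
proof -
  have "cond_ent D U X = cond_ent D U (\<lambda>w. (X w, V w))" by (rule cond_ent_markov[OF markov_sym[OF m], symmetric])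
  also have "\<dots> = cond_ent D U V" by (rule cond_ent_cong) (use determinesD[OF X] in blast)+
  also have "\<dots> \<le> cond_ent D B V" by (rule cond_ent_mono_determines[OF U])
  finally show ?thesis .
qed

lemma ereal_le_enn2ereal:
  assumes "ennreal r \<le> E" shows "ereal r \<le> enn2ereal E"
proof -
  have "ereal r \<le> enn2ereal (ennreal r)" by (cases "0 \<le> r") (auto simp: ennreal_neg zero_ennreal.rep_eq)
  also have "\<dots> \<le> enn2ereal E" using assms by (simp add: less_eq_ennreal.rep_eq)
  finally show ?thesis .
qed

text \<open>The residual terms are real differences with no sign established, so they are separated
  by subadditivity of the truncation at 0.\<close>

lemma ennreal_add_le: "ennreal (r + s) \<le> ennreal r + ennreal s"
  by (cases "0 \<le> r"; cases "0 \<le> s") (auto simp: ennreal_neg ennreal_plus[symmetric] intro!: ennreal_leI simp del: ennreal_plus)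

theorem theorem3:
  fixes W :: "'x::finite \<Rightarrow> 'y::finite \<Rightarrow> 'z::finite pmf"
    and pX :: "'x pmf" and pY :: "'y pmf"
    and P :: "('x, 'y, 'z) protocol"
    and D :: "('x, 'y, 'z) outcome pmf"
  assumes "normal_form W"
    and "set_pmf pX = UNIV" and "set_pmf pY = UNIV"
    and "secure_protocol pX pY W P D"
  shows "ereal (RI D oX oZ + cond_H D (\<lambda>w. (oY w, oZ w)) oX) \<le> enn2ereal (ent_inf (map_pmf oM23 D))
       \<and> ereal (RI D oY oZ + cond_H D (\<lambda>w. (oX w, oZ w)) oY) \<le> enn2ereal (ent_inf (map_pmf oM31 D))
       \<and> ereal (RI D oX oZ + RI D oY oZ + cond_H D (\<lambda>w. (oX w, oY w)) oZ)
           \<le> enn2ereal (ent_inf (map_pmf oM12 D))"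
proof -
  note det = outcome_determines[OF assms]
  have dX: "oX v = oX w" if "v \<in> set_pmf D" "w \<in> set_pmf D" "oM12 v = oM12 w" "oM31 v = oM31 w" for v w
    using determinesD[OF det(1) that(1,2)] that(3,4) by simp
  have dY: "oY v = oY w" if "v \<in> set_pmf D" "w \<in> set_pmf D" "oM12 v = oM12 w" "oM23 v = oM23 w" for v w
    using determinesD[OF det(2) that(1,2)] that(3,4) by simp
  have dZ: "oZ v = oZ w" if "v \<in> set_pmf D" "w \<in> set_pmf D" "oM23 v = oM23 w" "oM31 v = oM31 w" for v w
    using determinesD[OF det(3) that(1,2)] that(3,4) by simp
  have priv: "markov D (\<lambda>w. (oM12 w, oM31 w)) oX (\<lambda>w. (oY w, oZ w))"
     "markov D (\<lambda>w. (oM12 w, oM23 w)) oY (\<lambda>w. (oX w, oZ w))"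
     "markov D (\<lambda>w. (oM23 w, oM31 w)) oZ (\<lambda>w. (oX w, oY w))"
    using assms(4) by (simp_all add: secure_protocol_def is_private_def)
  have J: "nonneg_interaction D oM12 oM23 oM31"
    using assms(4) unfolding secure_protocol_def by (blast intro: nonneg_interaction_outcome)
  have mXZ: "markov D oM31 oX oZ" "markov D oM31 oZ oX"
    using markov_decompose[OF markov_decompose_left[OF priv(1), of snd], of snd]
      markov_decompose[OF markov_decompose_left[OF priv(3), of snd], of fst] by simp_all
  have mYZ: "markov D oM23 oY oZ" "markov D oM23 oZ oY"
    using markov_decompose[OF markov_decompose_left[OF priv(2), of snd], of snd]
      markov_decompose[OF markov_decompose_left[OF priv(3), of fst], of snd] by simp_all
  have 1: "ennreal (RI D oX oZ + cond_H D (\<lambda>w. (oY w, oZ w)) oX) \<le> cond_ent D oM23 (\<lambda>_. ())"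
  proof -
    have "ennreal (RI D oX oZ + cond_H D (\<lambda>w. (oY w, oZ w)) oX)
      \<le> cond_ent D (\<lambda>w. (oY w, oZ w)) oX + ennreal (RI D oX oZ)"
      using ennreal_add_le by (simp add: cond_ent_eq_cond_H add.commute)
    also have "cond_ent D (\<lambda>w. (oY w, oZ w)) oX \<le> cond_ent D oM23 (\<lambda>w. (oM12 w, oM31 w))"
      by (rule cut_entropy[OF priv(1) det(1)]) (use dY dZ in \<open>unfold determines_def, blast\<close>)
    also have "cond_ent D oM23 (\<lambda>w. (oM12 w, oM31 w)) + ennreal (RI D oX oZ) \<le> cond_ent D oM23 oM31"
      unfolding RI_commute[of D oX oZ]
      by (rule RI_le[OF det(3) det(1) mXZ(2,1)])
    also have "\<dots> \<le> cond_ent D oM23 (\<lambda>_. ())" by (rule cond_ent_le_uncond)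
    finally show ?thesis by simp
  qed
  have 2: "ennreal (RI D oY oZ + cond_H D (\<lambda>w. (oX w, oZ w)) oY) \<le> cond_ent D oM31 (\<lambda>_. ())"
  proof -
    have "ennreal (RI D oY oZ + cond_H D (\<lambda>w. (oX w, oZ w)) oY)
      \<le> cond_ent D (\<lambda>w. (oX w, oZ w)) oY + ennreal (RI D oY oZ)"
      using ennreal_add_le by (simp add: cond_ent_eq_cond_H add.commute)
    also have "cond_ent D (\<lambda>w. (oX w, oZ w)) oY \<le> cond_ent D oM31 (\<lambda>w. (oM12 w, oM23 w))"
      by (rule cut_entropy[OF priv(2) det(2)]) (use dX dZ in \<open>unfold determines_def, blast\<close>)
    also have "cond_ent D oM31 (\<lambda>w. (oM12 w, oM23 w)) + ennreal (RI D oY oZ) \<le> cond_ent D oM31 oM23"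
      unfolding RI_commute[of D oY oZ]
      by (rule RI_le[OF _ det(2) mYZ(2,1)]) (use dZ in \<open>unfold determines_def, blast\<close>)
    also have "\<dots> \<le> cond_ent D oM31 (\<lambda>_. ())" by (rule cond_ent_le_uncond)
    finally show ?thesis by simp
  qed
  have 3: "ennreal (RI D oX oZ + RI D oY oZ + cond_H D (\<lambda>w. (oX w, oY w)) oZ) \<le> cond_ent D oM12 (\<lambda>_. ())"
  proof -
    let ?h = "cond_ent D oM12 (\<lambda>w. (oM23 w, oM31 w))"
    have "?h + ennreal (RI D oX oZ) \<le> cond_ent D oM12 oM31"
      by (rule RI_le[OF det(1,3) mXZ])
    moreover have "?h + ennreal (RI D oY oZ) \<le> cond_ent D oM12 oM23"
    proof -
      have "cond_ent D oM12 (\<lambda>w. (oM31 w, oM23 w)) + ennreal (RI D oY oZ) \<le> cond_ent D oM12 oM23"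
        by (rule RI_le[OF det(2) _ mYZ]) (use dZ in \<open>unfold determines_def, blast\<close>)
      moreover have "cond_ent D oM12 (\<lambda>w. (oM31 w, oM23 w)) = ?h" by (rule cond_ent_cong) blast+
      ultimately show ?thesis by simp
    qed
    moreover have "cond_ent D oM12 oM23 + cond_ent D oM12 oM31 \<le> cond_ent D oM12 (\<lambda>_. ()) + ?h"
      using J by (simp add: nonneg_interaction_def)
    ultimately have "(?h + ennreal (RI D oY oZ)) + (?h + ennreal (RI D oX oZ)) \<le> cond_ent D oM12 (\<lambda>_. ()) + ?h"
      by (meson add_mono order_trans)
    then have "?h + (?h + ennreal (RI D oX oZ) + ennreal (RI D oY oZ)) \<le> ?h + cond_ent D oM12 (\<lambda>_. ())"
      by (simp add: ac_simps)
    moreover have "?h \<le> cond_ent D oM12 (\<lambda>_. ())" by (rule cond_ent_le_uncond)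
    \<comment> \<open>One copy of \<open>?h\<close> is cancelled if it is finite; if it is infinite,
      so is H(A) and the bound is trivial.\<close>
    ultimately have le: "?h + ennreal (RI D oX oZ) + ennreal (RI D oY oZ) \<le> cond_ent D oM12 (\<lambda>_. ())"
      by (auto simp: ennreal_add_left_cancel_le top_unique)
    have "ennreal (RI D oX oZ + RI D oY oZ + cond_H D (\<lambda>w. (oX w, oY w)) oZ)
      \<le> ennreal (RI D oX oZ) + ennreal (RI D oY oZ) + ennreal (cond_H D (\<lambda>w. (oX w, oY w)) oZ)"
      by (meson add_right_mono ennreal_add_le order_trans)
    also have "\<dots> = cond_ent D (\<lambda>w. (oX w, oY w)) oZ + ennreal (RI D oX oZ) + ennreal (RI D oY oZ)"
      by (simp add: cond_ent_eq_cond_H ac_simps)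
    also have "cond_ent D (\<lambda>w. (oX w, oY w)) oZ \<le> ?h"
      by (rule cut_entropy[OF priv(3) det(3)]) (use dX dY in \<open>unfold determines_def, blast\<close>)
    also note le
    finally show ?thesis by (simp add: add_right_mono)
  qed
  show ?thesis
    unfolding ent_inf_eq_cond_ent by (intro conjI ereal_le_enn2ereal 1 2 3)
qed

end
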